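(* Let $D$ be a classical knot diagram in the sphere $S^2$ and let $a,a'$ be two arcs of $D$. Then there is a sequence of isotopies and Reidemeister moves which transforms $D$ to itself and transforms the arc $a$ to the arc $a'$.
   Context: An arc of a knot diagram is a part of the diagram which ends at crossings and contains no crossings in its interior. *)

theory Defs
  imports Main
begin

text \<open>
  Combinatorial model of classical knot diagrams in the sphere S^2.
  A diagram is a combinatorial map (rotation system) on a finite set of darts
  (half-edges): sg is the counterclockwise rotation of darts around their
  vertex, al is the fixed-point-free involution pairing the two darts of an
  edge.  Faces are the orbits of sg o al.  A connected map with
  V - E + F = 2 is exactly a cellular embedding of a graph in S^2, considered
  up to orientation-preserving homeomorphism of S^2 (= up to isotopy of S^2).
  Vertices of degree 4 are crossings; ov d says whether the strand through
  the dart d is the over-strand of that crossing.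
  A based diagram additionally carries one vertex of degree 2, a marked point
  on the diagram which is never touched by a Reidemeister move; it is used to
  track an arc through a sequence of moves.
\<close>

record kd =
  dts :: "nat set"
  sg  :: "nat \<Rightarrow> nat"
  al  :: "nat \<Rightarrow> nat"
  ov  :: "nat \<Rightarrow> bool"

definition orbit :: "('a \<Rightarrow> 'a) \<Rightarrow> 'a \<Rightarrow> 'a set" where
  "orbit f x = {(f ^^ n) x | n. True}"

definition norb :: "('a \<Rightarrow> 'a) \<Rightarrow> 'a set \<Rightarrow> nat" where
  "norb f H = card {orbit f x | x. x \<in> H}"

definition vdeg :: "kd \<Rightarrow> nat \<Rightarrow> nat" where
  "vdeg D d = card (orbit (sg D) d)"

definition fc :: "kd \<Rightarrow> nat \<Rightarrow> nat" where
  "fc D = sg D \<circ> al D"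

text \<open>continue straight ahead through a vertex (through a crossing, or through
  the degree-2 marked point)\<close>
definition straight :: "kd \<Rightarrow> nat \<Rightarrow> nat" where
  "straight D d = (if vdeg D d = 4 then sg D (sg D d) else sg D d)"

definition spherical_map :: "kd \<Rightarrow> bool" where
  "spherical_map D \<longleftrightarrow>
     finite (dts D) \<and> dts D \<noteq> {} \<and>
     bij_betw (sg D) (dts D) (dts D) \<and>
     bij_betw (al D) (dts D) (dts D) \<and>
     (\<forall>d\<in>dts D. al D (al D d) = d \<and> al D d \<noteq> d) \<and>
     (\<forall>x\<in>dts D. \<forall>y\<in>dts D.
        (x, y) \<in> ({(d, sg D d) | d. d \<in> dts D} \<union> {(d, al D d) | d. d \<in> dts D})\<^sup>*) \<and>
     int (norb (sg D) (dts D)) - int (norb (al D) (dts D)) + int (norb (fc D) (dts D)) = 2"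

definition crossing_data :: "kd \<Rightarrow> bool" where
  "crossing_data D \<longleftrightarrow> (\<forall>d\<in>dts D. vdeg D d = 4 \<longrightarrow> ov D (sg D d) = (\<not> ov D d))"

text \<open>the diagram consists of a single closed curve (one component)\<close>
definition one_component :: "kd \<Rightarrow> bool" where
  "one_component D \<longleftrightarrow> norb (straight D \<circ> al D) (dts D) = 2"

text \<open>A classical knot diagram in S^2 (with at least one crossing).\<close>
definition knot_diagram :: "kd \<Rightarrow> bool" where
  "knot_diagram D \<longleftrightarrow> spherical_map D \<and> (\<forall>d\<in>dts D. vdeg D d = 4) \<and>
     crossing_data D \<and> one_component D"

text \<open>A knot diagram in S^2 with one marked point (a degree-2 vertex).\<close>
definition based_diagram :: "kd \<Rightarrow> bool" where
  "based_diagram D \<longleftrightarrow> spherical_map D \<and> (\<forall>d\<in>dts D. vdeg D d \<in> {2, 4}) \<and>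
     card {orbit (sg D) d | d. d \<in> dts D \<and> vdeg D d = 2} = 1 \<and>
     crossing_data D \<and> one_component D"

text \<open>Arcs of a knot diagram: the parts of the diagram between consecutive
  crossings, i.e. the edges of the map.\<close>
definition arcs :: "kd \<Rightarrow> nat set set" where
  "arcs D = {{d, al D d} | d. d \<in> dts D}"

text \<open>Put the marked point on the arc {d, al D d}.\<close>
definition insert_bp :: "kd \<Rightarrow> nat \<Rightarrow> kd" where
  "insert_bp D d =
     (let p1 = Suc (Max (dts D)); p2 = Suc (Suc (Max (dts D))); e = al D d in
      \<lparr> dts = dts D \<union> {p1, p2},
        sg = (sg D)(p1 := p2, p2 := p1),
        al = (al D)(d := p1, p1 := d, p2 := e, e := p2),
        ov = (ov D)(p1 := False, p2 := False) \<rparr>)"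

text \<open>Isotopy of S^2: isomorphism of maps respecting rotations, edges and
  crossing information.\<close>
definition diag_iso :: "kd \<Rightarrow> kd \<Rightarrow> bool" where
  "diag_iso D E \<longleftrightarrow> (\<exists>f. bij_betw f (dts D) (dts E) \<and>
     (\<forall>d\<in>dts D. f (sg D d) = sg E (f d) \<and> f (al D d) = al E (f d) \<and>
        (vdeg D d = 4 \<longrightarrow> ov E (f d) = ov D d)))"

text \<open>Reidemeister I: insert a kink (either side, either crossing) into the
  edge {d, al D d}.\<close>
definition R1 :: "kd \<Rightarrow> kd \<Rightarrow> bool" where
  "R1 D E \<longleftrightarrow> (\<exists>d x1 x2 x3 x4 b rev.
     d \<in> dts D \<and> distinct [x1, x2, x3, x4] \<and> {x1, x2, x3, x4} \<inter> dts D = {} \<and>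
     E = \<lparr> dts = dts D \<union> {x1, x2, x3, x4},
           sg = (if rev then (sg D)(x1 := x2, x2 := x3, x3 := x4, x4 := x1)
                 else (sg D)(x1 := x4, x4 := x3, x3 := x2, x2 := x1)),
           al = (al D)(d := x1, x1 := d, x2 := x3, x3 := x2, x4 := al D d, al D d := x4),
           ov = (ov D)(x1 := b, x2 := (\<not> b), x3 := b, x4 := (\<not> b)) \<rparr>)"

text \<open>Reidemeister II: push a finger of the edge of d1 across the edge of d2,
  where d1, d2 lie on the boundary of a common face (and the edges differ),
  creating a bigon; the edge of d1 is over (b) or under at both new crossings.\<close>
definition R2 :: "kd \<Rightarrow> kd \<Rightarrow> bool" where
  "R2 D E \<longleftrightarrow> (\<exists>d1 d2 ue un uw us ve vn vw vs b.
     d1 \<in> dts D \<and> d2 \<in> orbit (fc D) d1 \<and> d2 \<noteq> d1 \<and> d2 \<noteq> al D d1 \<and>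
     distinct [ue, un, uw, us, ve, vn, vw, vs] \<and>
     {ue, un, uw, us, ve, vn, vw, vs} \<inter> dts D = {} \<and>
     E = \<lparr> dts = dts D \<union> {ue, un, uw, us, ve, vn, vw, vs},
           sg = (sg D)(ue := un, un := uw, uw := us, us := ue,
                       ve := vn, vn := vw, vw := vs, vs := ve),
           al = (al D)(d1 := vs, vs := d1, vn := un, un := vn, us := al D d1, al D d1 := us,
                       d2 := uw, uw := d2, ue := vw, vw := ue, ve := al D d2, al D d2 := ve),
           ov = (ov D)(us := b, un := b, vs := b, vn := b,
                       ue := (\<not> b), uw := (\<not> b), ve := (\<not> b), vw := (\<not> b)) \<rparr>)"

text \<open>Reidemeister III on a triangular face c1 -> c2 -> c3 (orbit of fc) with three
  distinct crossings, provided some side of the triangle is over at both of its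
  ends (i.e. the triangle is not alternating).  Notation: a_i = al c_i,
  p_i = sg c_(i+1), q_(i+1) = sg p_i; the move reconnects the rotation and moves
  the crossing information accordingly (edges unchanged).\<close>
definition R3 :: "kd \<Rightarrow> kd \<Rightarrow> bool" where
  "R3 D E \<longleftrightarrow> (\<exists>c1 c2 c3.
     let s = sg D; a1 = al D c1; a2 = al D c2; a3 = al D c3;
         p1 = s c2; p2 = s c3; p3 = s c1;
         q2 = s p1; q3 = s p2; q1 = s p3 in
     c1 \<in> dts D \<and> c2 \<in> dts D \<and> c3 \<in> dts D \<and>
     s a1 = c2 \<and> s a2 = c3 \<and> s a3 = c1 \<and>
     s q2 = a1 \<and> s q3 = a2 \<and> s q1 = a3 \<and>
     distinct [c1, c2, c3, a1, a2, a3, p1, p2, p3, q1, q2, q3] \<and>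
     ((ov D c1 \<and> ov D a1) \<or> (ov D c2 \<and> ov D a2) \<or> (ov D c3 \<and> ov D a3)) \<and>
     E = \<lparr> dts = dts D,
           sg = s(c1 := a2, a2 := q1, q1 := p2, p2 := c1,
                  c2 := a3, a3 := q2, q2 := p3, p3 := c2,
                  c3 := a1, a1 := q3, q3 := p1, p1 := c3),
           al = al D,
           ov = (ov D)(c1 := ov D a1, q1 := ov D a1, a2 := ov D c2, p2 := ov D c2,
                       c2 := ov D a2, q2 := ov D a2, a3 := ov D c3, p3 := ov D c3,
                       c3 := ov D a3, q3 := ov D a3, a1 := ov D c1, p1 := ov D c1) \<rparr>)"

text \<open>One step: an isotopy or a Reidemeister move (in either direction) between
  based diagrams; the marked point never enters the support of a move.\<close>
definition reid_step :: "kd \<Rightarrow> kd \<Rightarrow> bool" where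
  "reid_step D E \<longleftrightarrow> based_diagram D \<and> based_diagram E \<and>
     (diag_iso D E \<or> R1 D E \<or> R1 E D \<or> R2 D E \<or> R2 E D \<or> R3 D E \<or> R3 E D)"

definition reid_equiv :: "kd \<Rightarrow> kd \<Rightarrow> bool" where
  "reid_equiv = reid_step\<^sup>*\<^sup>*"

end

theory Submission
  imports Defs
begin

text \<open>
  The marked point can be pushed through a crossing \<open>c\<close> of the diagram as follows. Instead of the marked
  point, move the other strand \<open>t\<close> of \<open>c\<close>: it is sent the long way round the sphere, staying entirely
  below (or entirely above) the rest of the diagram, until it meets the marked strand on the other side of the
  marked point.

  While \<open>t\<close> sweeps the sphere it is recorded by the word of edges that it crosses. Contracting the
  region already swept to one vertex gives a planar map whose rotation at that vertex is this word together
  with the marked strand. Contracting one more edge is the passage of \<open>t\<close> over a crossing (Reidemeister II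
  and III). Once only one vertex is left, Euler's formula yields two loops bounding a face, one of which avoids
  the marked strand; \<open>t\<close> is pulled off this loop (Reidemeister II, or I if the loop contains an end of
  \<open>t\<close>). What remains is the single crossing of \<open>t\<close> with the marked strand.

  Iterating over the knot moves the marked point to every arc. A removal of a bigon is a legal
  Reidemeister II move only if the two freed edges lie on a common face; otherwise the result would be a
  connected map of Euler characteristic 4, contradicting the genus inequality.
\<close>

section \<open>Orbits of permutations\<close>

text \<open>The sweep must leave the marked strand alone, so \<open>r\<close> is never a letter of
  the word and contraction may use every edge leaving the swept region except that of
  \<open>r\<close>. This is harmless by parity: unswept vertices have degree 4, so a single edge
  cannot be all that leads to them. Once one vertex with N darts is left, Euler's formula gives 2F =
  N + 2 for the number F of faces, hence at least two faces of length one, and one of them lies off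
  the marked edge. The moves are equations between records on concrete darts, while the sweep knows
  a diagram only up to names. Therefore diagrams are handled through presentations by indices
  \<open>(k, d)\<close>, and the last step is an isotopy between two diagrams with the same
  presentation. At the start the crossing is dissolved into the marked point, and the strand of
  \<open>insert_bp D r\<close> appears as crossing the edge of \<open>l\<close>; two Reidemeister I
  moves make it cross the edges of \<open>u\<close> and \<open>v\<close> as well. The word
  \<open>[u, l, v]\<close> is then the rotation at the dissolved crossing without \<open>r\<close>.
  At the end the word is \<open>[al D r]\<close>, which describes
  \<open>insert_bp D l\<close>.\<close>

lemma distinct4_neq:
  assumes "distinct [x1, x2, x3, x4]"
  shows "x1 \<noteq> x2" "x1 \<noteq> x3" "x1 \<noteq> x4" "x2 \<noteq> x1" "x2 \<noteq> x3"
      "x2 \<noteq> x4" "x3 \<noteq> x1" "x3 \<noteq> x2" "x3 \<noteq> x4" "x4 \<noteq> x1"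
      "x4 \<noteq> x2" "x4 \<noteq> x3"
  using assms by auto

lemma distinct8_neq:
  assumes "distinct [x1, x2, x3, x4, x5, x6, x7, x8]"
  shows "x1 \<noteq> x2" "x1 \<noteq> x3" "x1 \<noteq> x4" "x1 \<noteq> x5" "x1 \<noteq> x6"
      "x1 \<noteq> x7" "x1 \<noteq> x8" "x2 \<noteq> x1" "x2 \<noteq> x3" "x2 \<noteq> x4"
      "x2 \<noteq> x5" "x2 \<noteq> x6" "x2 \<noteq> x7" "x2 \<noteq> x8" "x3 \<noteq> x1"
      "x3 \<noteq> x2" "x3 \<noteq> x4" "x3 \<noteq> x5" "x3 \<noteq> x6" "x3 \<noteq> x7"
      "x3 \<noteq> x8" "x4 \<noteq> x1" "x4 \<noteq> x2" "x4 \<noteq> x3" "x4 \<noteq> x5"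
      "x4 \<noteq> x6" "x4 \<noteq> x7" "x4 \<noteq> x8" "x5 \<noteq> x1" "x5 \<noteq> x2"
      "x5 \<noteq> x3" "x5 \<noteq> x4" "x5 \<noteq> x6" "x5 \<noteq> x7" "x5 \<noteq> x8"
      "x6 \<noteq> x1" "x6 \<noteq> x2" "x6 \<noteq> x3" "x6 \<noteq> x4" "x6 \<noteq> x5"
      "x6 \<noteq> x7" "x6 \<noteq> x8" "x7 \<noteq> x1" "x7 \<noteq> x2" "x7 \<noteq> x3"
      "x7 \<noteq> x4" "x7 \<noteq> x5" "x7 \<noteq> x6" "x7 \<noteq> x8" "x8 \<noteq> x1"
      "x8 \<noteq> x2" "x8 \<noteq> x3" "x8 \<noteq> x4" "x8 \<noteq> x5" "x8 \<noteq> x6" "x8 \<noteq> x7"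
  using assms by auto

lemma distinct12_neq:
  assumes "distinct [x1, x2, x3, x4, x5, x6, x7, x8, x9, x10, x11, x12]"
  shows "x1 \<noteq> x2" "x1 \<noteq> x3" "x1 \<noteq> x4" "x1 \<noteq> x5" "x1 \<noteq> x6"
      "x1 \<noteq> x7" "x1 \<noteq> x8" "x1 \<noteq> x9" "x1 \<noteq> x10" "x1 \<noteq> x11"
      "x1 \<noteq> x12" "x2 \<noteq> x1" "x2 \<noteq> x3" "x2 \<noteq> x4" "x2 \<noteq> x5"
      "x2 \<noteq> x6" "x2 \<noteq> x7" "x2 \<noteq> x8" "x2 \<noteq> x9" "x2 \<noteq> x10"
      "x2 \<noteq> x11" "x2 \<noteq> x12" "x3 \<noteq> x1" "x3 \<noteq> x2" "x3 \<noteq> x4"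
      "x3 \<noteq> x5" "x3 \<noteq> x6" "x3 \<noteq> x7" "x3 \<noteq> x8" "x3 \<noteq> x9"
      "x3 \<noteq> x10" "x3 \<noteq> x11" "x3 \<noteq> x12" "x4 \<noteq> x1" "x4 \<noteq> x2"
      "x4 \<noteq> x3" "x4 \<noteq> x5" "x4 \<noteq> x6" "x4 \<noteq> x7" "x4 \<noteq> x8"
      "x4 \<noteq> x9" "x4 \<noteq> x10" "x4 \<noteq> x11" "x4 \<noteq> x12" "x5 \<noteq> x1"
      "x5 \<noteq> x2" "x5 \<noteq> x3" "x5 \<noteq> x4" "x5 \<noteq> x6" "x5 \<noteq> x7"
      "x5 \<noteq> x8" "x5 \<noteq> x9" "x5 \<noteq> x10" "x5 \<noteq> x11" "x5 \<noteq> x12"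
      "x6 \<noteq> x1" "x6 \<noteq> x2" "x6 \<noteq> x3" "x6 \<noteq> x4" "x6 \<noteq> x5"
      "x6 \<noteq> x7" "x6 \<noteq> x8" "x6 \<noteq> x9" "x6 \<noteq> x10" "x6 \<noteq> x11"
      "x6 \<noteq> x12" "x7 \<noteq> x1" "x7 \<noteq> x2" "x7 \<noteq> x3" "x7 \<noteq> x4"
      "x7 \<noteq> x5" "x7 \<noteq> x6" "x7 \<noteq> x8" "x7 \<noteq> x9" "x7 \<noteq> x10"
      "x7 \<noteq> x11" "x7 \<noteq> x12" "x8 \<noteq> x1" "x8 \<noteq> x2" "x8 \<noteq> x3"
      "x8 \<noteq> x4" "x8 \<noteq> x5" "x8 \<noteq> x6" "x8 \<noteq> x7" "x8 \<noteq> x9"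
      "x8 \<noteq> x10" "x8 \<noteq> x11" "x8 \<noteq> x12" "x9 \<noteq> x1" "x9 \<noteq> x2"
      "x9 \<noteq> x3" "x9 \<noteq> x4" "x9 \<noteq> x5" "x9 \<noteq> x6" "x9 \<noteq> x7"
      "x9 \<noteq> x8" "x9 \<noteq> x10" "x9 \<noteq> x11" "x9 \<noteq> x12" "x10 \<noteq> x1"
      "x10 \<noteq> x2" "x10 \<noteq> x3" "x10 \<noteq> x4" "x10 \<noteq> x5" "x10 \<noteq> x6"
      "x10 \<noteq> x7" "x10 \<noteq> x8" "x10 \<noteq> x9" "x10 \<noteq> x11" "x10 \<noteq> x12"
      "x11 \<noteq> x1" "x11 \<noteq> x2" "x11 \<noteq> x3" "x11 \<noteq> x4" "x11 \<noteq> x5"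
      "x11 \<noteq> x6" "x11 \<noteq> x7" "x11 \<noteq> x8" "x11 \<noteq> x9" "x11 \<noteq> x10"
      "x11 \<noteq> x12" "x12 \<noteq> x1" "x12 \<noteq> x2" "x12 \<noteq> x3" "x12 \<noteq> x4"
      "x12 \<noteq> x5" "x12 \<noteq> x6" "x12 \<noteq> x7" "x12 \<noteq> x8" "x12 \<noteq> x9"
      "x12 \<noteq> x10" "x12 \<noteq> x11"
  using assms by auto

text \<open>The functions of a diagram are total and arbitrary off its darts, so being a permutation
  is relative to a finite set.\<close>

definition fperm :: "('a \<Rightarrow> 'a) \<Rightarrow> 'a set \<Rightarrow> bool" where
  "fperm f H \<longleftrightarrow> finite H \<and> bij_betw f H H"

lemma fperm_finite: "fperm f H \<Longrightarrow> finite H"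
  by (simp add: fperm_def)

lemma fperm_in: "fperm f H \<Longrightarrow> x \<in> H \<Longrightarrow> f x \<in> H"
  by (auto simp: fperm_def bij_betw_def)

lemma fperm_inj: "fperm f H \<Longrightarrow> x \<in> H \<Longrightarrow> y \<in> H \<Longrightarrow> f x
    = f y \<longleftrightarrow> x = y"
  by (auto simp: fperm_def bij_betw_def inj_on_def)

lemma fperm_onto: "fperm f H \<Longrightarrow> y \<in> H \<Longrightarrow> \<exists>x\<in>H. y = f x"
  by (auto simp: fperm_def bij_betw_def image_iff)

lemma fpermI:
  assumes "finite H" "\<And>x. x \<in> H \<Longrightarrow> f x \<in> H" "inj_on f H"
  shows "fperm f H"
  using assms by (simp add: fperm_def bij_betw_def endo_inj_surj image_subset_iff)

lemma fpermI_surj: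
  assumes "finite H" "\<And>x. x \<in> H \<Longrightarrow> f x \<in> H"
      "\<And>y. y \<in> H \<Longrightarrow> \<exists>x\<in>H. y = f x"
  shows "fperm f H"
proof -
  have "f ` H = H" using assms(2,3) by (auto simp: image_iff)
  then show ?thesis using assms(1) by (simp add: fperm_def bij_betw_def eq_card_imp_inj_on)
qed

lemma fperm_comp: "fperm f H \<Longrightarrow> fperm g H \<Longrightarrow> fperm (f \<circ> g) H"
  by (auto simp: fperm_def intro: bij_betw_trans)

lemma fperm_involution:
  assumes "finite H" "\<And>x. x \<in> H \<Longrightarrow> f x \<in> H"
      "\<And>x. x \<in> H \<Longrightarrow> f (f x) = x"
  shows "fperm f H"
  by (rule fpermI_surj) (use assms in metis)+

lemma orbit_self: "x \<in> orbit f x"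
  unfolding orbit_def by (rule CollectI, rule exI[of _ 0]) simp

lemma orbit_stepI: "y \<in> orbit f x \<Longrightarrow> f y \<in> orbit f x"
  unfolding orbit_def by clarify (metis funpow.simps(2) comp_apply)

lemma orbit_step: "f x \<in> orbit f x"
  by (simp add: orbit_self orbit_stepI)

lemma orbit_closed_subset:
  assumes "x \<in> S" "\<And>s. s \<in> S \<Longrightarrow> f s \<in> S"
  shows "orbit f x \<subseteq> S"
proof -
  have "(f ^^ n) x \<in> S" for n by (induction n) (auto simp: assms)
  then show ?thesis by (auto simp: orbit_def)
qed

lemma orbit_induct [consumes 1, case_names self step]:
  assumes "y \<in> orbit f x" "P x" "\<And>s. s \<in> orbit f x \<Longrightarrow> P s \<Longrightarrow> P
      (f s)"
  shows "P y"
proof -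
  have "orbit f x \<subseteq> {s \<in> orbit f x. P s}"
    by (rule orbit_closed_subset) (auto simp: assms orbit_self orbit_stepI)
  then show ?thesis using assms(1) by blast
qed

lemma orbit_trans: "y \<in> orbit f x \<Longrightarrow> z \<in> orbit f y \<Longrightarrow> z \<in> orbit
    f x"
  using orbit_closed_subset[of y "orbit f x" f] orbit_stepI by (metis subsetD)

lemma orbit_cong:
  assumes "x \<in> S" "\<And>s. s \<in> S \<Longrightarrow> f s \<in> S"
      "\<And>s. s \<in> S \<Longrightarrow> f s = g s"
  shows "orbit f x = orbit g x"
proof -
  have "(f ^^ n) x \<in> S \<and> (f ^^ n) x = (g ^^ n) x" for n
  proof (induction n)
    case (Suc n)
    have "f ((f ^^ n) x) \<in> S" "f ((f ^^ n) x) = g ((f ^^ n) x)" using Suc by (blast intro: assms)+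
    then show ?case using Suc by simp
  qed (simp add: assms(1))
  then show ?thesis by (auto simp: orbit_def)
qed

lemma orbit_subset: "fperm f H \<Longrightarrow> x \<in> H \<Longrightarrow> orbit f x \<subseteq> H"
  by (rule orbit_closed_subset) (auto simp: fperm_in)

lemma orbit_image: "fperm f H \<Longrightarrow> x \<in> H \<Longrightarrow> f ` orbit f x = orbit f x"
  by (rule endo_inj_surj)
    (auto simp: orbit_stepI fperm_def bij_betw_def intro: finite_subset[OF orbit_subset[unfolded fperm_def]]
      inj_on_subset[OF _ orbit_subset[unfolded fperm_def]])

text \<open>\<open>orbit\<close> collects forward iterates only. On a finite set a permutation maps
  each orbit onto itself, so \<open>x\<close> is reached again from \<open>f x\<close>; this makes
  orbits symmetric.\<close>

lemma orbit_eq_step: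
  assumes "fperm f H" "x \<in> H"
  shows "orbit f (f x) = orbit f x"
proof -
  have "x \<in> f ` orbit f x" using orbit_image[OF assms] orbit_self by metis
  then obtain z where "z \<in> orbit f x" "x = f z" by blast
  then obtain n where "x = f ((f ^^ n) x)" unfolding orbit_def by blast
  then have "x = (f ^^ n) (f x)" by (simp add: funpow_swap1)
  then have "x \<in> orbit f (f x)" unfolding orbit_def by blast
  then show ?thesis using orbit_trans orbit_step by (metis subsetI subset_antisym)
qed

lemma orbit_eq:
  assumes "fperm f H" "x \<in> H" "y \<in> orbit f x"
  shows "orbit f y = orbit f x"
proof -
  have "y \<in> H \<and> orbit f y = orbit f x" using assms(3)
    by (induction rule: orbit_induct) (auto simp: assms(2) fperm_in[OF assms(1)] orbit_eq_step[OF assms(1)])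
  then show ?thesis by simp
qed

lemma orbit_sym: "fperm f H \<Longrightarrow> x \<in> H \<Longrightarrow> y \<in> orbit f x
    \<Longrightarrow> x \<in> orbit f y"
  using orbit_eq orbit_self by metis

lemma orbit_disj:
  "fperm f H \<Longrightarrow> x \<in> H \<Longrightarrow> y \<in> H \<Longrightarrow> y \<notin> orbit f
      x \<Longrightarrow> orbit f x \<inter> orbit f y = {}"
  using orbit_eq orbit_self by (metis disjoint_iff)

lemma norb_image: "norb f H = card (orbit f ` H)"
  by (simp add: norb_def Setcompr_eq_image)

lemma norb_cong:
  assumes "\<And>x. x \<in> H \<Longrightarrow> f x \<in> H"
      "\<And>x. x \<in> H \<Longrightarrow> f x = g x"
  shows "norb f H = norb g H"
proof -
  have "orbit f x = orbit g x" if "x \<in> H" for x by (rule orbit_cong[OF that assms])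
  then have "orbit f ` H = orbit g ` H" by (rule image_cong[OF refl])
  then show ?thesis by (simp add: norb_image)
qed

text \<open>An \<open>f\<close>-orbit is sent to the \<open>g\<close>-orbit of the retraction of any
  of its points. This is well defined by \<open>step\<close>, injective by \<open>rev\<close> and
  \<open>near\<close>, and onto because the points of \<open>K\<close> are fixed by
  \<open>ret\<close>.\<close>

lemma norb_retract:
  assumes f: "fperm f H" and g: "fperm g K"
    and ret: "\<And>y. y \<in> H \<Longrightarrow> ret y \<in> K"
        "\<And>x. x \<in> K \<Longrightarrow> ret x = x"
    and KH: "K \<subseteq> H"
    and step: "\<And>y. y \<in> H \<Longrightarrow> ret (f y) \<in> orbit g (ret y)"
    and rev: "\<And>x. x \<in> K \<Longrightarrow> g x \<in> orbit f x"
    and near: "\<And>y. y \<in> H \<Longrightarrow> ret y \<in> orbit f y"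
  shows "norb f H = norb g K"
proof -
  have 1: "ret z \<in> orbit g (ret y)" if "y \<in> H" "z \<in> orbit f y" for y z
  proof -
    have "z \<in> H \<and> ret z \<in> orbit g (ret y)" using that(2)
      by (induction rule: orbit_induct)
        (use that(1) fperm_in[OF f] step in \<open>auto simp: orbit_self intro: orbit_trans\<close>)
    then show ?thesis by simp
  qed
  have 2: "orbit g x \<subseteq> orbit f x" if "x \<in> K" for x
  proof
    fix z assume "z \<in> orbit g x"
    then have "z \<in> K \<and> z \<in> orbit f x"
      by (induction rule: orbit_induct)
        (use that fperm_in[OF g] rev in \<open>auto simp: orbit_self intro: orbit_trans\<close>)
    then show "z \<in> orbit f x" by simp
  qed
  \<comment> \<open>The representative of an orbit is chosen by \<open>SOME\<close>; fact
    \<open>T\<close> shows that the choice does not matter.\<close>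
  let ?T = "\<lambda>C. orbit g (ret (SOME y. y \<in> H \<and> orbit f y = C))"
  have T: "?T (orbit f y) = orbit g (ret y)" if "y \<in> H" for y
  proof -
    have "(SOME z. z \<in> H \<and> orbit f z = orbit f y) \<in> H \<and>
        orbit f (SOME z. z \<in> H \<and> orbit f z = orbit f y) = orbit f y"
      by (rule someI[of _ y]) (simp add: that)
    then obtain z where z: "z = (SOME z. z \<in> H \<and> orbit f z = orbit f y)" "z \<in> H"
      "orbit f z = orbit f y" by blast
    have "ret z \<in> orbit g (ret y)" using 1[OF that] z(3) orbit_self by metis
    then show ?thesis using orbit_eq[OF g ret(1)[OF that]] z(1) by simp
  qed
  have "bij_betw ?T (orbit f ` H) (orbit g ` K)"
    unfolding bij_betw_def
  proof
    show "inj_on ?T (orbit f ` H)"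
    proof (rule inj_onI)
      fix C C' assume "C \<in> orbit f ` H" "C' \<in> orbit f ` H" and eq: "?T C = ?T C'"
      then obtain y y' where y: "y \<in> H" "C = orbit f y" and y': "y' \<in> H" "C' = orbit f y'" by blast
      have "orbit g (ret y) = orbit g (ret y')" using eq by (simp only: y(2) y'(2) T[OF y(1)] T[OF y'(1)])
      then have "ret y' \<in> orbit g (ret y)" by (simp add: orbit_self)
      then have "ret y' \<in> orbit f (ret y)" using 2 ret(1)[OF y(1)] by blast
      then have "ret y' \<in> orbit f y" using near[OF y(1)] orbit_trans by metis
      then have "orbit f (ret y') = orbit f y" by (rule orbit_eq[OF f y(1)])
      moreover have "orbit f (ret y') = orbit f y'" by (rule orbit_eq[OF f y'(1) near[OF y'(1)]])
      ultimately show "C = C'" using y y' by simp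
    qed
    have "?T ` (orbit f ` H) = (\<lambda>y. orbit g (ret y)) ` H"
      using T by (force simp: image_iff)
    also have "\<dots> = orbit g ` K"
    proof
      show "(\<lambda>y. orbit g (ret y)) ` H \<subseteq> orbit g ` K" using ret(1) by blast
      show "orbit g ` K \<subseteq> (\<lambda>y. orbit g (ret y)) ` H" using ret(2) KH by (auto simp:
          image_iff) (metis subsetD)
    qed
    finally show "?T ` (orbit f ` H) = orbit g ` K" .
  qed
  then show ?thesis unfolding norb_image by (rule bij_betw_same_card)
qed

lemma fperm_Diff:
  assumes "fperm f H" "C \<subseteq> H" "\<And>x. x \<in> C \<Longrightarrow> f x \<in> C"
  shows "fperm f (H - C)" "fperm f C"
proof -
  have fin: "finite C" using assms finite_subset fperm_finite by metis
  show C: "fperm f C" using assms fin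
    by (intro fpermI) (auto simp: fperm_def bij_betw_def intro: inj_on_subset)
  have "f x \<notin> C" if "x \<in> H - C" for x
  proof
    assume "f x \<in> C"
    then obtain z where "z \<in> C" "f x = f z" using fperm_onto[OF C] by blast
    then show False using that fperm_inj[OF assms(1)] assms(2) by auto
  qed
  then show "fperm f (H - C)" using assms
    by (intro fpermI) (auto simp: fperm_def bij_betw_def intro: inj_on_subset)
qed

text \<open>An invariant part of a finite permutation has an invariant complement, so no orbit meets
  both parts.\<close>

lemma norb_Un:
  assumes "fperm f (H \<union> C)" "H \<inter> C = {}" "\<And>x. x \<in> C \<Longrightarrow> f x \<in> C"
  shows "norb f (H \<union> C) = norb f H + norb f C"
proof -
  have C: "fperm f C" and H: "fperm f H"
    using fperm_Diff[OF assms(1) _ assms(3)] assms(2) by (auto simp: Un_Diff Diff_triv)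
  have "orbit f ` H \<inter> orbit f ` C = {}"
  proof -
    have False if "x \<in> H" "y \<in> C" "orbit f x = orbit f y" for x y
      using orbit_subset[OF H that(1)] orbit_subset[OF C that(2)] orbit_self[of y f] that(3) assms(2) by
          blast
    then show ?thesis by blast
  qed
  then show ?thesis
    using fperm_finite[OF H] fperm_finite[OF C] by (simp add: norb_image image_Un card_Un_disjoint)
qed

lemma norb_single:
  assumes "x \<in> H" "fperm f H" "\<And>y. y \<in> H \<Longrightarrow> y \<in> orbit f x"
  shows "norb f H = 1"
proof -
  have "orbit f y = orbit f x" if "y \<in> H" for y by (rule orbit_eq[OF assms(2,1) assms(3)[OF that]])
  then have "orbit f ` H = {orbit f x}" using assms(1) by blast
  then show ?thesis by (simp add: norb_image)
qed

lemma sum_orbit_card: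
  assumes "fperm f H"
  shows "(\<Sum>C\<in>orbit f ` H. card C) = card H"
proof -
  have "\<Union>(orbit f ` H) = H"
  proof
    show "\<Union>(orbit f ` H) \<subseteq> H" using orbit_subset[OF assms] by blast
    show "H \<subseteq> \<Union>(orbit f ` H)" using orbit_self by (metis UN_I subsetI)
  qed
  moreover have "card (\<Union>(orbit f ` H)) = (\<Sum>C\<in>orbit f ` H. card C)"
  proof (rule card_Union_disjoint)
    show "pairwise disjnt (orbit f ` H)"
    proof (clarsimp simp: pairwise_def disjnt_def)
      fix x y assume xy: "x \<in> H" "y \<in> H" "orbit f x \<noteq> orbit f y"
      then have "y \<notin> orbit f x" using orbit_eq[OF assms xy(1)] by metis
      then show "orbit f x \<inter> orbit f y = {}" by (rule orbit_disj[OF assms xy(1,2)])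
    qed
    show "finite C" if "C \<in> orbit f ` H" for C
      using that orbit_subset[OF assms] fperm_finite[OF assms] finite_subset by blast
  qed
  ultimately show ?thesis by simp
qed

lemma norb_uniform:
  assumes "fperm f H" "\<And>x. x \<in> H \<Longrightarrow> card (orbit f x) = k"
  shows "norb f H * k = card H"
proof -
  have "(\<Sum>C\<in>orbit f ` H. card C) = (\<Sum>C\<in>orbit f ` H. k)"
    by (rule sum.cong) (auto simp: assms(2))
  then show ?thesis using sum_orbit_card[OF assms(1)] by (simp add: norb_image)
qed

lemma norb_involution:
  assumes "finite H" "\<And>x. x \<in> H \<Longrightarrow> f x \<in> H \<and> f (f x) = x \<and> f x
      \<noteq> x"
  shows "norb f H * 2 = card H"
proof (rule norb_uniform)
  show "fperm f H" using assms by (intro fperm_involution) auto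
  fix x assume x: "x \<in> H"
  have "orbit f x = {x, f x}"
    using orbit_closed_subset[of x "{x, f x}" f] assms(2)[OF x] orbit_self[of x f] orbit_step[of f x] by
        auto
  then show "card (orbit f x) = 2" using assms(2)[OF x] by (metis card_2_iff)
qed

section \<open>Cycle counts after multiplication by a transposition, and the genus
  inequality\<close>

lemma fperm_swap: "fperm f H \<Longrightarrow> a \<in> H \<Longrightarrow> b \<in> H \<Longrightarrow>
    fperm (f(a := f b, b := f a)) H"
  by (rule fpermI) (auto simp: fperm_finite fperm_in inj_on_def fperm_inj)

text \<open>\<open>f(a := f b, b := f a)\<close> is \<open>f\<close> precomposed with the
  transposition of \<open>a\<close> and \<open>b\<close>. From \<open>a\<close> it runs through the
  old cycle of \<open>b\<close> and then through that of \<open>a\<close>.\<close>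

lemma orbit_merge:
  assumes f: "fperm f H" and ab: "a \<in> H" "b \<in> H" and nb: "b \<notin> orbit f a"
  shows "orbit (f(a := f b, b := f a)) a = orbit f a \<union> orbit f b"
proof -
  let ?g = "f(a := f b, b := f a)"
  have ne: "a \<noteq> b" using nb orbit_self by metis
  have na: "a \<notin> orbit f b" using nb orbit_sym[OF f ab(2)] by metis
  have g: "fperm ?g H" by (rule fperm_swap[OF f ab])
  \<comment> \<open>A map \<open>h\<close> that enters the old cycle of \<open>x\<close> from
    \<open>y\<close>, at the point \<open>f x\<close>, follows this cycle until it arrives at
    \<open>x\<close>.\<close>
  have loop: "z = x \<or> z \<in> orbit h y"
    if z: "z \<in> orbit f x" and h: "h y = f x"
        "\<And>s. s \<in> orbit f x \<Longrightarrow> s \<noteq> x \<Longrightarrow> h s = f s"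
    for x y z and h :: "'a \<Rightarrow> 'a"
    using z
  proof (induction rule: orbit_induct)
    case (step s)
    show ?case
    proof (cases "s = x")
      case True then show ?thesis using h(1) orbit_step[of h y] by simp
    next
      case False then show ?thesis using step h(2)[OF step(1)] orbit_stepI[of s h y] by auto
    qed
  qed simp
  have loop': "orbit f x \<subseteq> orbit h y"
    if "h y = f x" "\<And>s. s \<in> orbit f x \<Longrightarrow> s \<noteq> x \<Longrightarrow> h s = f s"
        "x \<in> H" for x y and h :: "'a \<Rightarrow> 'a"
  proof -
    have l: "z \<in> orbit f x \<Longrightarrow> z = x \<or> z \<in> orbit h y" for z by (rule loop[OF _
        that(1,2)])
    have "x \<in> f ` orbit f x" using orbit_image[OF f that(3)] orbit_self by metis
    then obtain z where z: "z \<in> orbit f x" "x = f z" by blast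
    have "x \<in> orbit h y"
    proof (cases "z = x")
      case True then show ?thesis using z(2) that(1) orbit_step[of h y] by simp
    next
      case False then show ?thesis using l[OF z(1)] z that(2)[OF z(1)] orbit_stepI[of z h y] by auto
    qed
    then show ?thesis using l by blast
  qed
  have A: "orbit f a \<subseteq> orbit ?g b"
  proof (rule loop'[where h = ?g and x = a and y = b])
    show "?g s = f s" if "s \<in> orbit f a" "s \<noteq> a" for s using that nb by auto
  qed (simp_all add: ab)
  have B: "orbit f b \<subseteq> orbit ?g a"
  proof (rule loop'[where h = ?g and x = b and y = a])
    show "?g s = f s" if "s \<in> orbit f b" "s \<noteq> b" for s using that na by auto
  qed (simp_all add: ab ne)
  show "orbit ?g a = orbit f a \<union> orbit f b"
  proof
    show "orbit ?g a \<subseteq> orbit f a \<union> orbit f b"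
    proof (rule orbit_closed_subset)
      show "a \<in> orbit f a \<union> orbit f b" by (simp add: orbit_self)
      fix s assume "s \<in> orbit f a \<union> orbit f b"
      then show "?g s \<in> orbit f a \<union> orbit f b"
        using orbit_step[of f a] orbit_step[of f b] orbit_stepI[of s f a] orbit_stepI[of s f b]
        by (cases "s = a"; cases "s = b") (simp_all, blast)
    qed
    have "b \<in> orbit ?g a" using B orbit_self[of b f] by blast
    then have "orbit ?g b = orbit ?g a" by (rule orbit_eq[OF g ab(1)])
    then show "orbit f a \<union> orbit f b \<subseteq> orbit ?g a" using A B by simp
  qed
qed

lemma norb_merge:
  assumes f: "fperm f H" and ab: "a \<in> H" "b \<in> H" and nb: "b \<notin> orbit f a"
  shows "Suc (norb (f(a := f b, b := f a)) H) = norb f H"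
proof -
  let ?g = "f(a := f b, b := f a)"
  have g: "fperm ?g H" by (rule fperm_swap[OF f ab])
  have AB: "orbit ?g a = orbit f a \<union> orbit f b" by (rule orbit_merge[OF assms])
  have rest: "orbit ?g x = orbit f x" if "x \<in> H - (orbit f a \<union> orbit f b)" for x
  proof -
    have x: "x \<in> H" using that by simp
    show ?thesis
    proof (rule orbit_cong[of _ "orbit f x", symmetric])
      fix s assume s: "s \<in> orbit f x"
      have "s \<noteq> a" "s \<noteq> b" using orbit_sym[OF f x s] that by auto
      then show "f s = ?g s" by simp
    qed (auto simp: orbit_self orbit_stepI)
  qed
  let ?R = "H - (orbit f a \<union> orbit f b)"
  have HR: "H = orbit f a \<union> orbit f b \<union> ?R" using orbit_subset[OF f] ab by blast
  have 1: "orbit f ` H = {orbit f a, orbit f b} \<union> orbit f ` ?R"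
  proof -
    have "orbit f y = orbit f a" if "y \<in> orbit f a" for y by (rule orbit_eq[OF f ab(1) that])
    moreover have "orbit f y = orbit f b" if "y \<in> orbit f b" for y by (rule orbit_eq[OF f ab(2) that])
    ultimately show ?thesis using ab HR by blast
  qed
  have 2: "orbit ?g ` H = {orbit ?g a} \<union> orbit f ` ?R"
  proof -
    have "orbit ?g y = orbit ?g a" if "y \<in> orbit f a \<union> orbit f b" for y
      by (rule orbit_eq[OF g ab(1)]) (simp only: AB that)
    then have "orbit ?g ` (orbit f a \<union> orbit f b) = {orbit ?g a}" using orbit_self[of a f] by blast
    moreover have "orbit ?g ` ?R = orbit f ` ?R" by (rule image_cong[OF refl rest])
    moreover have "orbit ?g ` H = orbit ?g ` (orbit f a \<union> orbit f b) \<union> orbit ?g ` ?R"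
      using HR by (metis image_Un)
    ultimately show ?thesis by (simp only:)
  qed
  have d1: "orbit f a \<noteq> orbit f b" using nb orbit_self by metis
  have d2: "orbit f a \<notin> orbit f ` ?R" "orbit f b \<notin> orbit f ` ?R"
      "orbit ?g a \<notin> orbit f ` ?R"
  proof -
    have "orbit f x \<noteq> orbit f a" "orbit f x \<noteq> orbit f b" if "x \<in> ?R" for x
      using that orbit_self[of x f] by auto
    then show "orbit f a \<notin> orbit f ` ?R" "orbit f b \<notin> orbit f ` ?R" by (metis imageE)+
    show "orbit ?g a \<notin> orbit f ` ?R"
    proof
      assume "orbit ?g a \<in> orbit f ` ?R"
      then obtain x where "x \<in> ?R" "orbit ?g a = orbit f x" by blast
      then show False using orbit_self[of x f] unfolding AB by blast
    qed
  qed
  have fin: "finite (orbit f ` ?R)" using fperm_finite[OF f] by simp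
  show ?thesis unfolding norb_image 1 2 using fin d1 d2 by simp
qed

text \<open>Swapping twice restores \<open>f\<close>. Once \<open>a\<close> and \<open>b\<close> are
  seen to lie on different cycles of the new map, the merging count applied to that map leads back
  to \<open>f\<close>.\<close>

lemma norb_split:
  assumes f: "fperm f H" and ab: "a \<in> H" "b \<in> H" "a \<noteq> b" and b: "b \<in> orbit f a"
  shows "norb (f(a := f b, b := f a)) H = Suc (norb f H)"
proof -
  let ?g = "f(a := f b, b := f a)"
  have g: "fperm ?g H" by (rule fperm_swap[OF f ab(1,2)])
  have "\<exists>k. (f ^^ k) a = b" using b by (auto simp: orbit_def)
  define k where "k = (LEAST k. (f ^^ k) a = b)"
  have k: "(f ^^ k) a = b" unfolding k_def by (rule LeastI_ex) fact
  have kmin: "(f ^^ j) a \<noteq> b" if "j < k" for j using that not_less_Least unfolding k_def by blast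
  have k0: "k > 0" using k ab(3) by (cases k) auto
  have na: "(f ^^ j) a \<noteq> a" if "0 < j" "j \<le> k" for j
  proof
    assume "(f ^^ j) a = a"
    then have "(f ^^ (k - j)) a = (f ^^ k) a"
      using that by (metis comp_apply funpow_add le_add_diff_inverse2)
    then show False using kmin[of "k - j"] that k by simp
  qed
  have "orbit ?g b \<subseteq> {(f ^^ j) a |j. 0 < j \<and> j \<le> k}"
  proof (rule orbit_closed_subset)
    show "b \<in> {(f ^^ j) a |j. 0 < j \<and> j \<le> k}" using k k0 by blast
    fix s assume "s \<in> {(f ^^ j) a |j. 0 < j \<and> j \<le> k}"
    then obtain j where j: "0 < j" "j \<le> k" "s = (f ^^ j) a" by blast
    show "?g s \<in> {(f ^^ j) a |j. 0 < j \<and> j \<le> k}"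
    proof (cases "j = k")
      case True
      then have "?g s = (f ^^ 1) a" using j k by simp
      then show ?thesis using k0 by (metis (mono_tags, lifting) Suc_leI mem_Collect_eq zero_less_one
          One_nat_def)
    next
      case False
      then have "?g s = (f ^^ Suc j) a" using j na[of j] kmin[of j] by simp
      then show ?thesis using j False by (metis (mono_tags, lifting) Suc_leI le_neq_implies_less
          mem_Collect_eq zero_less_Suc)
    qed
  qed
  then have "a \<notin> orbit ?g b" using na by (smt (verit, ccfv_SIG) mem_Collect_eq subsetD)
  then have "b \<notin> orbit ?g a" using orbit_sym[OF g ab(1)] by metis
  then have "Suc (norb (?g(a := ?g b, b := ?g a)) H) = norb ?g H" by (rule norb_merge[OF g ab(1,2)])
  moreover have "?g(a := ?g b, b := ?g a) = f" using ab(3) by auto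
  ultimately show ?thesis by simp
qed

lemma norb_swap_le:
  assumes "fperm f H" "a \<in> H" "b \<in> H"
  shows "norb (f(a := f b, b := f a)) H \<le> Suc (norb f H)"
proof (cases "a = b")
  case True then show ?thesis by (simp add: fun_upd_idem)
next
  case False then show ?thesis using norb_split[OF assms False] norb_merge[OF assms] by (cases "b \<in>
      orbit f a") auto
qed

text \<open>This is V + F \<le> E + 2 for a connected map. The points moved by \<open>t\<close> are
  the darts of \<open>m\<close> edges; the points fixed by \<open>t\<close> are loose darts. Loose
  darts keep \<open>H\<close> constant during the induction, because an edge is removed by letting
  \<open>t\<close> fix its two darts. An edge between two vertices is contracted, at the cost of one
  vertex and no face. If all edges are loops there is at most one vertex, and deleting a loop loses
  at most one face.\<close>

lemma genus_bound:
  assumes "fperm s H" "\<And>x. x \<in> H \<Longrightarrow> t x \<in> H \<and> t (t x) = x"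
    and "card {x \<in> H. t x \<noteq> x} = 2 * m"
    and "\<And>S. S \<subseteq> H \<Longrightarrow> S \<noteq> {} \<Longrightarrow> (\<And>x. x \<in> S
        \<Longrightarrow> s x \<in> S \<and> t x \<in> S) \<Longrightarrow> S = H"
  shows "norb (s \<circ> t) H + norb s H \<le> m + 2"
  using assms
proof (induction m arbitrary: s t)
  case 0
  have fin: "finite H" by (rule fperm_finite[OF 0(1)])
  have t: "t x = x" if "x \<in> H" for x using 0(3) that fin by auto
  have one: "norb s H \<le> 1"
  proof (cases "H = {}")
    case False
    then obtain x where x: "x \<in> H" by blast
    have "orbit s x = H"
    proof (rule 0(4))
      show sub: "orbit s x \<subseteq> H" by (rule orbit_subset[OF 0(1) x])
      show "orbit s x \<noteq> {}" using orbit_self[of x s] by auto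
      show "s y \<in> orbit s x \<and> t y \<in> orbit s x" if "y \<in> orbit s x" for y
        using that t sub orbit_stepI[OF that] by (simp add: subset_iff)
    qed
    then have "norb s H = 1" by (intro norb_single[OF x 0(1)]) simp
    then show ?thesis by simp
  qed (simp add: norb_image)
  have "norb (s \<circ> t) H = norb s H"
    by (rule norb_cong) (auto simp: t fperm_in[OF 0(1)])
  then show ?case using one by (simp only:)
next
  case (Suc m)
  have fin: "finite H" by (rule fperm_finite[OF Suc.prems(1)])
  note T = Suc.prems(2)
  obtain a0 where a0: "a0 \<in> H" "t a0 \<noteq> a0"
    using Suc.prems(3) by (metis (mono_tags, lifting) Collect_empty_eq card.empty nat.distinct(1)
        mult_eq_0_iff zero_neq_numeral)
  have red: "card {x \<in> H. (t(a := a, t a := t a)) x \<noteq> x} = 2 * m"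
    and tin: "\<And>x. x \<in> H \<Longrightarrow> (t(a := a, t a := t a)) x \<in> H \<and>
      (t(a := a, t a := t a)) ((t(a := a, t a := t a)) x) = x"
    if a: "a \<in> H" "t a \<noteq> a" for a
  proof -
    have "{x \<in> H. (t(a := a, t a := t a)) x \<noteq> x} = {x \<in> H. t x \<noteq> x} - {a, t a}" by
        auto
    moreover have "{a, t a} \<subseteq> {x \<in> H. t x \<noteq> x}" using a T[OF a(1)] by auto
    moreover have "card {a, t a} = 2" using a(2) by (metis card_2_iff)
    ultimately show "card {x \<in> H. (t(a := a, t a := t a)) x \<noteq> x} = 2 * m"
      using Suc.prems(3) fin by (simp add: card_Diff_subset)
    show "(t(a := a, t a := t a)) x \<in> H \<and>
      (t(a := a, t a := t a)) ((t(a := a, t a := t a)) x) = x" if x: "x \<in> H" for x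
      using T[OF x] T[OF a(1)] x a(1) by auto
  qed
  show ?case
  proof (cases "\<exists>a\<in>H. t a \<notin> orbit s a")
    case True
    then obtain a where a: "a \<in> H" "t a \<notin> orbit s a" by blast
    have ne: "t a \<noteq> a" using a(2) orbit_self[of a s] by auto
    \<comment> \<open>Contraction: exchanging the successors of \<open>a\<close> and
      \<open>t a\<close> merges their vertices, while the product \<open>s \<circ> t\<close> stays
      the same on \<open>H\<close>, so the faces persist.\<close>
    let ?s = "s(a := s (t a), t a := s a)" and ?t = "t(a := a, t a := t a)"
    have ta: "t a \<in> H" using T[OF a(1)] by simp
    have "norb (?s \<circ> ?t) H + norb ?s H \<le> m + 2"
    proof (rule Suc.IH)
      show "fperm ?s H" by (rule fperm_swap[OF Suc.prems(1) a(1) ta])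
      show "?t x \<in> H \<and> ?t (?t x) = x" if "x \<in> H" for x by (rule tin[OF a(1) ne that])
      show "card {x \<in> H. ?t x \<noteq> x} = 2 * m" by (rule red[OF a(1) ne])
      fix S assume S: "S \<subseteq> H" "S \<noteq> {}" and cl: "\<And>x. x \<in> S \<Longrightarrow> ?s
          x \<in> S \<and> ?t x \<in> S"
      have om: "orbit ?s a = orbit s a \<union> orbit s (t a)"
        by (rule orbit_merge[OF Suc.prems(1) a(1) ta a(2)])
      have "t a \<in> orbit ?s a" using om orbit_self[of "t a" s] by simp
      moreover from this have "a \<in> orbit ?s (t a)"
        by (rule orbit_sym[OF fperm_swap[OF Suc.prems(1) a(1) ta] a(1)])
      moreover have "x \<in> S \<Longrightarrow> orbit ?s x \<subseteq> S" for x
        by (rule orbit_closed_subset) (use cl in blast)+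
      ultimately have both: "a \<in> S \<longleftrightarrow> t a \<in> S" by blast
      show "S = H"
      proof (rule Suc.prems(4)[OF S])
        fix x assume x: "x \<in> S"
        show "s x \<in> S \<and> t x \<in> S"
        proof (cases "x = a \<or> x = t a")
          case True
          then have "a \<in> S" "t a \<in> S" using x both by auto
          then show ?thesis using cl[of a] cl[of "t a"] ne True T[OF a(1)] by auto
        next
          case False
          then show ?thesis using cl[OF x] by auto
        qed
      qed
    qed
    moreover have "norb (?s \<circ> ?t) H = norb (s \<circ> t) H"
    proof (rule norb_cong)
      show "(?s \<circ> ?t) x = (s \<circ> t) x" if x: "x \<in> H" for x
      proof -
        have *: "t (t a) = a" "t (t x) = x" using T[OF x] T[OF a(1)] by simp_all
        consider "x = a" | "x = t a" | "x \<noteq> a" "x \<noteq> t a" by blast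
        then show ?thesis
        proof cases
          case 3
          then have "t x \<noteq> a" "t x \<noteq> t a" using * by metis+
          then show ?thesis using 3 by simp
        qed (use ne * in simp_all)
      qed
      then show "x \<in> H \<Longrightarrow> (?s \<circ> ?t) x \<in> H" for x using T fperm_in[OF
          Suc.prems(1)] by simp
    qed
    moreover have "Suc (norb ?s H) = norb s H" by (rule norb_merge[OF Suc.prems(1) a(1) ta a(2)])
    ultimately show ?thesis by linarith
  next
    case False
    \<comment> \<open>If no edge joins different vertices, every vertex is closed under
      \<open>t\<close>, and connectedness leaves a single vertex.\<close>
    have orb: "orbit s x = H" if x: "x \<in> H" for x
    proof (rule Suc.prems(4))
      show sub: "orbit s x \<subseteq> H" by (rule orbit_subset[OF Suc.prems(1) x])
      show "orbit s x \<noteq> {}" using orbit_self[of x s] by auto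
      show "s y \<in> orbit s x \<and> t y \<in> orbit s x" if y: "y \<in> orbit s x" for y
      proof
        show "s y \<in> orbit s x" by (rule orbit_stepI[OF y])
        have "t y \<in> orbit s y" using False sub y by blast
        then show "t y \<in> orbit s x" by (rule orbit_trans[OF y])
      qed
    qed
    let ?t = "t(a0 := a0, t a0 := t a0)"
    have ta: "t a0 \<in> H" using T[OF a0(1)] by simp
    have "norb (s \<circ> ?t) H + norb s H \<le> m + 2"
    proof (rule Suc.IH[OF Suc.prems(1)])
      show "?t x \<in> H \<and> ?t (?t x) = x" if "x \<in> H" for x by (rule tin[OF a0 that])
      show "card {x \<in> H. ?t x \<noteq> x} = 2 * m" by (rule red[OF a0])
      fix S assume S: "S \<subseteq> H" "S \<noteq> {}" and cl: "\<And>x. x \<in> S \<Longrightarrow> s x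
          \<in> S \<and> ?t x \<in> S"
      then obtain x where x: "x \<in> S" by blast
      have "orbit s x \<subseteq> S" by (rule orbit_closed_subset[OF x]) (use cl in blast)
      then show "S = H" using orb S x by blast
    qed
    moreover have "norb (s \<circ> t) H \<le> Suc (norb (s \<circ> ?t) H)"
    proof -
      have p: "fperm (s \<circ> ?t) H"
        by (rule fperm_comp[OF Suc.prems(1) fperm_involution[OF fin]]) (use tin[OF a0] in blast)+
      \<comment> \<open>Restoring the edge of \<open>a0\<close> multiplies the face permutation by a
        transposition.\<close>
      have "s \<circ> t = (s \<circ> ?t)(a0 := (s \<circ> ?t) (t a0), t a0 := (s \<circ> ?t) a0)"
        using a0 T[OF a0(1)] by (auto simp: fun_eq_iff)
      then show ?thesis using norb_swap_le[OF p a0(1) ta] by simp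
    qed
    ultimately show ?thesis by linarith
  qed
qed

text \<open>The four points may coincide, so that 2-cycles are covered as well.\<close>

lemma orbit_cycle4:
  assumes "f a = b" "f b = c" "f c = d" "f d = a"
  shows "orbit f a = {a, b, c, d}"
proof
  show "orbit f a \<subseteq> {a, b, c, d}" by (rule orbit_closed_subset) (use assms in auto)
  show "{a, b, c, d} \<subseteq> orbit f a"
    using orbit_self[of a f] orbit_stepI[of _ f a] assms by (metis empty_subsetI insert_subset)
qed

lemma orbit_cycle2:
  assumes "f a = b" "f b = a"
  shows "orbit f a = {a, b}"
  using orbit_cycle4[of f a b a b] assms by auto

text \<open>The least positive period \<open>n\<close> parametrizes the orbit injectively by
  \<open>{..<n}\<close>, so it is the size of the orbit. This turns the vertex degrees, which are
  cardinalities, into equations for the rotation.\<close>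

lemma orbit_period:
  assumes f: "fperm f H" and x: "x \<in> H"
  shows "(f ^^ card (orbit f x)) x = x" "inj_on (\<lambda>i. (f ^^ i) x) {..<card (orbit f x)}"
proof -
  have "\<exists>n. 0 < n \<and> (f ^^ n) x = x"
  proof -
    have "x \<in> f ` orbit f x" using orbit_image[OF f x] orbit_self[of x f] by simp
    then obtain z where "z \<in> orbit f x" "x = f z" by blast
    then obtain n where "x = f ((f ^^ n) x)" unfolding orbit_def by blast
    then have "(f ^^ Suc n) x = x" by simp
    then show ?thesis by blast
  qed
  then obtain n where n: "0 < n" "(f ^^ n) x = x"
      "\<And>m. 0 < m \<Longrightarrow> m < n \<Longrightarrow> (f ^^ m) x \<noteq> x"
    using exists_least_iff[of "\<lambda>n. 0 < n \<and> (f ^^ n) x = x"] by auto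
  have inj: "inj_on (\<lambda>i. (f ^^ i) x) {..<n}"
  proof -
    have *: "(f ^^ i) x \<noteq> (f ^^ j) x" if "i < j" "j < n" for i j
    proof
      assume eq: "(f ^^ i) x = (f ^^ j) x"
      have "(f ^^ (n - j + i)) x = (f ^^ (n - j)) ((f ^^ i) x)" by (simp add: funpow_add)
      also have "\<dots> = (f ^^ (n - j + j)) x" unfolding eq by (simp add: funpow_add)
      also have "\<dots> = x" using n(2) that by simp
      finally have per: "(f ^^ (n - j + i)) x = x" .
      have "0 < n - j + i" "n - j + i < n" using that by linarith+
      then show False by (rule notE[OF n(3) per])
    qed
    have "i = j" if "(f ^^ i) x = (f ^^ j) x" "i < n" "j < n" for i j
    proof (rule ccontr)
      assume "i \<noteq> j"
      then consider "i < j" | "j < i" by linarith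
      then show False
      proof cases
        case 1
        show ?thesis by (rule notE[OF *[OF 1 that(3)] that(1)])
      next
        case 2
        show ?thesis by (rule notE[OF *[OF 2 that(2)] that(1)[symmetric]])
      qed
    qed
    then show ?thesis unfolding inj_on_def lessThan_iff by blast
  qed
  have "orbit f x = (\<lambda>i. (f ^^ i) x) ` {..<n}"
  proof
    show "orbit f x \<subseteq> (\<lambda>i. (f ^^ i) x) ` {..<n}"
    proof (rule orbit_closed_subset)
      show "x \<in> (\<lambda>i. (f ^^ i) x) ` {..<n}" using n(1) by (force intro: image_eqI[of _ _ 0])
      fix s assume "s \<in> (\<lambda>i. (f ^^ i) x) ` {..<n}"
      then obtain i where i: "i < n" "s = (f ^^ i) x" by blast
      have "f s = (f ^^ (if Suc i = n then 0 else Suc i)) x" using i n(2) by auto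
      moreover have "(if Suc i = n then 0 else Suc i) < n" using i by auto
      ultimately show "f s \<in> (\<lambda>i. (f ^^ i) x) ` {..<n}" by blast
    qed
    show "(\<lambda>i. (f ^^ i) x) ` {..<n} \<subseteq> orbit f x" unfolding orbit_def by blast
  qed
  then have "card (orbit f x) = n" using inj by (simp add: card_image)
  then show "(f ^^ card (orbit f x)) x = x" "inj_on (\<lambda>i. (f ^^ i) x) {..<card (orbit f x)}"
    using n(2) inj by simp_all
qed

lemma orbit_card4:
  assumes "fperm f H" "x \<in> H" "card (orbit f x) = 4"
  shows "f (f (f (f x))) = x" "distinct [x, f x, f (f x), f (f (f x))]"
    "orbit f x = {x, f x, f (f x), f (f (f x))}"
proof -
  show 1: "f (f (f (f x))) = x" using orbit_period(1)[OF assms(1,2)] assms(3) by (simp add: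
      eval_nat_numeral)
  show 2: "orbit f x = {x, f x, f (f x), f (f (f x))}" by (rule orbit_cycle4) (auto simp: 1)
  have "card (set [x, f x, f (f x), f (f (f x))]) = length [x, f x, f (f x), f (f (f x))]"
    using assms(3) 2 by simp
  then show "distinct [x, f x, f (f x), f (f (f x))]" by (rule card_distinct)
qed

lemma orbit_card2:
  assumes "fperm f H" "x \<in> H" "card (orbit f x) = 2"
  shows "f (f x) = x" "f x \<noteq> x"
proof -
  show 1: "f (f x) = x" using orbit_period(1)[OF assms(1,2)] assms(3) by (simp add: eval_nat_numeral)
  have "orbit f x = {x, f x}" by (rule orbit_cycle2) (auto simp: 1)
  then show "f x \<noteq> x" using assms(3) by auto
qed

section \<open>Planar diagrams\<close>

text \<open>The local part of a diagram: neither the sphere, nor the crossing data, nor the number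
  of components enters. This much is known of the result of a rewiring before the move is seen to be
  legal.\<close>

definition pre_diagram :: "kd \<Rightarrow> bool" where
  "pre_diagram D \<longleftrightarrow> dts D \<noteq> {} \<and> fperm (sg D) (dts D) \<and>
     (\<forall>d\<in>dts D. al D d \<in> dts D \<and> al D (al D d) = d \<and> al D d \<noteq> d) \<and>
     (\<forall>d\<in>dts D. vdeg D d \<in> {2, 4})"

definition deg2_vertices :: "kd \<Rightarrow> nat set set" where
  "deg2_vertices D = {orbit (sg D) d | d. d \<in> dts D \<and> vdeg D d = 2}"

text \<open>Connectedness is not listed, as it follows from having one component. Euler's formula is
  written additively to stay in the naturals.\<close>

definition planar_diagram :: "kd \<Rightarrow> bool" where
  "planar_diagram D \<longleftrightarrow> pre_diagram D \<and> crossing_data D \<and> one_component D \<and>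
     norb (sg D) (dts D) + norb (fc D) (dts D) = norb (al D) (dts D) + 2"

context
  fixes D assumes pre: "pre_diagram D"
begin

lemma pre_finite: "finite (dts D)"
  and pre_nonempty: "dts D \<noteq> {}"
  and pre_sg: "fperm (sg D) (dts D)"
  and pre_al: "fperm (al D) (dts D)"
  and pre_fc: "fperm (fc D) (dts D)"
  using pre fperm_finite[of "sg D" "dts D"] unfolding pre_diagram_def fc_def
  by (auto intro!: fperm_comp intro: fperm_involution)

lemma pre_al_in: "d \<in> dts D \<Longrightarrow> al D d \<in> dts D"
  and pre_al_al: "d \<in> dts D \<Longrightarrow> al D (al D d) = d"
  and pre_al_neq: "d \<in> dts D \<Longrightarrow> al D d \<noteq> d"
  and pre_vdeg: "d \<in> dts D \<Longrightarrow> vdeg D d = 2 \<or> vdeg D d = 4"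
  using pre unfolding pre_diagram_def by auto

lemma pre_sg_in: "d \<in> dts D \<Longrightarrow> sg D d \<in> dts D"
  using fperm_in[OF pre_sg] .

lemma vdeg_sg: "d \<in> dts D \<Longrightarrow> vdeg D (sg D d) = vdeg D d"
  unfolding vdeg_def by (simp add: orbit_eq_step[OF pre_sg])

lemma pre_deg4:
  assumes "d \<in> dts D" "vdeg D d = 4"
  shows "sg D (sg D (sg D (sg D d))) = d" "distinct [d, sg D d, sg D (sg D d), sg D (sg D (sg D d))]"
    "orbit (sg D) d = {d, sg D d, sg D (sg D d), sg D (sg D (sg D d))}"
  using orbit_card4[OF pre_sg assms(1)] assms(2) unfolding vdeg_def by auto

lemma pre_deg2:
  assumes "d \<in> dts D" "vdeg D d = 2"
  shows "sg D (sg D d) = d" "sg D d \<noteq> d"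
  using orbit_card2[OF pre_sg assms(1)] assms(2) unfolding vdeg_def by auto

lemma straight_in: "d \<in> dts D \<Longrightarrow> straight D d \<in> dts D"
  unfolding straight_def by (simp add: pre_sg_in)

lemma straight_straight: "d \<in> dts D \<Longrightarrow> straight D (straight D d) = d"
  using pre_vdeg[of d] pre_deg4[of d] pre_deg2[of d] unfolding straight_def
  by (auto simp: vdeg_sg pre_sg_in)

lemma straight_neq: "d \<in> dts D \<Longrightarrow> straight D d \<noteq> d"
  using pre_vdeg[of d] pre_deg4[of d] pre_deg2[of d] unfolding straight_def
  by auto

text \<open>The orbits of \<open>straight D \<circ> al D\<close> are the oriented components: a
  closed curve gives one orbit for each direction, which is why one component means two
  orbits.\<close>

lemma pre_straight: "fperm (straight D \<circ> al D) (dts D)"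
  by (intro fperm_comp pre_al fperm_involution) (auto simp: pre_finite straight_in straight_straight)

text \<open>Otherwise \<open>al\<close> would reverse this orbit of the knot, and either \<open>al\<close> or \<open>straight\<close> would
  have a fixed point there.\<close>
lemma al_notin_component:
  assumes "x \<in> dts D"
  shows "al D x \<notin> orbit (straight D \<circ> al D) x"
proof -
  let ?h = "straight D \<circ> al D"
  have "x \<in> dts D \<Longrightarrow> (?h ^^ n) x \<noteq> al D x" for n x
  proof (induction n arbitrary: x rule: less_induct)
    case (less n)
    consider "n = 0" | "n = 1" | m where "n = Suc (Suc m)" by (metis One_nat_def not0_implies_Suc)
    then show ?case
    proof cases
      case 1
      then show ?thesis using pre_al_neq[OF less.prems] by simp
    next
      case 2
      then show ?thesis using straight_neq[OF pre_al_in[OF less.prems]] by simp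
    next
      case 3
      have hx: "?h x \<in> dts D" using less.prems by (simp add: pre_al_in straight_in)
      show ?thesis
      proof
        assume "(?h ^^ n) x = al D x"
        moreover have "?h (al D (?h x)) = al D x"
          using less.prems by (simp add: pre_al_in straight_in pre_al_al straight_straight)
        moreover have "(?h ^^ n) x = ?h ((?h ^^ m) (?h x))" using 3 by (simp add: funpow_swap1)
        ultimately have "?h ((?h ^^ m) (?h x)) = ?h (al D (?h x))" by simp
        moreover have "(?h ^^ m) (?h x) \<in> dts D"
          using orbit_subset[OF pre_straight hx] unfolding orbit_def by blast
        ultimately have "(?h ^^ m) (?h x) = al D (?h x)"
          using fperm_inj[OF pre_straight] pre_al_in[OF hx] by blast
        moreover have "m < n" using 3 by simp
        ultimately show False using less.IH[OF _ hx, of m] by blast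
      qed
    qed
  qed
  from this[OF assms] have "\<forall>n. al D x \<noteq> (?h ^^ n) x" by metis
  then show ?thesis unfolding orbit_def by blast
qed

text \<open>There are exactly two orbits, and the two directions of the curve through
  \<open>x\<close> already account for them.\<close>

lemma one_component_dichotomy:
  assumes "one_component D" "x \<in> dts D" "y \<in> dts D"
  shows "y \<in> orbit (straight D \<circ> al D) x \<or> y \<in> orbit (straight D \<circ> al D) (al D x)"
proof (rule ccontr)
  let ?h = "straight D \<circ> al D"
  assume n: "\<not> ?thesis"
  have ax: "al D x \<in> dts D" by (rule pre_al_in[OF assms(2)])
  have "orbit ?h x \<noteq> orbit ?h (al D x)" "orbit ?h x \<noteq> orbit ?h y"
      "orbit ?h (al D x) \<noteq> orbit ?h y"
    using al_notin_component[OF assms(2)] n orbit_self[of "al D x" ?h] orbit_self[of y ?h] by auto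
  then have "card {orbit ?h x, orbit ?h (al D x), orbit ?h y} = 3" by simp
  moreover have "card {orbit ?h x, orbit ?h (al D x), orbit ?h y} \<le> card (orbit ?h ` dts D)"
    by (rule card_mono) (auto simp: pre_finite assms ax)
  ultimately show False using assms(1) unfolding one_component_def norb_image by simp
qed

text \<open>A set closed under rotation and edges contains both directions of the curve through any
  of its darts.\<close>

lemma one_component_connected:
  assumes "one_component D" "S \<subseteq> dts D" "S \<noteq> {}"
      "\<And>x. x \<in> S \<Longrightarrow> sg D x \<in> S \<and> al D x \<in> S"
  shows "S = dts D"
proof
  obtain x where x: "x \<in> S" using assms(3) by blast
  have cl: "(straight D \<circ> al D) z \<in> S" if "z \<in> S" for z
    using assms(4) that unfolding straight_def by (simp split: if_splits)
  have "orbit (straight D \<circ> al D) z \<subseteq> S" if "z \<in> S" for z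
    by (rule orbit_closed_subset[OF that]) (rule cl)
  then have "orbit (straight D \<circ> al D) x \<subseteq> S"
      "orbit (straight D \<circ> al D) (al D x) \<subseteq> S"
    using x assms(4) by auto
  then show "dts D \<subseteq> S" using one_component_dichotomy[OF assms(1)] x assms(2) by blast
qed (rule assms(2))

lemma one_component_rtrancl:
  assumes "one_component D" "x \<in> dts D" "y \<in> dts D"
  shows "(x, y) \<in> ({(d, sg D d) | d. d \<in> dts D} \<union> {(d, al D d) | d. d \<in> dts
      D})\<^sup>*" (is "_ \<in> ?R\<^sup>*")
proof -
  have "{z \<in> dts D. (x, z) \<in> ?R\<^sup>*} = dts D"
  proof (rule one_component_connected[OF assms(1)])
    show "{z \<in> dts D. (x, z) \<in> ?R\<^sup>*} \<noteq> {}" using assms(2) by blast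
    fix z assume z: "z \<in> {z \<in> dts D. (x, z) \<in> ?R\<^sup>*}"
    then have "(x, sg D z) \<in> ?R\<^sup>*" "(x, al D z) \<in> ?R\<^sup>*"
      by (auto intro: rtrancl_into_rtrancl)
    then show "sg D z \<in> {z \<in> dts D. (x, z) \<in> ?R\<^sup>*} \<and> al D z \<in> {z \<in> dts D.
        (x, z) \<in> ?R\<^sup>*}"
      using z by (simp add: pre_sg_in pre_al_in)
  qed simp
  then show ?thesis using assms(3) by blast
qed

lemma pre_norb_al: "norb (al D) (dts D) * 2 = card (dts D)"
  by (rule norb_involution) (auto simp: pre_finite pre_al_in pre_al_al pre_al_neq)

text \<open>The genus inequality with every dart on an edge. No sphere is assumed: this is the bound
  that later excludes Euler characteristic 4.\<close>

lemma euler_bound: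
  assumes "one_component D"
  shows "norb (sg D) (dts D) + norb (fc D) (dts D) \<le> norb (al D) (dts D) + 2"
proof -
  have "{x \<in> dts D. al D x \<noteq> x} = dts D" using pre_al_neq by blast
  then have "card {x \<in> dts D. al D x \<noteq> x} = 2 * norb (al D) (dts D)" using pre_norb_al by simp
  then have "norb (sg D \<circ> al D) (dts D) + norb (sg D) (dts D) \<le> norb (al D) (dts D) + 2"
    by (intro genus_bound pre_sg one_component_connected[OF assms]) (auto simp: pre_al_in pre_al_al)
  then show ?thesis by (simp add: fc_def)
qed

end

lemma spherical_pre:
  assumes "spherical_map D" "\<forall>d\<in>dts D. vdeg D d \<in> {2, 4}"
  shows "pre_diagram D" "norb (sg D) (dts D) + norb (fc D) (dts D) = norb (al D) (dts D) + 2"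
proof -
  show "pre_diagram D" using assms unfolding spherical_map_def pre_diagram_def fperm_def
    by (auto simp: bij_betw_def)
  show "norb (sg D) (dts D) + norb (fc D) (dts D) = norb (al D) (dts D) + 2"
    using assms(1) unfolding spherical_map_def by linarith
qed

text \<open>Connectedness comes from the single component, so after a move only counts and local
  data remain to be checked.\<close>

lemma based_diagram_iff:
  "based_diagram D \<longleftrightarrow> planar_diagram D \<and> card (deg2_vertices D) = 1"
proof
  assume D: "based_diagram D"
  then show "planar_diagram D \<and> card (deg2_vertices D) = 1"
    unfolding planar_diagram_def using spherical_pre[of D]
    unfolding based_diagram_def deg2_vertices_def by auto
next
  assume R: "planar_diagram D \<and> card (deg2_vertices D) = 1"
  then have pre: "pre_diagram D" unfolding planar_diagram_def by simp
  have "int (norb (sg D) (dts D)) - int (norb (al D) (dts D)) + int (norb (fc D) (dts D)) = 2"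
    using R unfolding planar_diagram_def by linarith
  then have "spherical_map D"
    unfolding spherical_map_def
    using R pre one_component_rtrancl[OF pre] pre_sg[OF pre] pre_al[OF pre]
    unfolding planar_diagram_def pre_diagram_def fperm_def by blast
  then show "based_diagram D"
    using R pre unfolding based_diagram_def planar_diagram_def pre_diagram_def deg2_vertices_def by auto
qed

lemma knot_diagram_planar:
  assumes "knot_diagram D"
  shows "planar_diagram D"
proof -
  have "\<forall>d\<in>dts D. vdeg D d \<in> {2, 4}" using assms unfolding knot_diagram_def by auto
  then show ?thesis using spherical_pre[of D] assms unfolding knot_diagram_def planar_diagram_def by auto
qed

text \<open>Here \<open>f\<close> arises from \<open>g\<close> by subdividing steps: a point \<open>y\<close> of \<open>C\<close> is passed on the way
  from \<open>ret y\<close> to \<open>g (ret y)\<close>.\<close>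
lemma norb_subdivide:
  assumes f: "fperm f (H \<union> C)" and g: "fperm g H" and disj: "H \<inter> C = {}"
    and ret: "\<And>y. y \<in> C \<Longrightarrow> ret y \<in> H"
    and fH: "\<And>y. y \<in> H \<Longrightarrow> f y = g y \<or> f y \<in> C \<and> ret (f y) = y"
    and fC: "\<And>y. y \<in> C \<Longrightarrow> f y \<in> C \<and> ret (f y) = ret y \<or> f y = g (ret
        y)"
    and hit: "\<And>y. y \<in> C \<Longrightarrow> y \<in> orbit f (ret y)"
  shows "norb f (H \<union> C) = norb g H"
proof -
  define r where "r y = (if y \<in> C then ret y else y)" for y
  have rH: "r y = y" if "y \<in> H" for y using that disj unfolding r_def by auto
  have gH: "g y \<in> H" if "y \<in> H" for y using fperm_in[OF g that] .
  have hit': "ret y \<in> orbit f y" if "y \<in> C" for y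
    by (rule orbit_sym[OF f _ hit[OF that]]) (simp add: ret that)
  \<comment> \<open>If the walk from \<open>z\<close> never got to \<open>g (ret z)\<close>, it
    would stay in \<open>C\<close> for ever; but its orbit contains \<open>ret z\<close>, a point of
    \<open>H\<close>.\<close>
  have leave: "g (ret z) \<in> orbit f z" if z: "z \<in> C" for z
  proof (rule ccontr)
    assume n: "g (ret z) \<notin> orbit f z"
    have "s \<in> C \<and> ret s = ret z" if "s \<in> orbit f z" for s
      using that
    proof (induction rule: orbit_induct)
      case (step s)
      then show ?case using fC[of s] orbit_stepI[OF step(1)] n by auto
    qed (simp add: z)
    then have "ret z \<in> C" using hit'[OF z] by blast
    then show False using ret[OF z] disj by blast
  qed
  show ?thesis
  proof (rule norb_retract[OF f g, where ret = r])
    show "r y \<in> H" if "y \<in> H \<union> C" for y using that ret unfolding r_def by auto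
    show "r (f y) \<in> orbit g (r y)" if "y \<in> H \<union> C" for y
    proof (cases "y \<in> C")
      case True
      then show ?thesis using fC[OF True] rH[OF gH[OF ret[OF True]]] orbit_step[of g "ret y"]
        unfolding r_def by (auto simp: orbit_self)
    next
      case False
      then have y: "y \<in> H" using that by simp
      then show ?thesis using fH[OF y] rH[OF gH[OF y]] orbit_step[of g y] False
        unfolding r_def by (auto simp: orbit_self)
    qed
    show "g x \<in> orbit f x" if x: "x \<in> H" for x
    proof (cases "f x = g x")
      case True then show ?thesis using orbit_step[of f x] by simp
    next
      case False
      then have "f x \<in> C" "ret (f x) = x" using fH[OF x] by auto
      then have "g x \<in> orbit f (f x)" using leave[of "f x"] by simp
      then show ?thesis by (rule orbit_trans[OF orbit_step])
    qed
    show "r y \<in> orbit f y" if "y \<in> H \<union> C" for y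
      using hit'[of y] unfolding r_def by (simp add: orbit_self)
  qed (simp_all add: rH)
qed

section \<open>Reidemeister moves on based diagrams\<close>

text \<open>Common part of Reidemeister I and II: crossings are added and edges rewired, while old
  rotations and crossing information stay. Faces and components depend on the rewiring and are
  counted for each move separately.\<close>

definition adds_crossings :: "kd \<Rightarrow> kd \<Rightarrow> nat set \<Rightarrow> bool" where
  "adds_crossings D E X \<longleftrightarrow> dts E = dts D \<union> X \<and> dts D \<inter> X = {}
      \<and> finite X \<and>
     (\<forall>d\<in>dts D. sg E d = sg D d \<and> ov E d = ov D d) \<and>
     (\<forall>x\<in>X. sg E x \<in> X \<and> card (orbit (sg E) x) = 4 \<and> sg E (sg E (sg E (sg E
         x))) = x \<and>
        ov E (sg E x) = (\<not> ov E x)) \<and>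
     (\<forall>x\<in>dts E. al E x \<in> dts E \<and> al E (al E x) = x \<and> al E x \<noteq> x)"

context
  fixes D E :: kd and X
  assumes pre: "pre_diagram D" and ext: "adds_crossings D E X"
begin

private lemma ext_dE: "dts E = dts D \<union> X" and ext_disj: "dts D \<inter> X = {}" and ext_finX:
    "finite X"
  and ext_old: "\<And>d. d \<in> dts D \<Longrightarrow> sg E d = sg D d"
      "\<And>d. d \<in> dts D \<Longrightarrow> ov E d = ov D d"
  and ext_new: "\<And>x. x \<in> X \<Longrightarrow> sg E x \<in> X"
      "\<And>x. x \<in> X \<Longrightarrow> card (orbit (sg E) x) = 4"
      "\<And>x. x \<in> X \<Longrightarrow> sg E (sg E (sg E (sg E x))) = x"
          "\<And>x. x \<in> X \<Longrightarrow> ov E (sg E x) = (\<not> ov E x)"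
  and ext_al: "\<And>x. x \<in> dts E \<Longrightarrow> al E x \<in> dts E \<and> al E (al E x) = x
      \<and> al E x \<noteq> x"
  using ext unfolding adds_crossings_def by (blast | metis)+

lemma extend_sg: "fperm (sg E) (dts E)"
proof (rule fpermI_surj)
  show "finite (dts E)" by (simp add: ext_dE ext_finX pre_finite[OF pre])
  show "sg E x \<in> dts E" if "x \<in> dts E" for x
    using that ext_new(1)[of x] ext_old(1)[of x] pre_sg_in[OF pre, of x] by (auto simp: ext_dE)
  show "\<exists>x\<in>dts E. y = sg E x" if y: "y \<in> dts E" for y
  proof (cases "y \<in> X")
    case True
    then show ?thesis using ext_new(1,3) by (intro bexI[of _ "sg E (sg E (sg E y))"]) (auto simp: ext_dE)
  next
    case False
    then obtain x where "x \<in> dts D"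
        "y = sg D x" using y fperm_onto[OF pre_sg[OF pre]] by (auto simp: ext_dE)
    then show ?thesis using ext_old(1) by (intro bexI[of _ x]) (simp_all add: ext_dE)
  qed
qed

lemma extend_orbit: "d \<in> dts D \<Longrightarrow> orbit (sg E) d = orbit (sg D) d"
  by (rule orbit_cong[of _ "dts D"]) (auto simp: ext_old pre_sg_in[OF pre])

lemma extend_vdeg: "d \<in> dts D \<Longrightarrow> vdeg E d = vdeg D d"
    "x \<in> X \<Longrightarrow> vdeg E x = 4"
  by (simp_all add: vdeg_def extend_orbit ext_new(2))

lemma extend_pre: "pre_diagram E"
proof -
  have "vdeg E x \<in> {2, 4}" if "x \<in> dts E" for x
    using that extend_vdeg[of x] pre_vdeg[OF pre, of x] unfolding ext_dE by auto
  moreover have "dts E \<noteq> {}" using pre_nonempty[OF pre] ext_dE by simp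
  ultimately show ?thesis unfolding pre_diagram_def using extend_sg ext_al by blast
qed

lemma extend_straight: "d \<in> dts D \<Longrightarrow> straight E d = straight D d"
  "x \<in> X \<Longrightarrow> straight E x = sg E (sg E x)"
  by (simp_all add: straight_def extend_vdeg ext_old pre_sg_in[OF pre])

lemma extend_deg2: "deg2_vertices E = deg2_vertices D"
  unfolding deg2_vertices_def using extend_vdeg extend_orbit by (fastforce simp: ext_dE)

lemma extend_crossing: "crossing_data E \<longleftrightarrow> crossing_data D"
proof -
  have "ov E (sg E d) = (\<not> ov E d) \<longleftrightarrow> ov D (sg D d) = (\<not> ov D d)" if "d
      \<in> dts D" for d
    using ext_old[OF that] ext_old(2)[OF pre_sg_in[OF pre that]] by simp
  then show ?thesis unfolding crossing_data_def ext_dE using extend_vdeg ext_new(4) by (metis Un_iff)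
qed

lemma extend_norb_sg: "norb (sg E) (dts E) = norb (sg D) (dts D) + norb (sg E) X"
proof -
  have "norb (sg E) (dts E) = norb (sg E) (dts D) + norb (sg E) X"
    unfolding ext_dE by (rule norb_Un) (use extend_sg ext_dE ext_disj ext_new(1) in auto)
  moreover have "norb (sg E) (dts D) = norb (sg D) (dts D)"
    by (rule norb_cong) (simp_all add: ext_old pre_sg_in[OF pre])
  ultimately show ?thesis by simp
qed

lemma extend_norb_al: "2 * norb (al E) (dts E) = 2 * norb (al D) (dts D) + card X"
  using pre_norb_al[OF extend_pre] pre_norb_al[OF pre]
  by (simp add: ext_dE card_Un_disjoint ext_finX pre_finite[OF pre] ext_disj)

end

section \<open>Reidemeister I\<close>

text \<open>The kink of the other orientation is the same kink at \<open>al D d\<close> with the new darts in reverse order.\<close>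
definition kink :: "kd \<Rightarrow> nat \<Rightarrow> nat \<Rightarrow> nat \<Rightarrow> nat
    \<Rightarrow> nat \<Rightarrow> bool \<Rightarrow> kd" where
  "kink D d x1 x2 x3 x4 b = \<lparr> dts = dts D \<union> {x1, x2, x3, x4},
     sg = (sg D)(x1 := x2, x2 := x3, x3 := x4, x4 := x1),
     al = (al D)(d := x1, x1 := d, x2 := x3, x3 := x2, x4 := al D d, al D d := x4),
     ov = (ov D)(x1 := b, x2 := (\<not> b), x3 := b, x4 := (\<not> b)) \<rparr>"

lemma R1_kink:
  assumes "d \<in> dts D" "distinct [x1, x2, x3, x4]" "{x1, x2, x3, x4} \<inter> dts D = {}"
  shows "R1 D (kink D d x1 x2 x3 x4 b)"
  unfolding R1_def kink_def
  by (rule exI[of _ d], rule exI[of _ x1], rule exI[of _ x2], rule exI[of _ x3], rule exI[of _ x4], rule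
      exI[of _ b], rule exI[of _ True], intro conjI) (simp_all only: assms if_True)

context
  fixes D :: kd and d x1 x2 x3 x4 :: nat and b :: bool
  assumes pre: "pre_diagram D" and d: "d \<in> dts D" and dist: "distinct [x1, x2, x3, x4]"
    and fresh: "{x1, x2, x3, x4} \<inter> dts D = {}"
begin

private abbreviation (input) "KD \<equiv> kink D d x1 x2 x3 x4 b"
private abbreviation (input) "KX \<equiv> {x1, x2, x3, x4}"

private lemma kink_al_d: "al D d \<in> dts D" "al D (al D d) = d" "al D d \<noteq> d"
  using pre_al_in[OF pre d] pre_al_al[OF pre d] pre_al_neq[OF pre d] by auto

private lemma kink_neq: "x \<in> dts D \<Longrightarrow> x \<noteq> x1 \<and> x \<noteq> x2 \<and> x
    \<noteq> x3 \<and> x \<noteq> x4 \<and> x1 \<noteq> x \<and> x2 \<noteq> x \<and> x3 \<noteq> x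
    \<and> x4 \<noteq> x"
  using fresh by auto

private lemmas kink_neqs = distinct4_neq[OF dist]

private lemma kink_sgE: "x \<in> dts D \<Longrightarrow> sg KD x = sg D x" "sg KD x1 = x2" "sg KD x2 = x3"
    "sg KD x3 = x4" "sg KD x4 = x1"
  using kink_neq kink_neqs by (simp_all add: kink_def)

private lemma kink_alE: "x \<in> dts D \<Longrightarrow> x \<noteq> d \<Longrightarrow> x \<noteq> al D d
    \<Longrightarrow> al KD x = al D x"
  "al KD d = x1" "al KD (al D d) = x4" "al KD x1 = d" "al KD x2 = x3" "al KD x3 = x2" "al KD x4 = al D d"
  using kink_neq kink_neq[OF d] kink_neq[OF kink_al_d(1)] kink_neqs kink_al_d kink_al_d(3)[symmetric]
      kink_neq[OF d, THEN conjunct1, symmetric] by (auto simp: kink_def)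

private lemma kink_extE: "adds_crossings D KD KX"
  unfolding adds_crossings_def
proof (intro conjI ballI)
  show "dts KD = dts D \<union> KX" by (simp add: kink_def)
  show "dts D \<inter> KX = {}" using fresh by auto
  show "sg KD d = sg D d" if "d \<in> dts D" for d using kink_sgE(1)[OF that] .
  show "ov KD d = ov D d" if "d \<in> dts D" for d using kink_neq[OF that] by (simp add: kink_def)
  show "sg KD x \<in> KX" "sg KD (sg KD (sg KD (sg KD x))) = x" if "x \<in> KX" for x using that
      kink_sgE(2-5) by auto
  show "card (orbit (sg KD) x) = 4" if x: "x \<in> KX" for x
  proof -
    have "orbit (sg KD) x = KX" using x orbit_cycle4[of "sg KD" x] kink_sgE by auto
    then show ?thesis by (simp add: kink_neqs)
  qed
  show "ov KD (sg KD x) = (\<not> ov KD x)" if "x \<in> KX" for x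
    using that kink_neqs kink_sgE(2-5) by (auto simp: kink_def)
  have "al KD x \<in> dts KD \<and> al KD (al KD x) = x \<and> al KD x \<noteq> x" if x: "x \<in> dts KD"
      for x
  proof -
    have dE: "dts KD = dts D \<union> KX" by (simp add: kink_def)
    consider "x = d" | "x = al D d" | "x = x1" | "x = x2" | "x = x3" | "x = x4"
      | "x \<in> dts D" "x \<noteq> d" "x \<noteq> al D d"
      using x unfolding dE by auto
    then show ?thesis
    proof cases
      case 7
      then have "al D x \<noteq> d" "al D x \<noteq> al D d" "al D x \<in> dts D"
        using kink_al_d pre_al_al[OF pre 7(1)] pre_al_in[OF pre 7(1)] pre_al_al[OF pre d] by metis+
      then show ?thesis using 7 kink_alE(1) pre_al_al[OF pre 7(1)] pre_al_neq[OF pre 7(1)] by (simp add: dE)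
    qed (unfold dE, use kink_alE(2-) d kink_al_d(1) kink_neq[OF d] kink_neq[OF kink_al_d(1)] kink_neqs in
        simp_all)
  qed
  then show "x \<in> dts KD \<Longrightarrow> al KD x \<in> dts KD"
      "x \<in> dts KD \<Longrightarrow> al KD (al KD x) = x"
    "x \<in> dts KD \<Longrightarrow> al KD x \<noteq> x" for x by blast+
qed simp

lemma kink_pre: "pre_diagram KD" by (rule extend_pre[OF pre kink_extE])

private lemmas deg2_kink = extend_deg2[OF pre kink_extE]
private lemmas crossing_kink = extend_crossing[OF pre kink_extE]
private lemmas norb_sg_kink = extend_norb_sg[OF pre kink_extE]
private lemmas norb_al_kink = extend_norb_al[OF pre kink_extE]
private lemmas straight_kink = extend_straight[OF pre kink_extE]

text \<open>The new face is the monogon of \<open>x3\<close>. The other three darts only lengthen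
  old faces: \<open>x2\<close>, \<open>x4\<close> are inserted after \<open>d\<close> and
  \<open>x1\<close> after \<open>al D d\<close>.\<close>

private lemma norb_fc_kink: "norb (fc KD) (dts KD) = norb (fc D) (dts D) + 1"
proof -
  have g: "fc KD x = fc D x" if "x \<in> dts D" "x \<noteq> d" "x \<noteq> al D d" for x
    using that by (simp add: fc_def kink_alE kink_sgE pre_al_in[OF pre])
  have fcE: "fc KD d = x2" "fc KD x2 = x4" "fc KD x4 = fc D d" "fc KD (al D d) = x1"
      "fc KD x1 = fc D (al D d)"
    "fc KD x3 = x3"
    using d kink_al_d by (simp_all add: fc_def kink_alE kink_sgE)
  let ?H = "dts D \<union> {x1, x2, x4}"
  have H: "dts KD = ?H \<union> {x3}" by (auto simp: kink_def)
  have p: "fperm (fc KD) (?H \<union> {x3})" using pre_fc[OF kink_pre] H by simp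
  have "norb (fc KD) (dts KD) = norb (fc KD) ?H + norb (fc KD) {x3}"
    unfolding H by (rule norb_Un[OF p]) (use fcE kink_neq kink_neqs in auto)
  moreover have "norb (fc KD) {x3} = 1" by (simp add: norb_image)
  moreover have "norb (fc KD) ?H = norb (fc D) (dts D)"
  proof (rule norb_subdivide[where ret = "\<lambda>y. if y = x1 then al D d else d"])
    have "?H = (?H \<union> {x3}) - {x3}" using kink_neq kink_neqs by auto
    then show "fperm (fc KD) ?H" using fperm_Diff(1)[OF p, of "{x3}"] fcE by auto
    show "fperm (fc D) (dts D)" by (rule pre_fc[OF pre])
    show "y \<in> orbit (fc KD) (if y = x1 then al D d else d)" if "y \<in> {x1, x2, x4}" for y
      using that orbit_stepI[OF orbit_step, of "fc KD" d] orbit_step[of "fc KD" d]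
        orbit_step[of "fc KD" "al D d"] kink_neqs unfolding fcE by auto
    show "fc KD y = fc D y \<or> fc KD y \<in> {x1, x2, x4} \<and> (if fc KD y = x1 then al D d else d) = y"
      if "y \<in> dts D" for y
    proof -
      consider "y = d" | "y = al D d" | "y \<noteq> d" "y \<noteq> al D d" by blast
      then show ?thesis
      proof cases
        case 1 show ?thesis unfolding 1 fcE by (simp add: kink_neqs)
      next
        case 2 show ?thesis unfolding 2 fcE by simp
      next
        case 3 then show ?thesis using g[OF that 3] by simp
      qed
    qed
    show "dts D \<inter> {x1, x2, x4} = {}" using fresh by blast
    show "fc KD y \<in> {x1, x2, x4} \<and> (if fc KD y = x1 then al D d else d) = (if y = x1 then al D d
        else d) \<or>
        fc KD y = fc D (if y = x1 then al D d else d)" if yC: "y \<in> {x1, x2, x4}" for y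
    proof -
      consider "y = x1" | "y = x2" | "y = x4" using yC by blast
      then show ?thesis
      proof cases
        case 1 show ?thesis unfolding 1 fcE by (simp add: kink_neqs)
      next
        case 2 show ?thesis unfolding 2 fcE by (simp add: kink_neqs)
      next
        case 3 show ?thesis unfolding 3 fcE by (simp add: kink_neqs)
      qed
    qed
  qed (simp add: d kink_al_d)
  ultimately show ?thesis by simp
qed

text \<open>The curve arriving along \<open>d\<close> crosses from \<open>x1\<close> to
  \<open>x3\<close>, runs round the loop and crosses from \<open>x2\<close> to \<open>x4\<close>. So
  \<open>x3\<close>, \<open>x4\<close> are inserted after \<open>d\<close>, and \<open>x2\<close>,
  \<open>x1\<close> after \<open>al D d\<close> in the other direction.\<close>

private lemma one_component_kink: "one_component KD \<longleftrightarrow> one_component D"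
proof -
  let ?h = "straight D \<circ> al D" and ?k = "straight KD \<circ> al KD"
  have st: "straight KD x1 = x3" "straight KD x2 = x4" "straight KD x3 = x1" "straight KD x4 = x2"
    by (simp_all add: straight_kink(2) kink_sgE)
  have g: "?k x = ?h x" if "x \<in> dts D" "x \<noteq> d" "x \<noteq> al D d" for x
    using that by (simp add: kink_alE straight_kink(1) pre_al_in[OF pre])
  have kE: "?k d = x3" "?k x3 = x4" "?k x4 = ?h d" "?k (al D d) = x2" "?k x2 = x1" "?k x1 = ?h (al D d)"
    using d kink_al_d by (simp_all add: kink_alE st straight_kink(1))
  have p: "fperm ?k (dts D \<union> KX)" using pre_straight[OF kink_pre] by (simp add: kink_def)
  have "norb ?k (dts D \<union> KX) = norb ?h (dts D)"
  proof (rule norb_subdivide[where ret = "\<lambda>y. if y = x3 \<or> y = x4 then d else al D d", OF p])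
    show "fperm ?h (dts D)" by (rule pre_straight[OF pre])
    show "y \<in> orbit ?k (if y = x3 \<or> y = x4 then d else al D d)" if "y \<in> KX" for y
    proof -
      have "x3 \<in> orbit ?k d" "x4 \<in> orbit ?k d" "x1 \<in> orbit ?k (al D d)"
          "x2 \<in> orbit ?k (al D d)"
        using orbit_step orbit_stepI kE by metis+
      then show ?thesis using that by auto
    qed
    show "?k y = ?h y \<or> ?k y \<in> KX \<and> (if ?k y = x3 \<or> ?k y = x4 then d else al D d) = y"
      if "y \<in> dts D" for y
    proof -
      consider "y = d" | "y = al D d" | "y \<noteq> d" "y \<noteq> al D d" by blast
      then show ?thesis
      proof cases
        case 1 then show ?thesis unfolding 1 kE by simp
      next
        case 2 then show ?thesis unfolding 2 kE by (simp add: kink_neqs)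
      next
        case 3 then show ?thesis using g[OF that 3] by simp
      qed
    qed
    show "?k y \<in> KX \<and> (if ?k y = x3 \<or> ?k y = x4 then d else al D d) = (if y = x3 \<or> y =
        x4 then d else al D d) \<or>
        ?k y = ?h (if y = x3 \<or> y = x4 then d else al D d)" if yX: "y \<in> KX" for y
    proof -
      consider "y = x1" | "y = x2" | "y = x3" | "y = x4" using yX by auto
      then show ?thesis
      proof cases
        case 1 show ?thesis unfolding 1 kE by (simp add: kink_neqs)
      next
        case 2 show ?thesis unfolding 2 kE by (simp add: kink_neqs)
      next
        case 3 show ?thesis unfolding 3 kE by (simp add: kink_neqs)
      next
        case 4 show ?thesis unfolding 4 kE by (simp add: kink_neqs)
      qed
    qed
    show "dts D \<inter> KX = {}" using fresh by blast
  qed (simp add: d kink_al_d)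
  then show ?thesis unfolding one_component_def by (simp add: kink_def)
qed

text \<open>One vertex, two edges and one face are added, so the Euler characteristic is the same.
  The equivalence serves both insertion and removal.\<close>

lemma kink_based: "based_diagram KD \<longleftrightarrow> based_diagram D"
proof -
  have "norb (sg KD) KX = 1"
  proof (rule norb_single)
    show "fperm (sg KD) KX" by (rule fpermI_surj) (use kink_sgE in auto)
    show "y \<in> orbit (sg KD) x1" if "y \<in> KX" for y using orbit_cycle4[of "sg KD" x1 x2 x3 x4]
        kink_sgE that by simp
  qed simp
  moreover have "card KX = 4" by (simp add: kink_neqs)
  ultimately have "norb (sg KD) (dts KD) + norb (fc KD) (dts KD) = norb (al KD) (dts KD) + 2
      \<longleftrightarrow>
      norb (sg D) (dts D) + norb (fc D) (dts D) = norb (al D) (dts D) + 2"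
    using norb_sg_kink norb_al_kink norb_fc_kink by linarith
  then show ?thesis
    unfolding based_diagram_iff planar_diagram_def deg2_kink crossing_kink one_component_kink by (simp
        add: pre kink_pre)
qed

end

section \<open>Reidemeister II\<close>

definition finger :: "kd \<Rightarrow> nat \<Rightarrow> nat \<Rightarrow> nat \<Rightarrow> nat
    \<Rightarrow> nat \<Rightarrow> nat \<Rightarrow> nat \<Rightarrow> nat \<Rightarrow> nat
    \<Rightarrow> nat \<Rightarrow> bool \<Rightarrow> kd" where
  "finger D d1 d2 ue un uw us ve vn vw vs b = \<lparr> dts = dts D \<union> {ue, un, uw, us, ve, vn, vw,
      vs},
     sg = (sg D)(ue := un, un := uw, uw := us, us := ue, ve := vn, vn := vw, vw := vs, vs := ve),
     al = (al D)(d1 := vs, vs := d1, vn := un, un := vn, us := al D d1, al D d1 := us,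
                 d2 := uw, uw := d2, ue := vw, vw := ue, ve := al D d2, al D d2 := ve),
     ov = (ov D)(us := b, un := b, vs := b, vn := b,
                 ue := (\<not> b), uw := (\<not> b), ve := (\<not> b), vw := (\<not> b)) \<rparr>"

lemma R2_finger:
  assumes "d1 \<in> dts D" "d2 \<in> orbit (fc D) d1" "d2 \<noteq> d1" "d2 \<noteq> al D d1"
    "distinct [ue, un, uw, us, ve, vn, vw, vs]" "{ue, un, uw, us, ve, vn, vw, vs} \<inter> dts D = {}"
  shows "R2 D (finger D d1 d2 ue un uw us ve vn vw vs b)"
  unfolding R2_def finger_def
  by (rule exI[of _ d1], rule exI[of _ d2], rule exI[of _ ue], rule exI[of _ un], rule exI[of _ uw], rule
      exI[of _ us], rule exI[of _ ve], rule exI[of _ vn], rule exI[of _ vw], rule exI[of _ vs], rule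
      exI[of _ b], intro conjI) (rule assms refl)+

context
  fixes D :: kd and d1 d2 ue un uw us ve vn vw vs :: nat and b :: bool
  assumes pre: "pre_diagram D" and d1: "d1 \<in> dts D" and d2: "d2 \<in> dts D" and d12: "d2 \<noteq> d1"
      "d2 \<noteq> al D d1"
    and dist: "distinct [ue, un, uw, us, ve, vn, vw, vs]" and fresh: "{ue, un, uw, us, ve, vn, vw, vs}
        \<inter> dts D = {}"
begin

private abbreviation (input) "FD \<equiv> finger D d1 d2 ue un uw us ve vn vw vs b"
private abbreviation (input) "FX \<equiv> {ue, un, uw, us, ve, vn, vw, vs}"

private definition "t1 = al D d1"
private definition "t2 = al D d2"

private lemma finger_ends: "t1 \<in> dts D" "t2 \<in> dts D" "al D t1 = d1" "al D t2 = d2" "al D d1 = t1"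
    "al D d2 = t2"
  using pre_al_in[OF pre] pre_al_al[OF pre] d1 d2 by (auto simp: t1_def t2_def)

private lemma finger_ends_neq: "d1 \<noteq> d2" "d1 \<noteq> t1" "d1 \<noteq> t2" "d2 \<noteq> d1"
    "d2 \<noteq> t1" "d2 \<noteq> t2"
  "t1 \<noteq> d1" "t1 \<noteq> d2" "t1 \<noteq> t2" "t2 \<noteq> d1" "t2 \<noteq> d2" "t2 \<noteq> t1"
  using d12 finger_ends pre_al_neq[OF pre d1] pre_al_neq[OF pre d2] by metis+

private lemma finger_neq: "x \<in> dts D \<Longrightarrow> x \<noteq> ue \<and> ue \<noteq> x \<and> x
    \<noteq> un \<and> un \<noteq> x \<and> x \<noteq> uw \<and> uw \<noteq> x \<and> x \<noteq> us
    \<and> us \<noteq> x \<and> x \<noteq> ve \<and> ve \<noteq> x \<and> x \<noteq> vn \<and> vn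
    \<noteq> x \<and> x \<noteq> vw \<and> vw \<noteq> x \<and> x \<noteq> vs \<and> vs \<noteq> x"
  using fresh by auto

private lemmas finger_nqs = finger_neq[OF d1] finger_neq[OF d2] finger_neq[OF finger_ends(1)]
    finger_neq[OF finger_ends(2)]

private lemmas finger_neqs = distinct8_neq[OF dist]

private lemma finger_sgE: "x \<in> dts D \<Longrightarrow> sg FD x = sg D x" "sg FD ue = un"
    "sg FD un = uw" "sg FD uw = us" "sg FD us = ue"
  "sg FD ve = vn" "sg FD vn = vw" "sg FD vw = vs" "sg FD vs = ve"
proof -
  show "sg FD x = sg D x" if "x \<in> dts D" using finger_neq[OF that] by (simp add: finger_def)
qed (simp_all add: finger_def finger_neqs)

private lemma finger_alE: "x \<in> dts D \<Longrightarrow> x \<notin> {d1, t1, d2, t2} \<Longrightarrow>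
    al FD x = al D x"
  "al FD d1 = vs" "al FD vs = d1" "al FD vn = un" "al FD un = vn" "al FD us = t1" "al FD t1 = us"
  "al FD d2 = uw" "al FD uw = d2" "al FD ue = vw" "al FD vw = ue" "al FD ve = t2" "al FD t2 = ve"
proof -
  show "al FD x = al D x" if "x \<in> dts D" "x \<notin> {d1, t1, d2, t2}"
    using finger_neq[OF that(1)] that(2) by (simp add: finger_def finger_ends(5,6))
qed (simp_all add: finger_def finger_ends(5,6) finger_nqs finger_neqs finger_ends_neq)

private lemma finger_dE: "dts FD = dts D \<union> FX" by (simp add: finger_def)

private lemma finger_orbits_new: "orbit (sg FD) x = (if x \<in> {ue, un, uw, us} then {ue, un, uw, us}
    else {ve, vn, vw, vs})"
  if "x \<in> FX" for x
proof -
  have "orbit (sg FD) x = {x, sg FD x, sg FD (sg FD x), sg FD (sg FD (sg FD x))}"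
    by (rule orbit_cycle4) (use that in \<open>auto simp: finger_sgE(2-)\<close>)
  then have "orbit (sg FD) x = (if x \<in> {ue, un, uw, us} then {ue, un, uw, us} else {ve, vn, vw, vs})"
    if "x = ue \<or> x = un \<or> x = uw \<or> x = us \<or> x = ve \<or> x = vn \<or> x = vw \<or> x = vs"
    using that by (elim disjE) (simp_all add: finger_sgE finger_neqs insert_commute)
  then show ?thesis using that by simp
qed

private lemma finger_extE: "adds_crossings D FD FX"
  unfolding adds_crossings_def
proof (intro conjI ballI)
  show "dts FD = dts D \<union> FX" by (rule finger_dE)
  show "dts D \<inter> FX = {}" using fresh by auto
  show "sg FD d = sg D d" if "d \<in> dts D" for d using finger_sgE(1)[OF that] .
  show "ov FD x = ov D x" if "x \<in> dts D" for x using finger_neq[OF that] by (simp add: finger_def)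
  show "sg FD x \<in> FX" "sg FD (sg FD (sg FD (sg FD x))) = x" if "x \<in> FX" for x using that
      finger_sgE(2-) by auto
  show "card (orbit (sg FD) x) = 4" if x: "x \<in> FX" for x
    unfolding finger_orbits_new[OF x] by (simp add: finger_neqs)
  have ovE: "ov FD us = b" "ov FD un = b" "ov FD vs = b" "ov FD vn = b" "ov FD ue = (\<not> b)"
      "ov FD uw = (\<not> b)"
    "ov FD ve = (\<not> b)" "ov FD vw = (\<not> b)"
    using finger_neqs by (simp_all add: finger_def)
  show "ov FD (sg FD x) = (\<not> ov FD x)" if "x \<in> FX" for x
    using that finger_sgE(2-) ovE by auto
  have "al FD x \<in> dts FD \<and> al FD (al FD x) = x \<and> al FD x \<noteq> x" if x: "x \<in> dts FD"
      for x
  proof -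
    consider "x = d1" | "x = t1" | "x = d2" | "x = t2" | "x = ue" | "x = un" | "x = uw" | "x = us" | "x =
        ve" | "x = vn" | "x = vw" | "x = vs"
      | "x \<in> dts D" "x \<notin> {d1, t1, d2, t2}"
      using x unfolding finger_dE by blast
    then show ?thesis
    proof cases
      case 13
      then have "al D x \<notin> {d1, t1, d2, t2}" "al D x \<in> dts D"
        using pre_al_al[OF pre 13(1)] pre_al_in[OF pre 13(1)] finger_ends by auto
      then show ?thesis using 13 finger_alE(1) pre_al_al[OF pre 13(1)] pre_al_neq[OF pre 13(1)] by (simp
          add: finger_dE)
    next
      case 1 show ?thesis unfolding 1 finger_alE finger_dE by (simp add: d1 d2 finger_ends finger_nqs
          finger_neqs)
    next
      case 2 show ?thesis unfolding 2 finger_alE finger_dE by (simp add: d1 d2 finger_ends finger_nqs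
          finger_neqs)
    next
      case 3 show ?thesis unfolding 3 finger_alE finger_dE by (simp add: d1 d2 finger_ends finger_nqs
          finger_neqs)
    next
      case 4 show ?thesis unfolding 4 finger_alE finger_dE by (simp add: d1 d2 finger_ends finger_nqs
          finger_neqs)
    next
      case 5 show ?thesis unfolding 5 finger_alE finger_dE by (simp add: d1 d2 finger_ends finger_nqs
          finger_neqs)
    next
      case 6 show ?thesis unfolding 6 finger_alE finger_dE by (simp add: d1 d2 finger_ends finger_nqs
          finger_neqs)
    next
      case 7 show ?thesis unfolding 7 finger_alE finger_dE by (simp add: d1 d2 finger_ends finger_nqs
          finger_neqs)
    next
      case 8 show ?thesis unfolding 8 finger_alE finger_dE by (simp add: d1 d2 finger_ends finger_nqs
          finger_neqs)
    next
      case 9 show ?thesis unfolding 9 finger_alE finger_dE by (simp add: d1 d2 finger_ends finger_nqs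
          finger_neqs)
    next
      case 10 show ?thesis unfolding 10 finger_alE finger_dE by (simp add: d1 d2 finger_ends finger_nqs
          finger_neqs)
    next
      case 11 show ?thesis unfolding 11 finger_alE finger_dE by (simp add: d1 d2 finger_ends finger_nqs
          finger_neqs)
    next
      case 12 show ?thesis unfolding 12 finger_alE finger_dE by (simp add: d1 d2 finger_ends finger_nqs
          finger_neqs)
    qed
  qed
  then show "x \<in> dts FD \<Longrightarrow> al FD x \<in> dts FD"
      "x \<in> dts FD \<Longrightarrow> al FD (al FD x) = x"
    "x \<in> dts FD \<Longrightarrow> al FD x \<noteq> x" for x by blast+
qed simp

lemma finger_pre: "pre_diagram FD" by (rule extend_pre[OF pre finger_extE])

private lemmas deg2_finger = extend_deg2[OF pre finger_extE]
private lemmas crossing_finger = extend_crossing[OF pre finger_extE]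
private lemmas norb_sg_finger = extend_norb_sg[OF pre finger_extE]
private lemmas norb_al_finger = extend_norb_al[OF pre finger_extE]
private lemmas straight_finger = extend_straight[OF pre finger_extE]

text \<open>One new face is the bigon \<open>{un, vw}\<close>. Apart from it, the face walk that
  arrives along \<open>d1\<close> passes through \<open>ve\<close> and continues with the old
  successor of \<open>d2\<close>, and the one along \<open>d2\<close> passes through
  \<open>us\<close> to the old successor of \<open>d1\<close>. The remaining faces are thus those of
  \<open>fc D\<close> with two successors exchanged; whether this splits or merges faces depends on
  whether \<open>d1\<close> and \<open>d2\<close> share one.\<close>

private lemma norb_fc_finger:
  "norb (fc FD) (dts FD) = norb ((fc D)(d1 := fc D d2, d2 := fc D d1)) (dts D) + 1"
proof -
  let ?g = "(fc D)(d1 := fc D d2, d2 := fc D d1)"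
  have g: "fc FD x = fc D x" if "x \<in> dts D" "x \<notin> {d1, t1, d2, t2}" for x
    using that by (simp add: fc_def finger_alE finger_sgE pre_al_in[OF pre])
  have fcE: "fc FD d1 = ve" "fc FD ve = fc D d2" "fc FD d2 = us" "fc FD us = fc D d1"
    "fc FD t1 = ue" "fc FD ue = vs" "fc FD vs = fc D t1" "fc FD t2 = vn" "fc FD vn = uw"
        "fc FD uw = fc D t2"
    "fc FD un = vw" "fc FD vw = un"
    using d1 d2 finger_ends by (simp_all add: fc_def finger_alE finger_sgE)
  let ?C = "{ve, us, ue, vs, vn, uw}"
  let ?H = "dts D \<union> ?C"
  have H: "dts FD = ?H \<union> {un, vw}" unfolding finger_dE by blast
  have p: "fperm (fc FD) (?H \<union> {un, vw})" using pre_fc[OF finger_pre] H by simp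
  have "norb (fc FD) (dts FD) = norb (fc FD) ?H + norb (fc FD) {un, vw}"
    unfolding H
  proof (rule norb_Un[OF p])
    show "?H \<inter> {un, vw} = {}" using fresh finger_neqs by blast
  qed (use fcE in auto)
  moreover have "norb (fc FD) {un, vw} = 1"
  proof (rule norb_single)
    show "fperm (fc FD) {un, vw}" using fperm_Diff(2)[OF p, of "{un, vw}"] fcE by auto
    show "y \<in> orbit (fc FD) un" if "y \<in> {un, vw}" for y using that orbit_cycle2[of "fc FD" un vw]
        fcE by simp
  qed simp
  moreover have "norb (fc FD) ?H = norb ?g (dts D)"
  proof -
    \<comment> \<open>\<open>?ret y\<close> is the old dart after which \<open>y\<close> has been
      inserted into a face walk.\<close>
    let ?ret = "\<lambda>y. if y = ve then d1 else if y = us then d2 else if y = ue \<or> y = vs then t1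
        else t2"
    have "?H = (?H \<union> {un, vw}) - {un, vw}" using fresh finger_neqs by blast
    then have p1: "fperm (fc FD) ?H" using fperm_Diff(1)[OF p, of "{un, vw}"] fcE by auto
    show ?thesis
    proof (rule norb_subdivide[where ret = ?ret, OF p1])
      show "fperm ?g (dts D)" by (rule fperm_swap[OF pre_fc[OF pre] d1 d2])
      show "y \<in> orbit (fc FD) (?ret y)" if yC: "y \<in> ?C" for y
      proof -
        have "ve \<in> orbit (fc FD) d1" "us \<in> orbit (fc FD) d2" "ue \<in> orbit (fc FD) t1"
            "vs \<in> orbit (fc FD) t1"
          "vn \<in> orbit (fc FD) t2" "uw \<in> orbit (fc FD) t2"
          using orbit_step orbit_stepI fcE by metis+
        then show ?thesis using yC finger_neqs by auto
      qed
      show "fc FD y = ?g y \<or> fc FD y \<in> ?C \<and> ?ret (fc FD y) = y" if yD: "y \<in> dts D" for y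
      proof -
        consider "y = d1" | "y = t1" | "y = d2" | "y = t2" | "y \<notin> {d1, t1, d2, t2}" by blast
        then show ?thesis
        proof cases
          case 5 then show ?thesis using g[OF yD 5] by simp
        next
          case 1 show ?thesis unfolding 1 fcE by (simp add: finger_neqs finger_ends_neq)
        next
          case 2 show ?thesis unfolding 2 fcE by (simp add: finger_neqs finger_ends_neq)
        next
          case 3 show ?thesis unfolding 3 fcE by (simp add: finger_neqs finger_ends_neq)
        next
          case 4 show ?thesis unfolding 4 fcE by (simp add: finger_neqs finger_ends_neq)
        qed
      qed
      show "fc FD y \<in> ?C \<and> ?ret (fc FD y) = ?ret y \<or> fc FD y = ?g (?ret y)" if yC: "y \<in>
          ?C" for y
      proof -
        consider "y = ve" | "y = us" | "y = ue" | "y = vs" | "y = vn" | "y = uw" using yC by blast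
        then show ?thesis
        proof cases
          case 1 show ?thesis unfolding 1 fcE by (simp add: finger_neqs finger_ends_neq)
        next
          case 2 show ?thesis unfolding 2 fcE by (simp add: finger_neqs finger_ends_neq)
        next
          case 3 show ?thesis unfolding 3 fcE by (simp add: finger_neqs finger_ends_neq)
        next
          case 4 show ?thesis unfolding 4 fcE by (simp add: finger_neqs finger_ends_neq)
        next
          case 5 show ?thesis unfolding 5 fcE by (simp add: finger_neqs finger_ends_neq)
        next
          case 6 show ?thesis unfolding 6 fcE by (simp add: finger_neqs finger_ends_neq)
        qed
      qed
      show "dts D \<inter> ?C = {}" using fresh by blast
    qed (simp add: d1 d2 finger_ends)
  qed
  ultimately show ?thesis by simp
qed

text \<open>Going straight through both new crossings inserts two darts after each of the four darts
  of the two edges; otherwise the curve is unchanged.\<close>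

private lemma one_component_finger: "one_component FD \<longleftrightarrow> one_component D"
proof -
  let ?h = "straight D \<circ> al D" and ?k = "straight FD \<circ> al FD"
  have st: "straight FD ue = uw" "straight FD un = us" "straight FD uw = ue" "straight FD us = un"
    "straight FD ve = vw" "straight FD vn = vs" "straight FD vw = ve" "straight FD vs = vn"
    by (simp_all add: straight_finger(2) finger_sgE)
  have g: "?k x = ?h x" if "x \<in> dts D" "x \<notin> {d1, t1, d2, t2}" for x
    using that by (simp add: finger_alE straight_finger(1) pre_al_in[OF pre])
  have kE: "?k d1 = vn" "?k vn = us" "?k us = ?h d1" "?k t1 = un" "?k un = vs" "?k vs = ?h t1"
    "?k d2 = ue" "?k ue = ve" "?k ve = ?h d2" "?k t2 = vw" "?k vw = uw" "?k uw = ?h t2"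
    using d1 d2 finger_ends by (simp_all add: finger_alE st straight_finger(1))
  have p: "fperm ?k (dts D \<union> FX)" using pre_straight[OF finger_pre] by (simp add: finger_def)
  let ?ret = "\<lambda>y. if y = vn \<or> y = us then d1 else if y = un \<or> y = vs then t1 else if y =
      ue \<or> y = ve then d2 else t2"
  have "norb ?k (dts D \<union> FX) = norb ?h (dts D)"
  proof (rule norb_subdivide[where ret = ?ret, OF p])
    show "fperm ?h (dts D)" by (rule pre_straight[OF pre])
    show "y \<in> orbit ?k (?ret y)" if yX: "y \<in> FX" for y
    proof -
      have "vn \<in> orbit ?k d1" "us \<in> orbit ?k d1" "un \<in> orbit ?k t1" "vs \<in> orbit ?k t1"
        "ue \<in> orbit ?k d2" "ve \<in> orbit ?k d2" "vw \<in> orbit ?k t2" "uw \<in> orbit ?k t2"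
        using orbit_step orbit_stepI kE by metis+
      then show ?thesis using yX finger_neqs by auto
    qed
    show "?k y = ?h y \<or> ?k y \<in> FX \<and> ?ret (?k y) = y" if yD: "y \<in> dts D" for y
    proof -
      consider "y = d1" | "y = t1" | "y = d2" | "y = t2" | "y \<notin> {d1, t1, d2, t2}" by blast
      then show ?thesis
      proof cases
        case 5 then show ?thesis using g[OF yD 5] by simp
      next
        case 1 show ?thesis unfolding 1 kE by (simp add: finger_neqs)
      next
        case 2 show ?thesis unfolding 2 kE by (simp add: finger_neqs)
      next
        case 3 show ?thesis unfolding 3 kE by (simp add: finger_neqs)
      next
        case 4 show ?thesis unfolding 4 kE by (simp add: finger_neqs)
      qed
    qed
    show "?k y \<in> FX \<and> ?ret (?k y) = ?ret y \<or> ?k y = ?h (?ret y)" if yX: "y \<in> FX" for y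
    proof -
      consider "y = ue" | "y = un" | "y = uw" | "y = us" | "y = ve" | "y = vn" | "y = vw" | "y = vs"
          using yX by blast
      then show ?thesis
      proof cases
        case 1 show ?thesis unfolding 1 kE by (simp add: finger_neqs)
      next
        case 2 show ?thesis unfolding 2 kE by (simp add: finger_neqs)
      next
        case 3 show ?thesis unfolding 3 kE by (simp add: finger_neqs)
      next
        case 4 show ?thesis unfolding 4 kE by (simp add: finger_neqs)
      next
        case 5 show ?thesis unfolding 5 kE by (simp add: finger_neqs)
      next
        case 6 show ?thesis unfolding 6 kE by (simp add: finger_neqs)
      next
        case 7 show ?thesis unfolding 7 kE by (simp add: finger_neqs)
      next
        case 8 show ?thesis unfolding 8 kE by (simp add: finger_neqs)
      qed
    qed
    show "dts D \<inter> FX = {}" using fresh by blast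
  qed (simp add: d1 d2 finger_ends)
  then show ?thesis unfolding one_component_def by (simp add: finger_def)
qed

private lemma finger_norb_sg_new: "norb (sg FD) FX = 2"
proof -
  let ?U = "{ue, un, uw, us}" and ?V = "{ve, vn, vw, vs}"
  have U: "fperm (sg FD) ?U" and V: "fperm (sg FD) ?V"
    by (rule fpermI_surj; use finger_sgE in auto)+
  have UV: "fperm (sg FD) (?U \<union> ?V)" by (rule fpermI_surj; use finger_sgE in auto)
  have "norb (sg FD) (?U \<union> ?V) = norb (sg FD) ?U + norb (sg FD) ?V"
    by (rule norb_Un[OF UV]) (use finger_sgE finger_neqs in auto)
  moreover have "norb (sg FD) ?U = 1" by (rule norb_single[OF _ U, of ue]) (use finger_orbits_new in auto)
  moreover have "norb (sg FD) ?V = 1" by (rule norb_single[OF _ V, of ve]) (use finger_orbits_new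
      finger_neqs in auto)
  moreover have "FX = ?U \<union> ?V" by blast
  ultimately show ?thesis by simp
qed

private lemma finger_counts: "norb (sg FD) (dts FD) = norb (sg D) (dts D) + 2"
    "norb (al FD) (dts FD) = norb (al D) (dts D) + 4"
proof -
  have "card FX = 8" by (simp add: finger_neqs)
  then show "norb (sg FD) (dts FD) = norb (sg D) (dts D) + 2"
      "norb (al FD) (dts FD) = norb (al D) (dts D) + 4"
    using norb_sg_finger norb_al_finger finger_norb_sg_new by linarith+
qed

text \<open>Two vertices, four edges and two faces are added: the bigon, and one more since the
  finger splits the common face.\<close>

lemma finger_based:
  assumes "based_diagram D" "d2 \<in> orbit (fc D) d1"
  shows "based_diagram FD"
proof -
  have "norb (fc FD) (dts FD) = norb (fc D) (dts D) + 2"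
    using norb_fc_finger norb_split[OF pre_fc[OF pre] d1 d2 finger_ends_neq(1) assms(2)] by simp
  then show ?thesis
    using assms(1) finger_counts finger_pre
    unfolding based_diagram_iff planar_diagram_def deg2_finger crossing_finger one_component_finger by
        linarith
qed

text \<open>If the two edges were not on a common face, undoing the bigon would produce a connected map
  of Euler characteristic 4.\<close>
lemma finger_based_reverse:
  assumes "based_diagram FD"
  shows "d2 \<in> orbit (fc D) d1" "based_diagram D"
proof -
  have FD: "norb (sg FD) (dts FD) + norb (fc FD) (dts FD) = norb (al FD) (dts FD) + 2"
    and one: "one_component D" and rest: "crossing_data D" "card (deg2_vertices D) = 1"
    using assms unfolding based_diagram_iff planar_diagram_def deg2_finger crossing_finger
        one_component_finger
    by auto
  show face: "d2 \<in> orbit (fc D) d1"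
  proof (rule ccontr)
    assume "d2 \<notin> orbit (fc D) d1"
    then have "norb (fc FD) (dts FD) = norb (fc D) (dts D)"
      using norb_fc_finger norb_merge[OF pre_fc[OF pre] d1 d2] by simp
    then show False using euler_bound[OF pre one] FD finger_counts by linarith
  qed
  have "norb (fc FD) (dts FD) = norb (fc D) (dts D) + 2"
    using norb_fc_finger norb_split[OF pre_fc[OF pre] d1 d2 finger_ends_neq(1) face] by simp
  then have "norb (sg D) (dts D) + norb (fc D) (dts D) = norb (al D) (dts D) + 2" using FD finger_counts
      by linarith
  then show "based_diagram D" unfolding based_diagram_iff planar_diagram_def using pre one rest by simp
qed

end

section \<open>Reidemeister III\<close>

lemma orbit_period4: "f (f (f (f x))) = x \<Longrightarrow> orbit f x = {x, f x, f (f x), f (f (f x))}"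
  by (rule orbit_cycle4) (rule refl | assumption)+

text \<open>All edges are kept and only the rotations of the three crossings are redrawn. Along each
  side of the triangle the two crossings change places, which is why \<open>c1\<close> and
  \<open>a1\<close> exchange their crossing information.\<close>

definition tri :: "kd \<Rightarrow> nat \<Rightarrow> nat \<Rightarrow> nat \<Rightarrow> nat
    \<Rightarrow> nat \<Rightarrow> nat \<Rightarrow> nat \<Rightarrow> nat \<Rightarrow> nat
    \<Rightarrow> nat \<Rightarrow> nat \<Rightarrow> nat \<Rightarrow> kd" where
  "tri D c1 c2 c3 a1 a2 a3 p1 p2 p3 q1 q2 q3 = \<lparr> dts = dts D,
     sg = (sg D)(c1 := a2, a2 := q1, q1 := p2, p2 := c1,
                 c2 := a3, a3 := q2, q2 := p3, p3 := c2,
                 c3 := a1, a1 := q3, q3 := p1, p1 := c3),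
     al = al D,
     ov = (ov D)(c1 := ov D a1, q1 := ov D a1, a2 := ov D c2, p2 := ov D c2,
                 c2 := ov D a2, q2 := ov D a2, a3 := ov D c3, p3 := ov D c3,
                 c3 := ov D a3, q3 := ov D a3, a1 := ov D c1, p1 := ov D c1) \<rparr>"

context
  fixes D :: kd and c1 c2 c3 a1 a2 a3 p1 p2 p3 q1 q2 q3 :: nat
  assumes based: "based_diagram D" and c: "c1 \<in> dts D" "c2 \<in> dts D" "c3 \<in> dts D"
    and alc: "al D c1 = a1" "al D c2 = a2" "al D c3 = a3"
    and s: "sg D a1 = c2" "sg D c2 = p1" "sg D p1 = q2" "sg D q2 = a1"
      "sg D a2 = c3" "sg D c3 = p2" "sg D p2 = q3" "sg D q3 = a2"
      "sg D a3 = c1" "sg D c1 = p3" "sg D p3 = q1" "sg D q1 = a3"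
    and dist: "distinct [c1, c2, c3, a1, a2, a3, p1, p2, p3, q1, q2, q3]"
begin

lemma R3_tri:
  assumes "(ov D c1 \<and> ov D a1) \<or> (ov D c2 \<and> ov D a2) \<or> (ov D c3 \<and> ov D a3)"
  shows "R3 D (tri D c1 c2 c3 a1 a2 a3 p1 p2 p3 q1 q2 q3)"
  unfolding R3_def Let_def tri_def
  by (rule exI[of _ c1], rule exI[of _ c2], rule exI[of _ c3], unfold alc s, intro conjI)
    (rule c assms dist refl)+

private abbreviation (input) "MD \<equiv> tri D c1 c2 c3 a1 a2 a3 p1 p2 p3 q1 q2 q3"
private abbreviation (input) "TT \<equiv> {c1, c2, c3, a1, a2, a3, p1, p2, p3, q1, q2, q3}"

private lemma tri_pre: "pre_diagram D"
  using based unfolding based_diagram_iff planar_diagram_def by simp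

private lemmas tri_neqs = distinct12_neq[OF dist]

private lemma tri_ala: "al D a1 = c1" "al D a2 = c2" "al D a3 = c3"
  using pre_al_al[OF tri_pre] c alc by metis+

private lemma tri_TD: "c1 \<in> dts D" "c2 \<in> dts D" "c3 \<in> dts D" "a1 \<in> dts D" "a2 \<in> dts D"
    "a3 \<in> dts D"
  "p1 \<in> dts D" "p2 \<in> dts D" "p3 \<in> dts D" "q1 \<in> dts D" "q2 \<in> dts D" "q3 \<in> dts D"
  using c alc pre_al_in[OF tri_pre] pre_sg_in[OF tri_pre] s by metis+

private lemma tri_T_sub: "TT \<subseteq> dts D" using tri_TD by blast

private lemma tri_dE: "dts MD = dts D" and tri_alE: "al MD = al D" by (simp_all add: tri_def)

private lemma tri_sgE: "x \<notin> TT \<Longrightarrow> sg MD x = sg D x"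
  "sg MD c1 = a2" "sg MD a2 = q1" "sg MD q1 = p2" "sg MD p2 = c1"
  "sg MD c2 = a3" "sg MD a3 = q2" "sg MD q2 = p3" "sg MD p3 = c2"
  "sg MD c3 = a1" "sg MD a1 = q3" "sg MD q3 = p1" "sg MD p1 = c3"
  by (simp_all add: tri_def tri_neqs)

private lemma tri_ovE: "x \<notin> TT \<Longrightarrow> ov MD x = ov D x"
  "ov MD c1 = ov D a1" "ov MD q1 = ov D a1" "ov MD a2 = ov D c2" "ov MD p2 = ov D c2"
  "ov MD c2 = ov D a2" "ov MD q2 = ov D a2" "ov MD a3 = ov D c3" "ov MD p3 = ov D c3"
  "ov MD c3 = ov D a3" "ov MD q3 = ov D a3" "ov MD a1 = ov D c1" "ov MD p1 = ov D c1"
  by (simp_all add: tri_def tri_neqs)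

private lemma tri_Tcases: assumes "x \<in> TT"
  obtains "x = c1" | "x = c2" | "x = c3" | "x = a1" | "x = a2" | "x = a3" | "x = p1" | "x = p2" | "x = p3"
    | "x = q1" | "x = q2" | "x = q3"
  using assms by blast

private lemma tri_sgDT: "sg D x \<in> TT" if "x \<in> TT"
  using that by (rule tri_Tcases) (simp_all add: s)

private lemma tri_sgET: "sg MD x \<in> TT" if "x \<in> TT"
  using that by (rule tri_Tcases) (simp_all only: tri_sgE, simp_all)

private lemma tri_sgET4: "sg MD (sg MD (sg MD (sg MD x))) = x" if "x \<in> TT"
  using that by (rule tri_Tcases) (simp_all only: tri_sgE)

private lemma tri_fperm_sgE: "fperm (sg MD) (dts D)"
proof (rule fpermI_surj)
  show "finite (dts D)" by (rule pre_finite[OF tri_pre])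
  show "sg MD x \<in> dts D" if "x \<in> dts D" for x
    using tri_sgET[of x] tri_sgE(1)[of x] pre_sg_in[OF tri_pre that] tri_TD by (cases "x \<in> TT") auto
  show "\<exists>x\<in>dts D. y = sg MD x" if y: "y \<in> dts D" for y
  proof (cases "y \<in> TT")
    case True
    then have "sg MD (sg MD (sg MD y)) \<in> TT" by (intro tri_sgET)
    then have "sg MD (sg MD (sg MD y)) \<in> dts D" using tri_T_sub by (rule subsetD[rotated])
    then show ?thesis using tri_sgET4[OF True] by metis
  next
    case False
    then obtain x where "x \<in> dts D" "y = sg D x" using y fperm_onto[OF pre_sg[OF tri_pre]] by blast
    moreover from this have "x \<notin> TT" using False tri_sgDT by blast
    ultimately show ?thesis using tri_sgE(1) by metis
  qed
qed

private lemma tri_orbitE: "orbit (sg MD) x = orbit (sg D) x" if x: "x \<in> dts D" "x \<notin> TT"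
proof (rule orbit_cong[of _ "dts D - TT", symmetric])
  have "TT \<subseteq> dts D" using tri_TD by blast
  then have p: "fperm (sg D) (dts D - TT)" using tri_sgDT by (rule fperm_Diff(1)[OF pre_sg[OF tri_pre]])
  show "sg D y \<in> dts D - TT" if "y \<in> dts D - TT" for y by (rule fperm_in[OF p that])
  show "sg D y = sg MD y" if "y \<in> dts D - TT" for y
    using that by (intro tri_sgE(1)[symmetric]) blast
  show "x \<in> dts D - TT" using x by blast
qed

private lemma tri_vdegD_T: "vdeg D x = 4" if x: "x \<in> TT"
proof -
  have per: "sg D (sg D (sg D (sg D x))) = x" using x by (rule tri_Tcases) (simp_all only: s)
  have "orbit (sg D) x = {x, sg D x, sg D (sg D x), sg D (sg D (sg D x))}"
    by (rule orbit_period4) (rule per)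
  moreover have "card {x, sg D x, sg D (sg D x), sg D (sg D (sg D x))} = 4"
    using x by (rule tri_Tcases) (simp_all add: s tri_neqs)
  ultimately show ?thesis by (simp add: vdeg_def)
qed

private lemma tri_vdegE_T: "vdeg MD x = 4" if x: "x \<in> TT"
proof -
  have "orbit (sg MD) x = {x, sg MD x, sg MD (sg MD x), sg MD (sg MD (sg MD x))}"
    by (rule orbit_period4) (rule tri_sgET4[OF x])
  moreover have "card {x, sg MD x, sg MD (sg MD x), sg MD (sg MD (sg MD x))} = 4"
    using x by (rule tri_Tcases) (simp_all only: tri_sgE, simp_all add: tri_neqs)
  ultimately show ?thesis by (simp add: vdeg_def)
qed

private lemma tri_vdegE: "x \<in> dts D \<Longrightarrow> vdeg MD x = vdeg D x"
  using tri_vdegE_T tri_vdegD_T tri_orbitE by (cases "x \<in> TT") (simp_all add: vdeg_def)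

private lemma tri_preE: "pre_diagram MD"
  using tri_pre tri_fperm_sgE tri_vdegE unfolding pre_diagram_def tri_dE tri_alE by auto

text \<open>At the three vertices every dart has the same opposite dart before and after the move,
  for instance \<open>q1\<close> opposite \<open>c1\<close>. Hence the curve is literally the
  same.\<close>

private lemma tri_straightE: "x \<in> dts D \<Longrightarrow> straight MD x = straight D x"
proof (cases "x \<in> TT")
  case True
  then have "sg MD (sg MD x) = sg D (sg D x)"
    by (rule tri_Tcases) (simp_all only: tri_sgE s)
  then show ?thesis using tri_vdegE_T[OF True] tri_vdegD_T[OF True] by (simp add: straight_def)
next
  case False
  assume x: "x \<in> dts D"
  have "sg D x \<notin> TT"
  proof
    assume "sg D x \<in> TT"
    then have t: "sg D (sg D (sg D (sg D x))) \<in> TT" by - (assumption | rule tri_sgDT)+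
    have "vdeg D x = 4" using tri_vdegD_T[OF \<open>sg D x \<in> TT\<close>] vdeg_sg[OF tri_pre x] by simp
    from t[unfolded pre_deg4(1)[OF tri_pre x this]] show False using False by contradiction
  qed
  then show ?thesis using False x by (simp add: straight_def tri_vdegE tri_sgE(1))
qed

private lemma tri_one_componentE: "one_component MD \<longleftrightarrow> one_component D"
proof -
  have "norb (straight MD \<circ> al MD) (dts D) = norb (straight D \<circ> al D) (dts D)"
    by (rule norb_cong) (simp_all add: tri_alE tri_straightE straight_in[OF tri_pre] pre_al_in[OF tri_pre])
  then show ?thesis by (simp add: one_component_def tri_dE)
qed

private lemma tri_deg2E: "deg2_vertices MD = deg2_vertices D"
proof -
  have "vdeg MD x = 2 \<and> orbit (sg MD) x = v \<longleftrightarrow> vdeg D x = 2 \<and> orbit (sg D) x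
      = v" if "x \<in> dts D" for x v
    using that tri_vdegE[of x] tri_vdegD_T[of x] tri_orbitE[of x] by (cases "x \<in> TT") auto
  then show ?thesis unfolding deg2_vertices_def tri_dE by blast
qed

text \<open>The crossing with rotation \<open>c1, a2, q1, p2\<close> takes its information from
  \<open>a1\<close> and \<open>c2\<close>. These were neighbours at one old crossing and therefore
  differ; the other two crossings are alike.\<close>

private lemma tri_crossingE: "crossing_data MD"
proof -
  have D: "ov D (sg D x) = (\<not> ov D x)" if "x \<in> dts D" "vdeg D x = 4" for x
    using based that unfolding based_diagram_def crossing_data_def by auto
  have ca: "ov D c2 = (\<not> ov D a1)" "ov D c3 = (\<not> ov D a2)" "ov D c1 = (\<not> ov D a3)"
    using D[OF tri_TD(4)] D[OF tri_TD(5)] D[OF tri_TD(6)] tri_vdegD_T by (simp_all add: s)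
  show ?thesis unfolding crossing_data_def tri_dE
  proof (intro ballI impI)
    fix x assume x: "x \<in> dts D" "vdeg MD x = 4"
    show "ov MD (sg MD x) = (\<not> ov MD x)"
    proof (cases "x \<in> TT")
      case True
      then show ?thesis by (rule tri_Tcases) (simp_all only: tri_sgE tri_ovE ca, simp_all)
    next
      case False
      have "sg MD x \<notin> TT"
      proof
        assume "sg MD x \<in> TT"
        then have "sg MD (sg MD (sg MD (sg MD x))) \<in> TT" by - (assumption | rule tri_sgET)+
        from this[unfolded pre_deg4(1)[OF tri_preE, unfolded tri_dE, OF x]] show False using False by
            contradiction
      qed
      then have "sg D x \<notin> TT" using tri_sgE(1)[OF False] by simp
      then show ?thesis using D[OF x(1)] x tri_vdegE[OF x(1)] False by (simp add: tri_sgE(1) tri_ovE(1))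
    qed
  qed
qed

private lemma tri_norb_sgE: "norb (sg MD) (dts MD) = norb (sg D) (dts D)"
proof -
  have TT: "dts D = (dts D - TT) \<union> TT" using tri_TD by blast
  have split: "norb f (dts D) = norb f (dts D - TT) + norb f TT"
    if "fperm f (dts D)" "\<And>x. x \<in> TT \<Longrightarrow> f x \<in> TT" for f
    using norb_Un[of f "dts D - TT" TT] that TT by (metis Diff_disjoint inf_commute)
  have TD': "TT \<subseteq> dts D" using tri_TD by blast
  have "norb (sg MD) TT * 4 = card TT"
    by (rule norb_uniform[OF fperm_Diff(2)[OF tri_fperm_sgE TD' tri_sgET]]) (auto simp only: tri_vdegE_T
        vdeg_def[symmetric])
  moreover have "norb (sg D) TT * 4 = card TT"
    by (rule norb_uniform[OF fperm_Diff(2)[OF pre_sg[OF tri_pre] TD' tri_sgDT]]) (auto simp only: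
        tri_vdegD_T vdeg_def[symmetric])
  moreover have "norb (sg MD) (dts D - TT) = norb (sg D) (dts D - TT)"
  proof -
    have "orbit (sg MD) ` (dts D - TT) = orbit (sg D) ` (dts D - TT)"
      by (rule image_cong[OF refl]) (erule DiffE, rule tri_orbitE)
    then show ?thesis by (simp only: norb_image)
  qed
  ultimately show ?thesis unfolding tri_dE using split[OF tri_fperm_sgE tri_sgET] split[OF pre_sg[OF
      tri_pre] tri_sgDT] by simp
qed

private definition "b1 = al D q1"
private definition "b2 = al D q2"
private definition "b3 = al D q3"
private definition "e1 = al D p1"
private definition "e2 = al D p2"
private definition "e3 = al D p3"

private lemmas tri_be_def = b1_def b2_def b3_def e1_def e2_def e3_def

private lemma tri_be: "b1 \<in> dts D" "b2 \<in> dts D" "b3 \<in> dts D" "e1 \<in> dts D" "e2 \<in> dts D"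
    "e3 \<in> dts D"
  "al D b1 = q1" "al D b2 = q2" "al D b3 = q3" "al D e1 = p1" "al D e2 = p2" "al D e3 = p3"
  by (simp_all add: tri_be_def pre_al_in[OF tri_pre] pre_al_al[OF tri_pre] tri_TD)

private lemma tri_be_neq: "b1 \<noteq> b2" "b1 \<noteq> b3" "b1 \<noteq> e1" "b1 \<noteq> e2"
    "b1 \<noteq> e3" "b2 \<noteq> b1" "b2 \<noteq> b3" "b2 \<noteq> e1" "b2 \<noteq> e2" "b2 \<noteq> e3"
    "b3 \<noteq> b1" "b3 \<noteq> b2" "b3 \<noteq> e1" "b3 \<noteq> e2" "b3 \<noteq> e3" "e1 \<noteq> b1"
    "e1 \<noteq> b2" "e1 \<noteq> b3" "e1 \<noteq> e2" "e1 \<noteq> e3" "e2 \<noteq> b1" "e2 \<noteq> b2"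
    "e2 \<noteq> b3" "e2 \<noteq> e1" "e2 \<noteq> e3" "e3 \<noteq> b1" "e3 \<noteq> b2" "e3 \<noteq> b3"
    "e3 \<noteq> e1" "e3 \<noteq> e2"
  using tri_be alc tri_ala tri_neqs by metis+

private lemma tri_be_new: "b1 \<noteq> c1" "b1 \<noteq> c2" "b1 \<noteq> c3" "b1 \<noteq> a1"
    "b1 \<noteq> a2" "b1 \<noteq> a3" "b2 \<noteq> c1" "b2 \<noteq> c2" "b2 \<noteq> c3" "b2 \<noteq> a1"
    "b2 \<noteq> a2" "b2 \<noteq> a3" "b3 \<noteq> c1" "b3 \<noteq> c2" "b3 \<noteq> c3" "b3 \<noteq> a1"
    "b3 \<noteq> a2" "b3 \<noteq> a3" "e1 \<noteq> c1" "e1 \<noteq> c2" "e1 \<noteq> c3" "e1 \<noteq> a1"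
    "e1 \<noteq> a2" "e1 \<noteq> a3" "e2 \<noteq> c1" "e2 \<noteq> c2" "e2 \<noteq> c3" "e2 \<noteq> a1"
    "e2 \<noteq> a2" "e2 \<noteq> a3" "e3 \<noteq> c1" "e3 \<noteq> c2" "e3 \<noteq> c3" "e3 \<noteq> a1"
    "e3 \<noteq> a2" "e3 \<noteq> a3"
  using tri_be alc tri_ala tri_neqs by metis+

text \<open>Both face counts are one, for the triangle, plus the count of the same map
  \<open>?g\<close> on the darts off the triangle. Before the move the triangle is bounded by
  \<open>c1, c2, c3\<close> and the darts \<open>a1, a2, a3\<close> subdivide other faces;
  afterwards the roles are exchanged.\<close>

private lemma tri_norb_fcE: "norb (fc MD) (dts MD) = norb (fc D) (dts D)"
proof -
  let ?A = "{a1, a2, a3}" and ?C = "{c1, c2, c3}"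
  let ?H = "dts D - ?A - ?C"
  \<comment> \<open>\<open>?g\<close> shortens the old walk \<open>b1, a3, p2\<close> to
    \<open>b1, p2\<close>, and equally the new walk \<open>e1, c3, q2\<close> to
    \<open>e1, q2\<close>; the other indices are alike.\<close>
  let ?g = "(fc D)(b1 := p2, b2 := p3, b3 := p1)"
  have fD: "fc D c1 = c2" "fc D c2 = c3" "fc D c3 = c1" "fc D a1 = p3" "fc D a2 = p1" "fc D a3 = p2"
    "fc D b1 = a3" "fc D b2 = a1" "fc D b3 = a2" "fc D e1 = q2" "fc D e2 = q3" "fc D e3 = q1"
    by (simp_all add: fc_def alc tri_ala s tri_be)
  have fE: "fc MD a1 = a2" "fc MD a2 = a3" "fc MD a3 = a1" "fc MD c1 = q3" "fc MD c2 = q1" "fc MD c3 = q2"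
    "fc MD b1 = p2" "fc MD b2 = p3" "fc MD b3 = p1" "fc MD e1 = c3" "fc MD e2 = c1" "fc MD e3 = c2"
    by (simp_all add: fc_def alc tri_ala tri_be tri_alE) (simp_all only: tri_sgE)
  have fo: "fc MD x = fc D x" "fc D x \<in> ?H" if "x \<in> ?H" "x \<notin> {b1, b2, b3, e1, e2, e3}" for x
  proof -
    have x: "x \<in> dts D" using that by simp
    have nT: "al D x \<notin> TT"
    proof
      assume "al D x \<in> TT"
      moreover have "x = al D (al D x)" by (simp add: pre_al_al[OF tri_pre x])
      ultimately have "x = al D c1 \<or> x = al D c2 \<or> x = al D c3 \<or> x = al D a1 \<or> x = al D
          a2 \<or> x = al D a3 \<or>
          x = e1 \<or> x = e2 \<or> x = e3 \<or> x = b1 \<or> x = b2 \<or> x = b3"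
        unfolding tri_be_def by (elim insertE emptyE) metis+
      then show False using that by (simp add: alc tri_ala)
    qed
    show eq: "fc MD x = fc D x" using nT by (simp add: fc_def tri_alE tri_sgE(1))
    have "sg MD (al D x) \<notin> TT"
    proof
      assume "sg MD (al D x) \<in> TT"
      then have t: "sg MD (sg MD (sg MD (sg MD (al D x)))) \<in> TT" by - (assumption | rule tri_sgET)+
      have "vdeg MD (al D x) = 4" using tri_vdegE_T[OF \<open>sg MD (al D x) \<in> TT\<close>] vdeg_sg[OF
          tri_preE] x
        by (simp add: tri_dE pre_al_in[OF tri_pre])
      from t[unfolded pre_deg4(1)[OF tri_preE, unfolded tri_dE, OF pre_al_in[OF tri_pre x] this]]
      show False using nT by contradiction
    qed
    then have "fc D x \<notin> TT" using eq by (simp add: fc_def tri_alE)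
    then show "fc D x \<in> ?H" using fperm_in[OF pre_fc[OF tri_pre] x] by blast
  qed
  have gH: "?g x \<in> ?H" if "x \<in> ?H" for x
  proof -
    consider "x = b1" | "x = b2" | "x = b3" | "x = e1" | "x = e2" | "x = e3" | "x \<notin> {b1, b2, b3,
        e1, e2, e3}"
      by blast
    then show ?thesis
    proof cases
      case 7 then show ?thesis using fo(2)[OF that 7] by simp
    qed (simp_all add: fD tri_be_neq tri_TD tri_neqs)
  qed
  have g: "fperm ?g ?H"
  proof (rule fpermI_surj)
    show "finite ?H" using pre_finite[OF tri_pre] by simp
    show "?g x \<in> ?H" if "x \<in> ?H" for x by (rule gH[OF that])
    fix y assume y: "y \<in> ?H"
    have bH: "b1 \<in> ?H" "b2 \<in> ?H" "b3 \<in> ?H" by (simp_all add: tri_be tri_be_new)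
    show "\<exists>x\<in>?H. y = ?g x"
    proof (cases "y = p1 \<or> y = p2 \<or> y = p3")
      case True
      then show ?thesis
      proof (elim disjE)
        assume "y = p1" then show ?thesis by (intro bexI[OF _ bH(3)]) (simp add: tri_be_neq)
      next
        assume "y = p2" then show ?thesis by (intro bexI[OF _ bH(1)]) (simp add: tri_be_neq)
      next
        assume "y = p3" then show ?thesis by (intro bexI[OF _ bH(2)]) (simp add: tri_be_neq)
      qed
    next
      case False
      obtain x where x: "x \<in> dts D" "y = fc D x" using y fperm_onto[OF pre_fc[OF tri_pre]] by blast
      have "x \<notin> {c1, c2, c3, a1, a2, a3, b1, b2, b3}"
        using x(2) y False fD by auto
      then show ?thesis using x by (intro bexI[of _ x]) auto
    qed
  qed
  have tri_orbit: "norb f {x, y, z} = 1" if f: "fperm f {x, y, z}" "f x = y"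
      "f y = z" for f and x y z :: nat
  proof (rule norb_single[OF _ f(1), of x])
    show "w \<in> orbit f x" if "w \<in> {x, y, z}" for w
      using that orbit_self[of x f] orbit_step[of f x] orbit_stepI[OF orbit_step, of f x] f by auto
  qed simp
  have "norb (fc D) (dts D) = norb (fc D) (?H \<union> ?A) + norb (fc D) ?C"
  proof -
    have e: "dts D = (?H \<union> ?A) \<union> ?C" using tri_TD by blast
    show ?thesis
      by (subst e, rule norb_Un) (use pre_fc[OF tri_pre] e fD tri_neqs in auto)
  qed
  moreover have "norb (fc D) ?C = 1"
    by (rule tri_orbit) (use fperm_Diff(2)[OF pre_fc[OF tri_pre], of ?C] fD tri_TD in auto)
  moreover have "norb (fc D) (?H \<union> ?A) = norb ?g ?H"
  proof (rule norb_subdivide[where ret = "\<lambda>y. if y = a3 then b1 else if y = a1 then b2 else b3",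
      OF _ g])
    have "?H \<union> ?A = dts D - ?C" using tri_TD tri_neqs by auto
    then show "fperm (fc D) (?H \<union> ?A)" using fperm_Diff(1)[OF pre_fc[OF tri_pre], of ?C] fD tri_TD
        by auto
    show "?H \<inter> ?A = {}" by blast
    show "(if y = a3 then b1 else if y = a1 then b2 else b3) \<in> ?H" if "y \<in> ?A" for y
      by (simp add: tri_be tri_be_new)
    show "fc D y = ?g y \<or> fc D y \<in> ?A \<and> (if fc D y = a3 then b1 else if fc D y = a1 then b2
        else b3) = y"
      if "y \<in> ?H" for y
    proof -
      consider "y = b1" | "y = b2" | "y = b3" | "y \<notin> {b1, b2, b3}" by blast
      then show ?thesis by cases (simp_all add: fD tri_neqs)
    qed
    show "fc D y \<in> ?A \<and> (if fc D y = a3 then b1 else if fc D y = a1 then b2 else b3) =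
        (if y = a3 then b1 else if y = a1 then b2 else b3) \<or> fc D y = ?g (if y = a3 then b1 else if y
            = a1 then b2 else b3)"
      if yA: "y \<in> ?A" for y
    proof -
      consider "y = a1" | "y = a2" | "y = a3" using yA by blast
      then show ?thesis by cases (simp_all add: fD tri_neqs tri_be_neq)
    qed
    show "y \<in> orbit (fc D) (if y = a3 then b1 else if y = a1 then b2 else b3)" if "y \<in> ?A" for y
      using that orbit_step[of "fc D" b1] orbit_step[of "fc D" b2] orbit_step[of "fc D" b3] fD by auto
  qed
  moreover have "norb (fc MD) (dts MD) = norb (fc MD) (?H \<union> ?C) + norb (fc MD) ?A"
  proof -
    have e: "dts D = (?H \<union> ?C) \<union> ?A" using tri_TD by blast
    show ?thesis unfolding tri_dE
      by (subst e, rule norb_Un) (use pre_fc[OF tri_preE] e fE tri_neqs in \<open>auto simp: tri_dE\<close>)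
  qed
  moreover have "norb (fc MD) ?A = 1"
    by (rule tri_orbit) (use fperm_Diff(2)[OF pre_fc[OF tri_preE], of ?A] fE tri_TD in \<open>auto simp:
        tri_dE\<close>)
  moreover have "norb (fc MD) (?H \<union> ?C) = norb ?g ?H"
  proof (rule norb_subdivide[where ret = "\<lambda>y. if y = c3 then e1 else if y = c1 then e2 else e3",
      OF _ g])
    have "?H \<union> ?C = dts D - ?A" using tri_TD tri_neqs by auto
    then show "fperm (fc MD) (?H \<union> ?C)" using fperm_Diff(1)[OF pre_fc[OF tri_preE], of ?A] fE
        tri_TD by (auto simp: tri_dE)
    show "?H \<inter> ?C = {}" by blast
    show "(if y = c3 then e1 else if y = c1 then e2 else e3) \<in> ?H" if "y \<in> ?C" for y
      by (simp add: tri_be tri_be_new)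
    show "fc MD y = ?g y \<or> fc MD y \<in> ?C \<and> (if fc MD y = c3 then e1 else if fc MD y = c1 then
        e2 else e3) = y"
      if "y \<in> ?H" for y
    proof -
      consider "y = b1" | "y = b2" | "y = b3" | "y = e1" | "y = e2" | "y = e3" | "y \<notin> {b1, b2, b3,
          e1, e2, e3}"
        by blast
      then show ?thesis
      proof cases
        case 7 then show ?thesis using fo(1)[OF that 7] by simp
      qed (simp_all add: fE tri_neqs tri_be_neq)
    qed
    show "fc MD y \<in> ?C \<and> (if fc MD y = c3 then e1 else if fc MD y = c1 then e2 else e3) =
        (if y = c3 then e1 else if y = c1 then e2 else e3) \<or> fc MD y = ?g (if y = c3 then e1 else if
            y = c1 then e2 else e3)"
      if yA: "y \<in> ?C" for y
    proof -
      consider "y = c1" | "y = c2" | "y = c3" using yA by blast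
      then show ?thesis by cases (simp_all add: fD fE tri_neqs tri_be_neq)
    qed
    show "y \<in> orbit (fc MD) (if y = c3 then e1 else if y = c1 then e2 else e3)" if "y \<in> ?C" for y
      using that orbit_step[of "fc MD" e1] orbit_step[of "fc MD" e2] orbit_step[of "fc MD" e3] fE by auto
  qed
  ultimately show ?thesis by simp
qed

lemma tri_based: "based_diagram MD"
  using based tri_crossingE tri_preE tri_norb_sgE tri_norb_fcE
  unfolding based_diagram_iff planar_diagram_def tri_deg2E tri_one_componentE tri_dE tri_alE by simp

end

section \<open>Inserting the marked point\<close>

context
  fixes D :: kd and d :: nat
  assumes knot: "knot_diagram D" and d: "d \<in> dts D"
begin

private definition "m1 = Suc (Max (dts D))"
private definition "m2 = Suc (Suc (Max (dts D)))"
private definition "ae = al D d"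
private abbreviation (input) "BD \<equiv> insert_bp D d"

private lemma bp_pre: "pre_diagram D"
  using knot_diagram_planar[OF knot] unfolding planar_diagram_def by simp

private lemma bp_ends: "ae \<in> dts D" "al D ae = d" "al D d = ae" "ae \<noteq> d" "d \<noteq> ae"
  using pre_al_in[OF bp_pre d] pre_al_al[OF bp_pre d] pre_al_neq[OF bp_pre d] by (auto simp: ae_def)

private lemma bp_neq: "x \<in> dts D \<Longrightarrow> x \<noteq> m1 \<and> x \<noteq> m2 \<and> m1
    \<noteq> x \<and> m2 \<noteq> x"
  using Max_ge[OF pre_finite[OF bp_pre], of x] unfolding m1_def m2_def by auto

private lemma bp_p12: "m1 \<noteq> m2" "m2 \<noteq> m1" unfolding m1_def m2_def by auto

private lemma bp_BD: "BD = \<lparr> dts = dts D \<union> {m1, m2}, sg = (sg D)(m1 := m2, m2 := m1),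
   al = (al D)(d := m1, m1 := d, m2 := ae, ae := m2), ov = (ov D)(m1 := False, m2 := False) \<rparr>"
  unfolding insert_bp_def Let_def m1_def m2_def ae_def by simp

private lemma bp_dE: "dts BD = dts D \<union> {m1, m2}" by (simp add: bp_BD)

private lemma bp_sgE: "sg BD m1 = m2" "sg BD m2 = m1" "x \<in> dts D \<Longrightarrow> sg BD x = sg D x"
  using bp_neq[of x] bp_p12 by (auto simp: bp_BD)

private lemma bp_alE: "al BD d = m1" "al BD m1 = d" "al BD m2 = ae" "al BD ae = m2"
  "x \<in> dts D \<Longrightarrow> x \<noteq> d \<Longrightarrow> x \<noteq> ae \<Longrightarrow> al BD x
      = al D x"
  using bp_neq[OF d] bp_neq[OF bp_ends(1)] bp_neq[of x] bp_p12 bp_ends by (auto simp: bp_BD)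

private lemma bp_vdegE: "x \<in> dts D \<Longrightarrow> vdeg BD x = 4" "vdeg BD m1 = 2" "vdeg BD m2 = 2"
proof -
  show "vdeg BD x = 4" if "x \<in> dts D"
  proof -
    have "orbit (sg BD) x = orbit (sg D) x"
      by (rule orbit_cong[of _ "dts D"]) (auto simp: that bp_sgE pre_sg_in[OF bp_pre])
    then show ?thesis using knot that by (simp add: vdeg_def knot_diagram_def)
  qed
  have "orbit (sg BD) m1 = {m1, m2}" "orbit (sg BD) m2 = {m2, m1}" by (rule orbit_cycle2; simp add: bp_sgE)+
  then show "vdeg BD m1 = 2" "vdeg BD m2 = 2" by (simp_all add: vdeg_def bp_p12)
qed

private lemma bp_fperm_sgE: "fperm (sg BD) (dts BD)"
proof (rule fpermI_surj)
  show "finite (dts BD)" by (simp add: bp_dE pre_finite[OF bp_pre])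
  show "sg BD x \<in> dts BD" if "x \<in> dts BD" for x
    using that bp_sgE pre_sg_in[OF bp_pre] by (auto simp: bp_dE)
  show "\<exists>x\<in>dts BD. y = sg BD x" if y: "y \<in> dts BD" for y
  proof (cases "y \<in> dts D")
    case True
    then obtain x where "x \<in> dts D" "y = sg D x" using fperm_onto[OF pre_sg[OF bp_pre]] by blast
    then show ?thesis using bp_sgE(3) by (intro bexI[of _ x]) (simp_all add: bp_dE)
  next
    case False
    then show ?thesis using y bp_sgE by (auto simp: bp_dE)
  qed
qed

private lemma bp_preE: "pre_diagram BD"
proof -
  have "al BD x \<in> dts BD \<and> al BD (al BD x) = x \<and> al BD x \<noteq> x" if x: "x \<in> dts BD"
      for x
  proof -
    consider "x = d" | "x = ae" | "x = m1" | "x = m2" | "x \<in> dts D" "x \<noteq> d" "x \<noteq> ae"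
      using x unfolding bp_dE by blast
    then show ?thesis
    proof cases
      case 5
      then have "al D x \<noteq> d" "al D x \<noteq> ae" "al D x \<in> dts D"
        using bp_ends pre_al_al[OF bp_pre 5(1)] pre_al_in[OF bp_pre 5(1)] by metis+
      then show ?thesis using 5 pre_al_al[OF bp_pre 5(1)] pre_al_neq[OF bp_pre 5(1)] by (simp add: bp_dE
          bp_alE)
    qed (simp_all add: bp_dE bp_alE bp_ends d bp_neq[OF d] bp_neq[OF bp_ends(1)])
  qed
  moreover have "vdeg BD x \<in> {2, 4}" if "x \<in> dts BD" for x
    using that bp_vdegE unfolding bp_dE by auto
  moreover have "dts BD \<noteq> {}" by (simp add: bp_dE)
  ultimately show ?thesis unfolding pre_diagram_def using bp_fperm_sgE by blast
qed

text \<open>Face walk and curve alike go from \<open>d\<close> through \<open>m2\<close> and from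
  \<open>ae\<close> through \<open>m1\<close>, so one count serves for both.\<close>

private lemma bp_subdivide:
  assumes p: "fperm f (dts D \<union> {m1, m2})" and g: "fperm g (dts D)"
    and f: "f d = m2" "f m2 = g d" "f ae = m1" "f m1 = g ae"
        "\<And>x. x \<in> dts D \<Longrightarrow> x \<noteq> d \<Longrightarrow> x \<noteq> ae
        \<Longrightarrow> f x = g x"
  shows "norb f (dts D \<union> {m1, m2}) = norb g (dts D)"
proof (rule norb_subdivide[where ret = "\<lambda>y. if y = m2 then d else ae", OF p g])
  show "dts D \<inter> {m1, m2} = {}" using bp_neq by blast
  show "f y = g y \<or> f y \<in> {m1, m2} \<and> (if f y = m2 then d else ae) = y" if "y \<in> dts D" for y
  proof -
    consider "y = d" | "y = ae" | "y \<noteq> d" "y \<noteq> ae" by blast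
    then show ?thesis using that by cases (simp_all add: f bp_p12)
  qed
  show "f y \<in> {m1, m2} \<and> (if f y = m2 then d else ae) = (if y = m2 then d else ae) \<or> f y = g
      (if y = m2 then d else ae)"
    if "y \<in> {m1, m2}" for y
  proof -
    consider "y = m1" | "y = m2" using \<open>y \<in> {m1, m2}\<close> by blast
    then show ?thesis by cases (simp_all add: f bp_p12)
  qed
  show "y \<in> orbit f (if y = m2 then d else ae)" if "y \<in> {m1, m2}" for y
    using that orbit_step[of f d] orbit_step[of f ae] f by auto
qed (simp add: d bp_ends)

text \<open>One vertex of degree 2 and one edge are added, while faces and components are merely
  subdivided.\<close>

lemma insert_bp_based: "based_diagram BD"
proof -
  have D: "norb (sg D) (dts D) + norb (fc D) (dts D) = norb (al D) (dts D) + 2" "crossing_data D"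
      "one_component D"
    using knot_diagram_planar[OF knot] unfolding planar_diagram_def by auto
  have fc: "norb (fc BD) (dts BD) = norb (fc D) (dts D)"
    unfolding bp_dE
    by (rule bp_subdivide) (use pre_fc[OF bp_preE] pre_fc[OF bp_pre] in
      \<open>simp_all add: bp_dE fc_def bp_alE bp_sgE bp_ends d pre_al_in[OF bp_pre]\<close>)
  have st: "straight BD x = straight D x" if "x \<in> dts D" for x
    using that knot bp_vdegE by (simp add: straight_def bp_sgE pre_sg_in[OF bp_pre] knot_diagram_def)
  have st2: "straight BD m1 = m2" "straight BD m2 = m1" by (simp_all add: straight_def bp_vdegE bp_sgE)
  have h: "norb (straight BD \<circ> al BD) (dts BD) = norb (straight D \<circ> al D) (dts D)"
    unfolding bp_dE
    by (rule bp_subdivide) (use pre_straight[OF bp_preE] pre_straight[OF bp_pre] in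
      \<open>simp_all add: bp_dE bp_alE st st2 bp_ends d pre_al_in[OF bp_pre]\<close>)
  have deg2: "deg2_vertices BD = {{m1, m2}}"
  proof -
    have "orbit (sg BD) m1 = {m1, m2}" "orbit (sg BD) m2 = {m2, m1}" by (rule orbit_cycle2; simp add:
        bp_sgE)+
    moreover have "{x \<in> dts BD. vdeg BD x = 2} = {m1, m2}" using bp_vdegE unfolding bp_dE by auto
    ultimately have "orbit (sg BD) ` {x \<in> dts BD. vdeg BD x = 2} = {{m1, m2}}" by auto
    then show ?thesis unfolding deg2_vertices_def by blast
  qed
  have cr: "crossing_data BD"
    unfolding crossing_data_def
  proof (intro ballI impI)
    fix x assume "x \<in> dts BD" "vdeg BD x = 4"
    then have x: "x \<in> dts D" using bp_vdegE unfolding bp_dE by auto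
    then show "ov BD (sg BD x) = (\<not> ov BD x)"
      using D(2) knot bp_neq[OF x] bp_neq[OF pre_sg_in[OF bp_pre x]] unfolding crossing_data_def
          knot_diagram_def
      by (simp add: bp_BD)
  qed
  have sgn: "norb (sg BD) (dts BD) = norb (sg D) (dts D) + 1"
  proof -
    have "norb (sg BD) (dts BD) = norb (sg BD) (dts D) + norb (sg BD) {m1, m2}"
      unfolding bp_dE by (rule norb_Un) (use bp_fperm_sgE bp_neq bp_sgE in \<open>auto simp: bp_dE\<close>)
    moreover have "norb (sg BD) (dts D) = norb (sg D) (dts D)"
      by (rule norb_cong) (simp_all add: bp_sgE pre_sg_in[OF bp_pre])
    moreover have "norb (sg BD) {m1, m2} = 1"
    proof (rule norb_single[of m1])
      show "fperm (sg BD) {m1, m2}" by (rule fpermI_surj) (auto simp: bp_sgE)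
      show "y \<in> orbit (sg BD) m1" if "y \<in> {m1, m2}" for y using that orbit_cycle2[of "sg BD" m1
          m2] bp_sgE by simp
    qed simp
    ultimately show ?thesis by simp
  qed
  have "card (dts BD) = card (dts D) + 2"
    unfolding bp_dE using bp_neq bp_p12 pre_finite[OF bp_pre] by (subst card_Un_disjoint) auto
  then have "norb (al BD) (dts BD) = norb (al D) (dts D) + 1"
    using pre_norb_al[OF bp_pre] pre_norb_al[OF bp_preE] by linarith
  then show ?thesis
    unfolding based_diagram_iff planar_diagram_def using bp_preE cr sgn fc h deg2 D by (simp add:
        one_component_def)
qed

end

section \<open>Presentations of diagrams\<close>

text \<open>A presentation names the darts of a based diagram \<open>E\<close> by the indices in \<open>S\<close>: rotation \<open>rho\<close>,
  edges \<open>L\<close> (possibly not all of them) and crossing information \<open>lev\<close>, which is irrelevant on the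
  indices \<open>Z\<close> of the marked point.\<close>
definition presents ::
  "kd \<Rightarrow> ('a \<Rightarrow> nat) \<Rightarrow> 'a set \<Rightarrow> 'a set \<Rightarrow> ('a
      \<Rightarrow> 'a) \<Rightarrow> ('a \<times> 'a) set \<Rightarrow> ('a \<Rightarrow> bool)
      \<Rightarrow> bool" where
  "presents E psi S Z rho L lev \<longleftrightarrow> based_diagram E \<and> bij_betw psi S (dts E) \<and>
     (\<forall>p\<in>S. rho p \<in> S \<and> sg E (psi p) = psi (rho p)) \<and>
     (\<forall>(p, q)\<in>L. p \<in> S \<and> q \<in> S \<and> al E (psi p) = psi q) \<and>
     (\<forall>p\<in>S - Z. ov E (psi p) = lev p)"

lemma presentsD:
  assumes "presents E psi S Z rho L lev"
  shows "based_diagram E" "bij_betw psi S (dts E)" "\<And>p. p \<in> S \<Longrightarrow> rho p \<in> S"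
    "\<And>p. p \<in> S \<Longrightarrow> sg E (psi p) = psi (rho p)"
    "\<And>p q. (p, q) \<in> L \<Longrightarrow> p \<in> S"
        "\<And>p q. (p, q) \<in> L \<Longrightarrow> q \<in> S"
    "\<And>p q. (p, q) \<in> L \<Longrightarrow> al E (psi p) = psi q"
    "\<And>p. p \<in> S \<Longrightarrow> p \<notin> Z \<Longrightarrow> ov E (psi p) = lev p"
    "\<And>p. p \<in> S \<Longrightarrow> psi p \<in> dts E"
        "\<And>p q. p \<in> S \<Longrightarrow> q \<in> S \<Longrightarrow> psi p = psi q
        \<longleftrightarrow> p = q"
    "pre_diagram E"
  using assms unfolding presents_def based_diagram_iff planar_diagram_def
  by (auto simp: bij_betw_def inj_on_def)

lemma presentsI:
  assumes "based_diagram E" "bij_betw psi S (dts E)" "\<And>p. p \<in> S \<Longrightarrow> rho p \<in> S"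
    "\<And>p. p \<in> S \<Longrightarrow> sg E (psi p) = psi (rho p)"
    "\<And>p q. (p, q) \<in> L \<Longrightarrow> p \<in> S \<and> q \<in> S \<and> al E (psi p) = psi q"
    "\<And>p. p \<in> S \<Longrightarrow> p \<notin> Z \<Longrightarrow> ov E (psi p) = lev p"
  shows "presents E psi S Z rho L lev"
  using assms unfolding presents_def by auto

lemma presents_sym_al:
  assumes "presents E psi S Z rho L lev" "(p, q) \<in> L"
  shows "al E (psi q) = psi p"
proof -
  note P = presentsD[OF assms(1)]
  show ?thesis using pre_al_al[OF P(11) P(9)[OF P(5)[OF assms(2)]]] P(7)[OF assms(2)] by simp
qed

text \<open>A triangle move keeps the names of the darts on their edges and changes the rotations.
  Afterwards the diagram has to be read through the indices of the new word, which is a change of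
  names.\<close>

lemma presents_reindex:
  assumes P: "presents E psi S Z rho L lev" and pi: "bij_betw pi S' S"
    and rot: "\<And>p. p \<in> S' \<Longrightarrow> rho' p \<in> S' \<and> pi (rho' p) = rho (pi p)"
    and L: "\<And>p q. (p, q) \<in> L' \<Longrightarrow> p \<in> S' \<and> q \<in> S' \<and> (pi p, pi q)
        \<in> L"
    and lev: "\<And>p. p \<in> S' \<Longrightarrow> p \<notin> Z' \<Longrightarrow> pi p \<notin> Z
        \<and> lev' p = lev (pi p)"
  shows "presents E (psi \<circ> pi) S' Z' rho' L' lev'"
proof -
  note D = presentsD[OF P]
  have S: "pi p \<in> S" if "p \<in> S'" for p using bij_betw_apply[OF pi that] .
  show ?thesis
  proof (rule presentsI)
    show "based_diagram E" by (rule D(1))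
    show "bij_betw (psi \<circ> pi) S' (dts E)" by (rule bij_betw_trans[OF pi D(2)])
    show "rho' p \<in> S'" if "p \<in> S'" for p using rot[OF that] by simp
    show "sg E ((psi \<circ> pi) p) = (psi \<circ> pi) (rho' p)" if "p \<in> S'" for p
      using rot[OF that] D(4)[OF S[OF that]] by simp
    show "p \<in> S' \<and> q \<in> S' \<and> al E ((psi \<circ> pi) p) = (psi \<circ> pi) q" if "(p, q)
        \<in> L'" for p q
      using L[OF that] D(7) by simp
    show "ov E ((psi \<circ> pi) p) = lev' p" if "p \<in> S'" "p \<notin> Z'" for p
      using lev[OF that] D(8)[OF S[OF that(1)]] by simp
  qed
qed

text \<open>Darts with the same index are sent to each other, and the covering edge list makes this
  compatible with \<open>al\<close>. On \<open>Z\<close> the crossing information is unknown, but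
  there the rotation squares to the identity, and \<open>diag_iso\<close> compares crossing
  information at degree 4 only.\<close>

lemma presents_unique:
  assumes P: "presents E psi S Z rho L lev" and P': "presents E' psi' S Z rho L lev"
    and cover: "\<And>p. p \<in> S \<Longrightarrow> \<exists>q. (p, q) \<in> L \<or> (q, p) \<in> L"
    and Z: "\<And>p. p \<in> S \<Longrightarrow> p \<in> Z \<Longrightarrow> rho (rho p) = p"
  shows "diag_iso E E'"
proof -
  note D = presentsD[OF P] and D' = presentsD[OF P']
  define f where "f = psi' \<circ> the_inv_into S psi"
  have f: "f (psi p) = psi' p" if "p \<in> S" for p
    using the_inv_into_f_f[of psi S p] D(2) that unfolding f_def bij_betw_def by simp
  have "bij_betw f (dts E) (dts E')"
    unfolding f_def by (rule bij_betw_trans[OF bij_betw_the_inv_into[OF D(2)] D'(2)])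
  moreover have "f (sg E d) = sg E' (f d) \<and> f (al E d) = al E' (f d) \<and> (vdeg E d = 4
      \<longrightarrow> ov E' (f d) = ov E d)"
    if d: "d \<in> dts E" for d
  proof -
    obtain p where p: "p \<in> S" "d = psi p" using d D(2) unfolding bij_betw_def by blast
    have 1: "f (sg E d) = sg E' (f d)" using D(4) D'(4) f D(3) p by simp
    obtain q where q: "(p, q) \<in> L \<or> (q, p) \<in> L" using cover[OF p(1)] by blast
    then have "q \<in> S" "al E d = psi q" "al E' (psi' p) = psi' q"
      using D(5,6,7) D'(7) presents_sym_al[OF P] presents_sym_al[OF P'] p by auto
    then have 2: "f (al E d) = al E' (f d)" using f p by simp
    have 3: "vdeg E d = 4 \<longrightarrow> ov E' (f d) = ov E d"
    proof
      assume v: "vdeg E d = 4"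
      have "p \<notin> Z"
      proof
        assume "p \<in> Z"
        then have "sg E (sg E d) = d" using Z[OF p(1)] p D(3,4) by simp
        then show False using pre_deg4(2)[OF D(11) d v] by simp
      qed
      then show "ov E' (f d) = ov E d" using D(8) D'(8) f p by simp
    qed
    show ?thesis using 1 2 3 by blast
  qed
  ultimately show ?thesis unfolding diag_iso_def by blast
qed

section \<open>Reidemeister moves on presentations\<close>

lemma fresh_bound:
  assumes "pre_diagram E"
  obtains m where "\<And>x. x \<in> dts E \<Longrightarrow> x < (m :: nat)"
  using finite_nat_set_iff_bounded[of "dts E"] pre_finite[OF assms] by blast

text \<open>Numbers above all darts in use are matched with the fresh indices. The new edge list
  need only be contained in the rewired one, so that a caller verifies a single inclusion.\<close>

lemma presents_kink_add:
  assumes P: "presents E psi S Z rho L lev" and st: "(s, t) \<in> L"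
    and dist: "distinct [x1, x2, x3, x4]" and fresh: "{x1, x2, x3, x4} \<inter> S = {}"
    and rot: "rho x1 = x2" "rho x2 = x3" "rho x3 = x4" "rho x4 = x1"
    and lev: "lev x1 = b" "lev x2 = (\<not> b)" "lev x3 = b" "lev x4 = (\<not> b)"
    and L': "L' \<subseteq> (L - {(s, t), (t, s)}) \<union> {(s, x1), (x1, s), (x2, x3), (x3, x2), (x4,
        t), (t, x4)}"
  shows "\<exists>E' psi'. reid_step E E' \<and> presents E' psi' (S \<union> {x1, x2, x3, x4}) Z rho L'
      lev"
proof -
  note D = presentsD[OF P] and sy = presents_sym_al[OF P]
  obtain m where m: "\<And>x. x \<in> dts E \<Longrightarrow> x < m" using fresh_bound[OF D(11)] by blast
  define y1 and y2 and y3 and y4 where "y1 = m + 0" and "y2 = m + 1" and "y3 = m + 2" and "y4 = m + 3"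
  have yd: "distinct [y1, y2, y3, y4]" by (simp add: y1_def y2_def y3_def y4_def)
  note yneq = distinct4_neq[OF yd]
  have yn: "x \<in> dts E \<Longrightarrow> x \<noteq> y1 \<and> y1 \<noteq> x \<and> x \<noteq> y2
      \<and> y2 \<noteq> x \<and> x \<noteq> y3 \<and> y3 \<noteq> x \<and> x \<noteq> y4 \<and> y4
      \<noteq> x" for x
    using m[of x] unfolding y1_def y2_def y3_def y4_def by auto
  have yf: "{y1, y2, y3, y4} \<inter> dts E = {}" using yn by blast
  let ?X = "{x1, x2, x3, x4}"
  let ?Y = "{y1, y2, y3, y4}"
  define psi' where "psi' = psi(x1 := y1, x2 := y2, x3 := y3, x4 := y4)"
  note xneq = distinct4_neq[OF dist]
  have px: "psi' x1 = y1" "psi' x2 = y2" "psi' x3 = y3" "psi' x4 = y4"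
    by (simp_all add: psi'_def xneq)
  have po: "psi' p = psi p" if "p \<in> S" for p using that fresh unfolding psi'_def by auto
  have endS: "s \<in> S" "t \<in> S"
    using D(5,6) st by auto
  let ?E = "kink E (psi s) y1 y2 y3 y4 b"
  have als: "al E (psi s) = psi t" "al E (psi t) = psi s" using D(7) sy st by auto
  have ends: "psi s \<noteq> psi t" "psi t \<noteq> psi s" using pre_al_neq[OF D(11) D(9)[OF endS(1)]]
      als by auto
  have R: "R1 E ?E" by (rule R1_kink[OF D(9)[OF endS(1)] yd yf])
  have B: "based_diagram ?E" using kink_based[OF D(11) D(9)[OF endS(1)] yd yf] D(1) by simp
  have step: "reid_step E ?E" unfolding reid_step_def using D(1) B R by simp
  have dE: "dts ?E = dts E \<union> ?Y" by (simp add: kink_def)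
  have sgo: "sg ?E x = sg E x" "ov ?E x = ov E x" if "x \<in> dts E" for x using yn[OF that] by (simp_all
      add: kink_def)
  have sgn: "sg ?E y1 = y2" "sg ?E y2 = y3" "sg ?E y3 = y4" "sg ?E y4 = y1"
    by (simp_all add: kink_def yneq)
  have ovn: "ov ?E y1 = b" "ov ?E y2 = (\<not> b)" "ov ?E y3 = b" "ov ?E y4 = (\<not> b)"
    by (simp_all add: kink_def yneq)
  have alo: "al ?E x = al E x" if "x \<in> dts E" "x \<notin> {psi s, psi t}" for x
    using yn[OF that(1)] that(2) by (simp add: kink_def als)
  have aln: "al ?E (psi s) = y1" "al ?E y1 = (psi s)" "al ?E y2 = y3" "al ?E y3 = y2" "al ?E y4 = (psi t)"
      "al ?E (psi t) = y4"
    by (simp_all add: kink_def als yneq ends yn[OF D(9)[OF endS(1)]] yn[OF D(9)[OF endS(2)]])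
  have "presents ?E psi' (S \<union> ?X) Z rho L' lev"
  proof (rule presentsI)
    show "based_diagram ?E" by (rule B)
    have "bij_betw psi' S (dts E)" using D(2) po by (simp cong: bij_betw_cong)
    moreover have "bij_betw psi' ?X ?Y" unfolding bij_betw_def inj_on_def using px yneq by auto
    ultimately show "bij_betw psi' (S \<union> ?X) (dts ?E)"
      unfolding dE using yf by (intro bij_betw_combine) blast+
    fix p assume p: "p \<in> S \<union> ?X"
    then consider "p \<in> S" | "p = x1" | "p = x2" | "p = x3" | "p = x4" by blast
    then have "rho p \<in> S \<union> ?X \<and> sg ?E (psi' p) = psi' (rho p) \<and> (p \<notin> Z
        \<longrightarrow> ov ?E (psi' p) = lev p)"
    proof cases
      case 1
      show ?thesis using D(3)[OF 1] D(4)[OF 1] D(8)[OF 1] sgo[OF D(9)[OF 1]] po[OF 1] po[OF D(3)[OF 1]]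
          by simp
    qed (simp_all add: rot px sgn ovn lev)
    then show "rho p \<in> S \<union> ?X" "sg ?E (psi' p) = psi' (rho p)"
        "p \<notin> Z \<Longrightarrow> ov ?E (psi' p) = lev p" by auto
  next
    fix p q assume pq: "(p, q) \<in> L'"
    have "(p, q) \<in> L \<and> (p, q) \<notin> {(s, t), (t, s)} \<or> (p, q) \<in> {(s, x1), (x1, s),
        (x2, x3), (x3, x2), (x4, t), (t, x4)}"
      using subsetD[OF L' pq] by (simp only: Un_iff Diff_iff)
    then consider "(p, q) \<in> L" "(p, q) \<notin> {(s, t), (t, s)}" | "(p, q) \<in> {(s, x1), (x1, s),
        (x2, x3), (x3, x2), (x4, t), (t, x4)}" by (elim disjE conjE)
    then show "p \<in> S \<union> ?X \<and> q \<in> S \<union> ?X \<and> al ?E (psi' p) = psi' q"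
    proof cases
      case 1
      have pS: "p \<in> S" and qS: "q \<in> S" using D(5,6) 1(1) by auto
      \<comment> \<open>A listed edge at an end of the cut edge is the cut edge itself, as
        \<open>al\<close> is a function.\<close>
      have "psi p \<notin> {psi s, psi t}"
      proof
        assume "psi p \<in> {psi s, psi t}"
        then have "p \<in> {s, t}" using D(10)[OF pS] endS by simp
        then have "(p, q) \<in> {(s, t), (t, s)}"
          using D(7)[OF 1(1)] by (elim insertE emptyE) (simp_all add: als D(10) qS endS)
        then show False using 1(2) by contradiction
      qed
      then show ?thesis using alo[OF D(9)[OF pS]] D(7)[OF 1(1)] po pS qS by simp
    next
      case 2
      then show ?thesis by (elim insertE emptyE) (simp_all add: px aln endS po)
    qed
  qed
  then show ?thesis using step by blast
qed

text \<open>Faces are not part of a presentation, so the common face enters as a premise about the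
  presented diagram.\<close>

lemma presents_finger_add:
  assumes P: "presents E psi S Z rho L lev" and st: "(s1, t1) \<in> L" "(s2, t2) \<in> L"
    and dist: "distinct [ue, un, uw, us, ve, vn, vw, vs]" and fresh: "{ue, un, uw, us, ve, vn, vw, vs}
        \<inter> S = {}"
    and rot: "rho ue = un" "rho un = uw" "rho uw = us" "rho us = ue" "rho ve = vn" "rho vn = vw"
        "rho vw = vs" "rho vs = ve"
    and lev: "lev us = b" "lev un = b" "lev vs = b" "lev vn = b" "lev ue = (\<not> b)"
        "lev uw = (\<not> b)" "lev ve = (\<not> b)" "lev vw = (\<not> b)"
    and face: "psi s2 \<in> orbit (fc E) (psi s1)" and ne: "s2 \<noteq> s1" "s2 \<noteq> t1"
    and L': "L' \<subseteq> (L - {(s1, t1), (t1, s1), (s2, t2), (t2, s2)}) \<union> {(s1, vs), (vs, s1),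
        (vn, un), (un, vn), (us, t1), (t1, us), (s2, uw), (uw, s2), (ue, vw), (vw, ue), (ve, t2), (t2, ve)}"
  shows "\<exists>E' psi'. reid_step E E' \<and> presents E' psi' (S \<union> {ue, un, uw, us, ve, vn,
      vw, vs}) Z rho L' lev"
proof -
  note D = presentsD[OF P] and sy = presents_sym_al[OF P]
  obtain m where m: "\<And>x. x \<in> dts E \<Longrightarrow> x < m" using fresh_bound[OF D(11)] by blast
  define y1 and y2 and y3 and y4 and y5 and y6 and y7 and y8 where "y1 = m + 0" and "y2 = m + 1" and "y3
      = m + 2" and "y4 = m + 3" and "y5 = m + 4" and "y6 = m + 5" and "y7 = m + 6" and "y8 = m + 7"
  have yd: "distinct [y1, y2, y3, y4, y5, y6, y7, y8]" by (simp add: y1_def y2_def y3_def y4_def y5_def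
      y6_def y7_def y8_def)
  note yneq = distinct8_neq[OF yd]
  have yn: "x \<in> dts E \<Longrightarrow> x \<noteq> y1 \<and> y1 \<noteq> x \<and> x \<noteq> y2
      \<and> y2 \<noteq> x \<and> x \<noteq> y3 \<and> y3 \<noteq> x \<and> x \<noteq> y4 \<and> y4
      \<noteq> x \<and> x \<noteq> y5 \<and> y5 \<noteq> x \<and> x \<noteq> y6 \<and> y6 \<noteq> x
      \<and> x \<noteq> y7 \<and> y7 \<noteq> x \<and> x \<noteq> y8 \<and> y8 \<noteq> x" for x
    using m[of x] unfolding y1_def y2_def y3_def y4_def y5_def y6_def y7_def y8_def by auto
  have yf: "{y1, y2, y3, y4, y5, y6, y7, y8} \<inter> dts E = {}" using yn by blast
  let ?X = "{ue, un, uw, us, ve, vn, vw, vs}"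
  let ?Y = "{y1, y2, y3, y4, y5, y6, y7, y8}"
  define psi' where "psi' = psi(ue := y1, un := y2, uw := y3, us := y4, ve := y5, vn := y6, vw := y7, vs
      := y8)"
  note xneq = distinct8_neq[OF dist]
  have px: "psi' ue = y1" "psi' un = y2" "psi' uw = y3" "psi' us = y4" "psi' ve = y5" "psi' vn = y6"
      "psi' vw = y7" "psi' vs = y8"
    by (simp_all add: psi'_def xneq)
  have po: "psi' p = psi p" if "p \<in> S" for p using that fresh unfolding psi'_def by auto
  have endS: "s1 \<in> S" "t1 \<in> S" "s2 \<in> S" "t2 \<in> S"
    using D(5,6) st by auto
  let ?E = "finger E (psi s1) (psi s2) y1 y2 y3 y4 y5 y6 y7 y8 b"
  have als: "al E (psi s1) = psi t1" "al E (psi t1) = psi s1" "al E (psi s2) = psi t2"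
      "al E (psi t2) = psi s2"
    using D(7) sy st by auto
  have ne': "psi s2 \<noteq> psi s1" "psi s2 \<noteq> al E (psi s1)"
    using ne D(10) endS als by auto
  have ends: "psi s1 \<noteq> psi t1" "psi s1 \<noteq> psi s2" "psi s1 \<noteq> psi t2"
      "psi t1 \<noteq> psi s1" "psi t1 \<noteq> psi s2" "psi t1 \<noteq> psi t2"
    "psi s2 \<noteq> psi s1" "psi s2 \<noteq> psi t1" "psi s2 \<noteq> psi t2" "psi t2 \<noteq> psi s1"
        "psi t2 \<noteq> psi t1" "psi t2 \<noteq> psi s2"
    using ne' als pre_al_neq[OF D(11) D(9)[OF endS(1)]] pre_al_neq[OF D(11) D(9)[OF endS(3)]] by metis+
  have R: "R2 E ?E" by (rule R2_finger[OF D(9)[OF endS(1)] face ne' yd yf])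
  have B: "based_diagram ?E"
    by (rule finger_based[OF D(11) D(9)[OF endS(1)] D(9)[OF endS(3)] ne' yd yf D(1) face])
  have step: "reid_step E ?E" unfolding reid_step_def using D(1) B R by simp
  have dE: "dts ?E = dts E \<union> ?Y" by (simp add: finger_def)
  have sgo: "sg ?E x = sg E x" "ov ?E x = ov E x" if "x \<in> dts E" for x using yn[OF that] by (simp_all
      add: finger_def)
  have sgn: "sg ?E y1 = y2" "sg ?E y2 = y3" "sg ?E y3 = y4" "sg ?E y4 = y1" "sg ?E y5 = y6"
      "sg ?E y6 = y7" "sg ?E y7 = y8" "sg ?E y8 = y5"
    by (simp_all add: finger_def yneq)
  have ovn: "ov ?E y4 = b" "ov ?E y2 = b" "ov ?E y8 = b" "ov ?E y6 = b" "ov ?E y1 = (\<not> b)"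
      "ov ?E y3 = (\<not> b)" "ov ?E y5 = (\<not> b)" "ov ?E y7 = (\<not> b)"
    by (simp_all add: finger_def yneq)
  have alo: "al ?E x = al E x" if "x \<in> dts E" "x \<notin> {psi s1, psi t1, psi s2, psi t2}" for x
    using yn[OF that(1)] that(2) by (simp add: finger_def als)
  have aln: "al ?E (psi s1) = y8" "al ?E y8 = (psi s1)" "al ?E y6 = y2" "al ?E y2 = y6"
      "al ?E y4 = (psi t1)" "al ?E (psi t1) = y4" "al ?E (psi s2) = y3" "al ?E y3 = (psi s2)"
      "al ?E y1 = y7" "al ?E y7 = y1" "al ?E y5 = (psi t2)" "al ?E (psi t2) = y5"
    by (simp_all add: finger_def als yneq ends yn[OF D(9)[OF endS(1)]] yn[OF D(9)[OF endS(2)]] yn[OF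
        D(9)[OF endS(3)]] yn[OF D(9)[OF endS(4)]])
  have "presents ?E psi' (S \<union> ?X) Z rho L' lev"
  proof (rule presentsI)
    show "based_diagram ?E" by (rule B)
    have "bij_betw psi' S (dts E)" using D(2) po by (simp cong: bij_betw_cong)
    moreover have "bij_betw psi' ?X ?Y" unfolding bij_betw_def inj_on_def using px yneq by auto
    ultimately show "bij_betw psi' (S \<union> ?X) (dts ?E)"
      unfolding dE using yf by (intro bij_betw_combine) blast+
    fix p assume p: "p \<in> S \<union> ?X"
    then consider "p \<in> S" | "p = ue" | "p = un" | "p = uw" | "p = us" | "p = ve" | "p = vn" | "p =
        vw" | "p = vs" by blast
    then have "rho p \<in> S \<union> ?X \<and> sg ?E (psi' p) = psi' (rho p) \<and> (p \<notin> Z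
        \<longrightarrow> ov ?E (psi' p) = lev p)"
    proof cases
      case 1
      show ?thesis using D(3)[OF 1] D(4)[OF 1] D(8)[OF 1] sgo[OF D(9)[OF 1]] po[OF 1] po[OF D(3)[OF 1]]
          by simp
    qed (simp_all add: rot px sgn ovn lev)
    then show "rho p \<in> S \<union> ?X" "sg ?E (psi' p) = psi' (rho p)"
        "p \<notin> Z \<Longrightarrow> ov ?E (psi' p) = lev p" by auto
  next
    fix p q assume pq: "(p, q) \<in> L'"
    have "(p, q) \<in> L \<and> (p, q) \<notin> {(s1, t1), (t1, s1), (s2, t2), (t2, s2)} \<or> (p, q)
        \<in> {(s1, vs), (vs, s1), (vn, un), (un, vn), (us, t1), (t1, us), (s2, uw), (uw, s2), (ue, vw),
        (vw, ue), (ve, t2), (t2, ve)}"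
      using subsetD[OF L' pq] by (simp only: Un_iff Diff_iff)
    then consider "(p, q) \<in> L" "(p, q) \<notin> {(s1, t1), (t1, s1), (s2, t2), (t2, s2)}" | "(p, q)
        \<in> {(s1, vs), (vs, s1), (vn, un), (un, vn), (us, t1), (t1, us), (s2, uw), (uw, s2), (ue, vw),
        (vw, ue), (ve, t2), (t2, ve)}" by (elim disjE conjE)
    then show "p \<in> S \<union> ?X \<and> q \<in> S \<union> ?X \<and> al ?E (psi' p) = psi' q"
    proof cases
      case 1
      have pS: "p \<in> S" and qS: "q \<in> S" using D(5,6) 1(1) by auto
      have "psi p \<notin> {psi s1, psi t1, psi s2, psi t2}"
      proof
        assume "psi p \<in> {psi s1, psi t1, psi s2, psi t2}"
        then have "p \<in> {s1, t1, s2, t2}" using D(10)[OF pS] endS by simp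
        then have "(p, q) \<in> {(s1, t1), (t1, s1), (s2, t2), (t2, s2)}"
          using D(7)[OF 1(1)] by (elim insertE emptyE) (simp_all add: als D(10) qS endS)
        then show False using 1(2) by contradiction
      qed
      then show ?thesis using alo[OF D(9)[OF pS]] D(7)[OF 1(1)] po pS qS by simp
    next
      case 2
      then show ?thesis by (elim insertE emptyE) (simp_all add: px aln endS po)
    qed
  qed
  then show ?thesis using step by blast
qed

text \<open>The smaller diagram \<open>F\<close> forgets four darts and joins \<open>s\<close> to
  \<open>t\<close>. It keeps the total functions \<open>sg\<close> and \<open>ov\<close> of
  \<open>E\<close>, so that \<open>E\<close> is literally a \<open>kink\<close> of \<open>F\<close>
  and the results on insertion apply backwards.\<close>

lemma presents_kink_del:
  assumes P: "presents E psi (S \<union> {x1, x2, x3, x4}) Z rho L lev"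
    and st: "(s, x1) \<in> L" "(x2, x3) \<in> L" "(x4, t) \<in> L" and endS: "s \<in> S" "t \<in> S"
    and dist: "distinct [x1, x2, x3, x4]" and fresh: "{x1, x2, x3, x4} \<inter> S = {}" and XZ: "{x1, x2,
        x3, x4} \<inter> Z = {}"
    and rot: "rho x1 = x2" "rho x2 = x3" "rho x3 = x4"
        "rho x4 = x1" and rotS: "\<And>p. p \<in> S \<Longrightarrow> rho p \<in> S"
    and lev: "lev x1 = b" "lev x2 = (\<not> b)" "lev x3 = b" "lev x4 = (\<not> b)"
    and L': "L' \<subseteq> {(p, q) \<in> L. p \<in> S \<and> q \<in> S} \<union> {(s, t), (t, s)}"
  shows "\<exists>E'. reid_step E E' \<and> presents E' psi S Z rho L' lev"
proof -
  note D = presentsD[OF P] and sy = presents_sym_al[OF P]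
  let ?X = "{x1, x2, x3, x4}"
  let ?Y = "{psi x1, psi x2, psi x3, psi x4}"
  note xneq = distinct4_neq[OF dist]
  have inX: "x1 \<in> S \<union> ?X" "x2 \<in> S \<union> ?X" "x3 \<in> S \<union> ?X"
      "x4 \<in> S \<union> ?X" by simp_all
  have inS: "p \<in> S \<union> ?X" if "p \<in> S" for p using that by simp
  have "inj_on psi (set [x1, x2, x3, x4])"
    by (rule inj_on_subset[of psi "S \<union> ?X"]) (use D(2) in \<open>simp_all add: bij_betw_def\<close>)
  then have yd: "distinct [psi x1, psi x2, psi x3, psi x4]"
    using dist distinct_map[of psi "[x1, x2, x3, x4]"] by (simp only: list.map)
  note yneq = distinct4_neq[OF yd]
  have yo: "psi p \<noteq> psi x" if "p \<in> S" "x \<in> ?X" for p x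
    using that fresh D(10)[of p x] by auto
  have al1: "al E (psi s) = psi x1" "al E (psi x2) = psi x3" "al E (psi x4) = psi t"
    using D(7) st by simp_all
  have al2: "al E (psi x1) = psi s" "al E (psi x3) = psi x2" "al E (psi t) = psi x4"
    using sy st by simp_all
  define F where "F = E\<lparr>dts := psi ` S, al := (al E)(psi s := psi t, psi t := psi s)\<rparr>"
  have dF: "dts F = psi ` S" and sgF: "sg F = sg E" and ovF: "ov F = ov E"
    and alF: "al F = (al E)(psi s := psi t, psi t := psi s)"
    by (simp_all add: F_def)
  have dE: "dts E = psi ` S \<union> ?Y" using D(2) unfolding bij_betw_def by auto
  have yf: "?Y \<inter> dts F = {}" using yo unfolding dF by fastforce
  \<comment> \<open>Equal ends would have equal partners, but the partners are \<open>psi x1\<close>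
    and \<open>psi x4\<close>.\<close>
  have ends: "psi s \<noteq> psi t" "psi t \<noteq> psi s"
    using yneq al1 al2 by metis+
  have alFe: "al F (psi s) = psi t" "al F (psi t) = psi s"
    by (simp_all add: alF ends)
  have alFo: "al F x = al E x" if "x \<notin> {psi s, psi t}" for x using that by (simp add: alF)
  have ysg: "sg E (psi x1) = psi x2" "sg E (psi x2) = psi x3" "sg E (psi x3) = psi x4"
      "sg E (psi x4) = psi x1"
    using D(4)[OF inX(1)] D(4)[OF inX(2)] D(4)[OF inX(3)] D(4)[OF inX(4)] by (simp_all add: rot)
  have yov: "ov E (psi x1) = b" "ov E (psi x2) = (\<not> b)" "ov E (psi x3) = b"
      "ov E (psi x4) = (\<not> b)"
    using D(8) inX lev XZ by simp_all
  have ye1: "psi s \<noteq> psi x1" "psi s \<noteq> psi x2" "psi s \<noteq> psi x3"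
      "psi s \<noteq> psi x4" "psi t \<noteq> psi x1" "psi t \<noteq> psi x2" "psi t \<noteq> psi x3"
      "psi t \<noteq> psi x4"
    by (rule yo, rule endS, simp)+
  note ye = ye1 ye1[symmetric]
  have rec: "E = kink F (psi s) (psi x1) (psi x2) (psi x3) (psi x4) b"
  proof -
    have "al E = al (kink F (psi s) (psi x1) (psi x2) (psi x3) (psi x4) b)"
    proof
      fix x
      show "al E x = al (kink F (psi s) (psi x1) (psi x2) (psi x3) (psi x4) b) x"
      proof (cases "x \<in> {psi s, psi t} \<union> ?Y")
        case True
        then show ?thesis unfolding kink_def
          by (elim UnE insertE emptyE) (simp_all add: alFe al1 al2 yneq ye ends)
      next
        case False
        then show ?thesis unfolding kink_def by (simp add: alFo alFe)
      qed
    qed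
    moreover have "sg E = sg (kink F (psi s) (psi x1) (psi x2) (psi x3) (psi x4) b)" unfolding kink_def
        sgF using ysg by (auto simp: fun_eq_iff)
    moreover have "ov E = ov (kink F (psi s) (psi x1) (psi x2) (psi x3) (psi x4) b)" unfolding kink_def
        ovF using yov by (auto simp: fun_eq_iff)
    moreover have "dts E = dts (kink F (psi s) (psi x1) (psi x2) (psi x3) (psi x4) b)" unfolding kink_def
        dF dE by simp
    ultimately show ?thesis by simp
  qed
  have pre: "pre_diagram F"
  proof -
    have orb: "orbit (sg F) (psi p) = orbit (sg E) (psi p)" for p by (simp add: sgF)
    have inE: "psi p \<in> dts E" if "p \<in> S" for p using that by (simp add: dE)
    have perm: "fperm (sg F) (dts F)"
    proof (rule fpermI)
      show "finite (dts F)" using pre_finite[OF D(11)] unfolding dF dE by simp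
      show "sg F x \<in> dts F" if "x \<in> dts F" for x
        using that D(4)[OF inS] rotS unfolding dF sgF by auto
      show "inj_on (sg F) (dts F)"
        using fperm_inj[OF pre_sg[OF D(11)]] unfolding inj_on_def dF sgF dE by blast
    qed
    have "al F x \<in> dts F \<and> al F (al F x) = x \<and> al F x \<noteq> x" if x: "x \<in> dts F" for x
    proof (cases "x \<in> {psi s, psi t}")
      case True
      then show ?thesis by (elim insertE emptyE) (simp_all add: alFe dF endS ends)
    next
      case False
      have xE: "x \<in> dts E" using x unfolding dF dE by blast
      have aa: "al E (al E x) = x" by (rule pre_al_al[OF D(11) xE])
      have xY: "x \<notin> ?Y" using x yf by blast
      have "al E x \<notin> ?Y \<union> {psi s, psi t}"
      proof
        assume "al E x \<in> ?Y \<union> {psi s, psi t}"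
        then have "al E (al E x) \<in> ?Y \<union> {psi s, psi t}"
          by (elim UnE insertE emptyE) (simp_all add: al1 al2)
        then show False using xY False aa by simp
      qed
      moreover have "al E x \<in> dts E" by (rule pre_al_in[OF D(11) xE])
      ultimately have "al E x \<in> dts F" "al E x \<notin> {psi s, psi t}" unfolding dF dE by auto
      then show ?thesis using alFo[OF False] alFo[of "al E x"] aa pre_al_neq[OF D(11) xE] by simp
    qed
    moreover have "vdeg F x \<in> {2, 4}" if "x \<in> dts F" for x
    proof -
      have "x \<in> dts E" using that unfolding dF dE by blast
      then show ?thesis using pre_vdeg[OF D(11)] by (auto simp: vdeg_def sgF)
    qed
    moreover have "dts F \<noteq> {}" using endS unfolding dF by blast
    ultimately show ?thesis using perm unfolding pre_diagram_def by blast
  qed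
  have sF: "psi s \<in> dts F" using endS unfolding dF by blast
  have B: "based_diagram F" using kink_based[OF pre sF yd yf] D(1) rec by simp
  have "R1 F E" by (subst rec) (rule R1_kink[OF sF yd yf])
  then have step: "reid_step E F" unfolding reid_step_def using D(1) B by simp
  have "presents F psi S Z rho L' lev"
  proof (rule presentsI)
    show "based_diagram F" using B by simp
    show "bij_betw psi S (dts F)" using D(2) unfolding dF bij_betw_def by (auto intro: inj_on_subset)
    show "rho p \<in> S" if "p \<in> S" for p by (rule rotS[OF that])
    show "sg F (psi p) = psi (rho p)" if "p \<in> S" for p using D(4)[OF inS[OF that]] by (simp add: sgF)
    show "ov F (psi p) = lev p" if "p \<in> S"
        "p \<notin> Z" for p using D(8)[OF inS[OF that(1)] that(2)] by (simp add: ovF)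
    fix p q assume pq: "(p, q) \<in> L'"
    have "(p, q) \<in> L \<and> p \<in> S \<and> q \<in> S \<or> (p, q) \<in> {(s, t), (t, s)}"
      using subsetD[OF L' pq] by (simp only: Un_iff mem_Collect_eq prod.case)
    then consider "(p, q) \<in> L" "p \<in> S"
        "q \<in> S" | "(p, q) \<in> {(s, t), (t, s)}" by (elim disjE conjE)
    then show "p \<in> S \<and> q \<in> S \<and> al F (psi p) = psi q"
    proof cases
      case 1
      have "psi p \<notin> {psi s, psi t}"
      proof
        assume "psi p \<in> {psi s, psi t}"
        then have "al E (psi p) \<in> ?Y" by (elim insertE emptyE) (simp_all add: al1 al2)
        then have "psi q \<in> ?Y" using D(7)[OF 1(1)] by simp
        then show False using yf 1(3) unfolding dF by blast
      qed
      then show ?thesis using alFo D(7)[OF 1(1)] 1 by simp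
    next
      case 2
      then show ?thesis by (elim insertE emptyE) (simp_all add: alFe endS)
    qed
  qed
  then show ?thesis using step by blast
qed

text \<open>The face condition of Reidemeister II is not a premise here: it is derived from the
  planarity of \<open>E\<close>, which is again literally a \<open>finger\<close> of the reduced
  diagram \<open>F\<close>.\<close>

lemma presents_finger_del:
  assumes P: "presents E psi (S \<union> {ue, un, uw, us, ve, vn, vw, vs}) Z rho L lev"
    and st: "(s1, vs) \<in> L" "(vn, un) \<in> L" "(us, t1) \<in> L" "(s2, uw) \<in> L" "(ue, vw) \<in> L"
        "(ve, t2) \<in> L" and endS: "s1 \<in> S" "t1 \<in> S" "s2 \<in> S" "t2 \<in> S"
    and dist: "distinct [ue, un, uw, us, ve, vn, vw, vs]" and fresh: "{ue, un, uw, us, ve, vn, vw, vs}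
        \<inter> S = {}" and XZ: "{ue, un, uw, us, ve, vn, vw, vs} \<inter> Z = {}"
    and rot: "rho ue = un" "rho un = uw" "rho uw = us" "rho us = ue" "rho ve = vn" "rho vn = vw"
        "rho vw = vs" "rho vs = ve" and rotS: "\<And>p. p \<in> S \<Longrightarrow> rho p \<in> S"
    and lev: "lev us = b" "lev un = b" "lev vs = b" "lev vn = b" "lev ue = (\<not> b)"
        "lev uw = (\<not> b)" "lev ve = (\<not> b)" "lev vw = (\<not> b)"
    and L': "L' \<subseteq> {(p, q) \<in> L. p \<in> S \<and> q \<in> S} \<union> {(s1, t1), (t1, s1),
        (s2, t2), (t2, s2)}"
  shows "\<exists>E'. reid_step E E' \<and> presents E' psi S Z rho L' lev"
proof -
  note D = presentsD[OF P] and sy = presents_sym_al[OF P]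
  let ?X = "{ue, un, uw, us, ve, vn, vw, vs}"
  let ?Y = "{psi ue, psi un, psi uw, psi us, psi ve, psi vn, psi vw, psi vs}"
  note xneq = distinct8_neq[OF dist]
  have inX: "ue \<in> S \<union> ?X" "un \<in> S \<union> ?X" "uw \<in> S \<union> ?X"
      "us \<in> S \<union> ?X" "ve \<in> S \<union> ?X" "vn \<in> S \<union> ?X" "vw \<in> S \<union> ?X"
      "vs \<in> S \<union> ?X" by simp_all
  have inS: "p \<in> S \<union> ?X" if "p \<in> S" for p using that by simp
  have "inj_on psi (set [ue, un, uw, us, ve, vn, vw, vs])"
    by (rule inj_on_subset[of psi "S \<union> ?X"]) (use D(2) in \<open>simp_all add: bij_betw_def\<close>)
  then have yd: "distinct [psi ue, psi un, psi uw, psi us, psi ve, psi vn, psi vw, psi vs]"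
    using dist distinct_map[of psi "[ue, un, uw, us, ve, vn, vw, vs]"] by (simp only: list.map)
  note yneq = distinct8_neq[OF yd]
  have yo: "psi p \<noteq> psi x" if "p \<in> S" "x \<in> ?X" for p x
    using that fresh D(10)[of p x] by auto
  have al1: "al E (psi s1) = psi vs" "al E (psi vn) = psi un" "al E (psi us) = psi t1"
      "al E (psi s2) = psi uw" "al E (psi ue) = psi vw" "al E (psi ve) = psi t2"
    using D(7) st by simp_all
  have al2: "al E (psi vs) = psi s1" "al E (psi un) = psi vn" "al E (psi t1) = psi us"
      "al E (psi uw) = psi s2" "al E (psi vw) = psi ue" "al E (psi t2) = psi ve"
    using sy st by simp_all
  define F where "F = E\<lparr>dts := psi ` S, al := (al E)(psi s1 := psi t1, psi t1 := psi s1, psi s2 :=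
      psi t2, psi t2 := psi s2)\<rparr>"
  have dF: "dts F = psi ` S" and sgF: "sg F = sg E" and ovF: "ov F = ov E"
    and alF: "al F = (al E)(psi s1 := psi t1, psi t1 := psi s1, psi s2 := psi t2, psi t2 := psi s2)"
    by (simp_all add: F_def)
  have dE: "dts E = psi ` S \<union> ?Y" using D(2) unfolding bij_betw_def by auto
  have yf: "?Y \<inter> dts F = {}" using yo unfolding dF by fastforce
  have ends: "psi s1 \<noteq> psi t1" "psi s1 \<noteq> psi s2" "psi s1 \<noteq> psi t2"
      "psi t1 \<noteq> psi s1" "psi t1 \<noteq> psi s2" "psi t1 \<noteq> psi t2" "psi s2 \<noteq> psi s1"
      "psi s2 \<noteq> psi t1" "psi s2 \<noteq> psi t2" "psi t2 \<noteq> psi s1" "psi t2 \<noteq> psi t1"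
      "psi t2 \<noteq> psi s2"
    using yneq al1 al2 by metis+
  have alFe: "al F (psi s1) = psi t1" "al F (psi t1) = psi s1" "al F (psi s2) = psi t2"
      "al F (psi t2) = psi s2"
    by (simp_all add: alF ends)
  have alFo: "al F x = al E x" if "x \<notin> {psi s1, psi t1, psi s2, psi t2}" for x using that by (simp
      add: alF)
  have ysg: "sg E (psi ue) = psi un" "sg E (psi un) = psi uw" "sg E (psi uw) = psi us"
      "sg E (psi us) = psi ue" "sg E (psi ve) = psi vn" "sg E (psi vn) = psi vw" "sg E (psi vw) = psi vs"
      "sg E (psi vs) = psi ve"
    using D(4)[OF inX(1)] D(4)[OF inX(2)] D(4)[OF inX(3)] D(4)[OF inX(4)] D(4)[OF inX(5)] D(4)[OF inX(6)]
        D(4)[OF inX(7)] D(4)[OF inX(8)] by (simp_all add: rot)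
  have yov: "ov E (psi us) = b" "ov E (psi un) = b" "ov E (psi vs) = b" "ov E (psi vn) = b"
      "ov E (psi ue) = (\<not> b)" "ov E (psi uw) = (\<not> b)" "ov E (psi ve) = (\<not> b)"
      "ov E (psi vw) = (\<not> b)"
    using D(8) inX lev XZ by simp_all
  have ye1: "psi s1 \<noteq> psi ue" "psi s1 \<noteq> psi un" "psi s1 \<noteq> psi uw"
      "psi s1 \<noteq> psi us" "psi s1 \<noteq> psi ve" "psi s1 \<noteq> psi vn" "psi s1 \<noteq> psi vw"
      "psi s1 \<noteq> psi vs" "psi t1 \<noteq> psi ue" "psi t1 \<noteq> psi un" "psi t1 \<noteq> psi uw"
      "psi t1 \<noteq> psi us" "psi t1 \<noteq> psi ve" "psi t1 \<noteq> psi vn" "psi t1 \<noteq> psi vw"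
      "psi t1 \<noteq> psi vs" "psi s2 \<noteq> psi ue" "psi s2 \<noteq> psi un" "psi s2 \<noteq> psi uw"
      "psi s2 \<noteq> psi us" "psi s2 \<noteq> psi ve" "psi s2 \<noteq> psi vn" "psi s2 \<noteq> psi vw"
      "psi s2 \<noteq> psi vs" "psi t2 \<noteq> psi ue" "psi t2 \<noteq> psi un" "psi t2 \<noteq> psi uw"
      "psi t2 \<noteq> psi us" "psi t2 \<noteq> psi ve" "psi t2 \<noteq> psi vn" "psi t2 \<noteq> psi vw"
      "psi t2 \<noteq> psi vs"
    by (rule yo, rule endS, simp)+
  note ye = ye1 ye1[symmetric]
  have rec: "E = finger F (psi s1) (psi s2) (psi ue) (psi un) (psi uw) (psi us) (psi ve) (psi vn) (psi
      vw) (psi vs) b"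
  proof -
    have "al E = al (finger F (psi s1) (psi s2) (psi ue) (psi un) (psi uw) (psi us) (psi ve) (psi vn)
        (psi vw) (psi vs) b)"
    proof
      fix x
      show "al E x = al (finger F (psi s1) (psi s2) (psi ue) (psi un) (psi uw) (psi us) (psi ve) (psi vn)
          (psi vw) (psi vs) b) x"
      proof (cases "x \<in> {psi s1, psi t1, psi s2, psi t2} \<union> ?Y")
        case True
        then show ?thesis unfolding finger_def
          by (elim UnE insertE emptyE) (simp_all add: alFe al1 al2 yneq ye ends)
      next
        case False
        then show ?thesis unfolding finger_def by (simp add: alFo alFe)
      qed
    qed
    moreover have "sg E = sg (finger F (psi s1) (psi s2) (psi ue) (psi un) (psi uw) (psi us) (psi ve)
        (psi vn) (psi vw) (psi vs) b)" unfolding finger_def sgF using ysg by (auto simp: fun_eq_iff)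
    moreover have "ov E = ov (finger F (psi s1) (psi s2) (psi ue) (psi un) (psi uw) (psi us) (psi ve)
        (psi vn) (psi vw) (psi vs) b)" unfolding finger_def ovF using yov by (auto simp: fun_eq_iff)
    moreover have "dts E = dts (finger F (psi s1) (psi s2) (psi ue) (psi un) (psi uw) (psi us) (psi ve)
        (psi vn) (psi vw) (psi vs) b)" unfolding finger_def dF dE by simp
    ultimately show ?thesis by simp
  qed
  have pre: "pre_diagram F"
  proof -
    have orb: "orbit (sg F) (psi p) = orbit (sg E) (psi p)" for p by (simp add: sgF)
    have inE: "psi p \<in> dts E" if "p \<in> S" for p using that by (simp add: dE)
    have perm: "fperm (sg F) (dts F)"
    proof (rule fpermI)
      show "finite (dts F)" using pre_finite[OF D(11)] unfolding dF dE by simp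
      show "sg F x \<in> dts F" if "x \<in> dts F" for x
        using that D(4)[OF inS] rotS unfolding dF sgF by auto
      show "inj_on (sg F) (dts F)"
        using fperm_inj[OF pre_sg[OF D(11)]] unfolding inj_on_def dF sgF dE by blast
    qed
    have "al F x \<in> dts F \<and> al F (al F x) = x \<and> al F x \<noteq> x" if x: "x \<in> dts F" for x
    proof (cases "x \<in> {psi s1, psi t1, psi s2, psi t2}")
      case True
      then show ?thesis by (elim insertE emptyE) (simp_all add: alFe dF endS ends)
    next
      case False
      have xE: "x \<in> dts E" using x unfolding dF dE by blast
      have aa: "al E (al E x) = x" by (rule pre_al_al[OF D(11) xE])
      have xY: "x \<notin> ?Y" using x yf by blast
      have "al E x \<notin> ?Y \<union> {psi s1, psi t1, psi s2, psi t2}"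
      proof
        assume "al E x \<in> ?Y \<union> {psi s1, psi t1, psi s2, psi t2}"
        then have "al E (al E x) \<in> ?Y \<union> {psi s1, psi t1, psi s2, psi t2}"
          by (elim UnE insertE emptyE) (simp_all add: al1 al2)
        then show False using xY False aa by simp
      qed
      moreover have "al E x \<in> dts E" by (rule pre_al_in[OF D(11) xE])
      ultimately have "al E x \<in> dts F"
          "al E x \<notin> {psi s1, psi t1, psi s2, psi t2}" unfolding dF dE by auto
      then show ?thesis using alFo[OF False] alFo[of "al E x"] aa pre_al_neq[OF D(11) xE] by simp
    qed
    moreover have "vdeg F x \<in> {2, 4}" if "x \<in> dts F" for x
    proof -
      have "x \<in> dts E" using that unfolding dF dE by blast
      then show ?thesis using pre_vdeg[OF D(11)] by (auto simp: vdeg_def sgF)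
    qed
    moreover have "dts F \<noteq> {}" using endS unfolding dF by blast
    ultimately show ?thesis using perm unfolding pre_diagram_def by blast
  qed
  have sF: "psi s1 \<in> dts F" "psi s2 \<in> dts F" using endS unfolding dF by blast+
  have ne: "psi s2 \<noteq> psi s1" "psi s2 \<noteq> al F (psi s1)" using ends alFe by simp_all
  have BE: "based_diagram (finger F (psi s1) (psi s2) (psi ue) (psi un) (psi uw) (psi us) (psi ve) (psi
      vn) (psi vw) (psi vs) b)" using D(1) rec by simp
  have B: "psi s2 \<in> orbit (fc F) (psi s1)" "based_diagram F"
    using finger_based_reverse[OF pre sF ne yd yf BE] by auto
  have "R2 F E" by (subst rec) (rule R2_finger[OF sF(1) B(1) ne yd yf])
  then have step: "reid_step E F" unfolding reid_step_def using D(1) B by simp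
  have "presents F psi S Z rho L' lev"
  proof (rule presentsI)
    show "based_diagram F" using B by simp
    show "bij_betw psi S (dts F)" using D(2) unfolding dF bij_betw_def by (auto intro: inj_on_subset)
    show "rho p \<in> S" if "p \<in> S" for p by (rule rotS[OF that])
    show "sg F (psi p) = psi (rho p)" if "p \<in> S" for p using D(4)[OF inS[OF that]] by (simp add: sgF)
    show "ov F (psi p) = lev p" if "p \<in> S"
        "p \<notin> Z" for p using D(8)[OF inS[OF that(1)] that(2)] by (simp add: ovF)
    fix p q assume pq: "(p, q) \<in> L'"
    have "(p, q) \<in> L \<and> p \<in> S \<and> q \<in> S \<or> (p, q) \<in> {(s1, t1), (t1, s1), (s2,
        t2), (t2, s2)}"
      using subsetD[OF L' pq] by (simp only: Un_iff mem_Collect_eq prod.case)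
    then consider "(p, q) \<in> L" "p \<in> S"
        "q \<in> S" | "(p, q) \<in> {(s1, t1), (t1, s1), (s2, t2), (t2, s2)}" by (elim disjE conjE)
    then show "p \<in> S \<and> q \<in> S \<and> al F (psi p) = psi q"
    proof cases
      case 1
      have "psi p \<notin> {psi s1, psi t1, psi s2, psi t2}"
      proof
        assume "psi p \<in> {psi s1, psi t1, psi s2, psi t2}"
        then have "al E (psi p) \<in> ?Y" by (elim insertE emptyE) (simp_all add: al1 al2)
        then have "psi q \<in> ?Y" using D(7)[OF 1(1)] by simp
        then show False using yf 1(3) unfolding dF by blast
      qed
      then show ?thesis using alFo D(7)[OF 1(1)] 1 by simp
    next
      case 2
      then show ?thesis by (elim insertE emptyE) (simp_all add: alFe endS)
    qed
  qed
  then show ?thesis using step by blast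
qed

lemma presents_tri:
  assumes P: "presents E psi S Z rho L lev" and st: "(c1, a1) \<in> L" "(c2, a2) \<in> L" "(c3, a3) \<in> L"
    and rot: "rho a1 = c2" "rho c2 = p1" "rho p1 = q2" "rho q2 = a1" "rho a2 = c3" "rho c3 = p2"
        "rho p2 = q3" "rho q3 = a2" "rho a3 = c1" "rho c1 = p3" "rho p3 = q1" "rho q1 = a3"
    and dist: "distinct [c1, c2, c3, a1, a2, a3, p1, p2, p3, q1, q2, q3]" and TS: "{c1, c2, c3, a1, a2,
        a3, p1, p2, p3, q1, q2, q3} \<subseteq> S" and TZ: "{c1, c2, c3, a1, a2, a3, p1, p2, p3, q1, q2,
        q3} \<inter> Z = {}"
    and over: "(lev c1 \<and> lev a1) \<or> (lev c2 \<and> lev a2) \<or> (lev c3 \<and> lev a3)"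
  shows "\<exists>E'. reid_step E E' \<and> presents E' psi S Z (rho(c1 := a2, a2 := q1, q1 := p2, p2 :=
      c1, c2 := a3, a3 := q2, q2 := p3, p3 := c2, c3 := a1, a1 := q3, q3 := p1, p1 := c3)) L
    (lev(c1 := lev a1, q1 := lev a1, a2 := lev c2, p2 := lev c2, c2 := lev a2, q2 := lev a2, a3 := lev
        c3, p3 := lev c3, c3 := lev a3, q3 := lev a3, a1 := lev c1, p1 := lev c1))"
proof -
  note D = presentsD[OF P]
  have inS: "c1 \<in> S" "c2 \<in> S" "c3 \<in> S" "a1 \<in> S" "a2 \<in> S" "a3 \<in> S" "p1 \<in> S"
      "p2 \<in> S" "p3 \<in> S" "q1 \<in> S" "q2 \<in> S" "q3 \<in> S" using TS by auto
  have nZ: "c1 \<notin> Z" "c2 \<notin> Z" "c3 \<notin> Z" "a1 \<notin> Z" "a2 \<notin> Z" "a3 \<notin> Z"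
      "p1 \<notin> Z" "p2 \<notin> Z" "p3 \<notin> Z" "q1 \<notin> Z" "q2 \<notin> Z"
      "q3 \<notin> Z" using TZ by auto
  let ?E = "tri E (psi c1) (psi c2) (psi c3) (psi a1) (psi a2) (psi a3) (psi p1) (psi p2) (psi p3) (psi
      q1) (psi q2) (psi q3)"
  note xneq = distinct12_neq[OF dist]
  have "inj_on psi (set [c1, c2, c3, a1, a2, a3, p1, p2, p3, q1, q2, q3])"
    by (rule inj_on_subset[of psi S]) (use D(2) TS in \<open>simp_all add: bij_betw_def\<close>)
  then have yd: "distinct [psi c1, psi c2, psi c3, psi a1, psi a2, psi a3, psi p1, psi p2, psi p3, psi
      q1, psi q2, psi q3]"
    using dist distinct_map[of psi "[c1, c2, c3, a1, a2, a3, p1, p2, p3, q1, q2, q3]"] by (simp only: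
        list.map)
  note yneq = distinct12_neq[OF yd]
  have s: "sg E (psi a1) = psi c2" "sg E (psi c2) = psi p1" "sg E (psi p1) = psi q2"
      "sg E (psi q2) = psi a1" "sg E (psi a2) = psi c3" "sg E (psi c3) = psi p2" "sg E (psi p2) = psi q3"
      "sg E (psi q3) = psi a2" "sg E (psi a3) = psi c1" "sg E (psi c1) = psi p3" "sg E (psi p3) = psi q1"
      "sg E (psi q1) = psi a3"
    using D(4)[OF inS(1)] D(4)[OF inS(2)] D(4)[OF inS(3)] D(4)[OF inS(4)] D(4)[OF inS(5)] D(4)[OF inS(6)]
        D(4)[OF inS(7)] D(4)[OF inS(8)] D(4)[OF inS(9)] D(4)[OF inS(10)] D(4)[OF inS(11)] D(4)[OF
        inS(12)] by (simp_all add: rot)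
  have al: "al E (psi c1) = psi a1" "al E (psi c2) = psi a2"
      "al E (psi c3) = psi a3" using D(7) st by simp_all
  have c: "psi c1 \<in> dts E" "psi c2 \<in> dts E" "psi c3 \<in> dts E" using D(9) inS by simp_all
  have ov: "ov E (psi c1) = lev c1" "ov E (psi c2) = lev c2" "ov E (psi c3) = lev c3"
      "ov E (psi a1) = lev a1" "ov E (psi a2) = lev a2" "ov E (psi a3) = lev a3" "ov E (psi p1) = lev p1"
      "ov E (psi p2) = lev p2" "ov E (psi p3) = lev p3" "ov E (psi q1) = lev q1" "ov E (psi q2) = lev q2"
      "ov E (psi q3) = lev q3" using D(8) inS nZ by simp_all
  have R: "R3 E ?E" by (rule R3_tri[OF D(1) c al s yd]) (use over ov in simp)
  have B: "based_diagram ?E" by (rule tri_based[OF D(1) c al s yd])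
  have step: "reid_step E ?E" unfolding reid_step_def using D(1) B R by simp
  have dE: "dts ?E = dts E" and alE: "al ?E = al E" by (simp_all add: tri_def)
  have sgo: "sg ?E (psi p) = sg E (psi p)" "ov ?E (psi p) = ov E (psi p)" if "p \<in> S"
      "p \<notin> {c1, c2, c3, a1, a2, a3, p1, p2, p3, q1, q2, q3}" for p
  proof -
    have "psi p \<noteq> psi x" if "x \<in> {c1, c2, c3, a1, a2, a3, p1, p2, p3, q1, q2, q3}" for x using
        D(10)[OF \<open>p \<in> S\<close>, of x] that \<open>p \<notin> {c1, c2, c3, a1, a2, a3, p1, p2,
        p3, q1, q2, q3}\<close> TS by auto
    then show "sg ?E (psi p) = sg E (psi p)" "ov ?E (psi p) = ov E (psi p)" by (simp_all add: tri_def)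
  qed
  have sgn: "sg ?E (psi c1) = psi a2" "sg ?E (psi a2) = psi q1" "sg ?E (psi q1) = psi p2"
      "sg ?E (psi p2) = psi c1" "sg ?E (psi c2) = psi a3" "sg ?E (psi a3) = psi q2"
      "sg ?E (psi q2) = psi p3" "sg ?E (psi p3) = psi c2" "sg ?E (psi c3) = psi a1"
      "sg ?E (psi a1) = psi q3" "sg ?E (psi q3) = psi p1" "sg ?E (psi p1) = psi c3"
    by (simp_all add: tri_def yneq)
  have ovn: "ov ?E (psi c1) = lev a1" "ov ?E (psi q1) = lev a1" "ov ?E (psi a2) = lev c2"
      "ov ?E (psi p2) = lev c2" "ov ?E (psi c2) = lev a2" "ov ?E (psi q2) = lev a2"
      "ov ?E (psi a3) = lev c3" "ov ?E (psi p3) = lev c3" "ov ?E (psi c3) = lev a3"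
      "ov ?E (psi q3) = lev a3" "ov ?E (psi a1) = lev c1" "ov ?E (psi p1) = lev c1"
    by (simp_all add: tri_def yneq ov)
  have "presents ?E psi S Z (rho(c1 := a2, a2 := q1, q1 := p2, p2 := c1, c2 := a3, a3 := q2, q2 := p3, p3
      := c2, c3 := a1, a1 := q3, q3 := p1, p1 := c3)) L (lev(c1 := lev a1, q1 := lev a1, a2 := lev c2, p2
      := lev c2, c2 := lev a2, q2 := lev a2, a3 := lev c3, p3 := lev c3, c3 := lev a3, q3 := lev a3, a1
      := lev c1, p1 := lev c1))" (is "presents _ _ _ _ ?rho _ ?lev")
  proof (rule presentsI)
    show "based_diagram ?E" by (rule B)
    show "bij_betw psi S (dts ?E)" unfolding dE by (rule D(2))
    show "p \<in> S \<and> q \<in> S \<and> al ?E (psi p) = psi q" if "(p, q) \<in> L" for p q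
      using D(5,6,7) that unfolding alE by blast
    have rn: "?rho c1 = a2" "?rho a2 = q1" "?rho q1 = p2" "?rho p2 = c1" "?rho c2 = a3" "?rho a3 = q2"
        "?rho q2 = p3" "?rho p3 = c2" "?rho c3 = a1" "?rho a1 = q3" "?rho q3 = p1" "?rho p1 = c3"
      by (simp_all add: xneq)
    have ln: "?lev c1 = lev a1" "?lev q1 = lev a1" "?lev a2 = lev c2" "?lev p2 = lev c2"
        "?lev c2 = lev a2" "?lev q2 = lev a2" "?lev a3 = lev c3" "?lev p3 = lev c3" "?lev c3 = lev a3"
        "?lev q3 = lev a3" "?lev a1 = lev c1" "?lev p1 = lev c1"
      by (simp_all add: xneq)
    fix p assume p: "p \<in> S"
    consider "p \<notin> {c1, c2, c3, a1, a2, a3, p1, p2, p3, q1, q2, q3}" | "p = c1" | "p = c2" | "p =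
        c3" | "p = a1" | "p = a2" | "p = a3" | "p = p1" | "p = p2" | "p = p3" | "p = q1" | "p = q2" | "p
        = q3" by blast
    then have "?rho p \<in> S \<and> sg ?E (psi p) = psi (?rho p) \<and> (p \<notin> Z \<longrightarrow>
        ov ?E (psi p) = ?lev p)"
    proof cases
      case 1
      then have "?rho p = rho p" "?lev p = lev p" by simp_all
      then show ?thesis using D(3,4,8)[OF p] sgo[OF p 1] by simp
    qed (simp_all only: rn ln sgn ovn inS, simp_all)
    then show "?rho p \<in> S" "sg ?E (psi p) = psi (?rho p)"
        "p \<notin> Z \<Longrightarrow> ov ?E (psi p) = ?lev p" by blast+
  qed
  then show ?thesis using step by blast
qed

section \<open>Sweeping a strand across the sphere\<close>

text \<open>The strand enters the crossing of a letter \<open>e\<close> at \<open>(2, e)\<close> and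
  leaves it at \<open>(4, e)\<close>. A chain joins \<open>s\<close> to the entry of the first
  letter, each exit to the next entry, and the last exit to \<open>t\<close>.
  \<open>chain_init\<close> omits the last of these edges, which begins at
  \<open>chain_end\<close>.\<close>

fun chain_init :: "nat \<times> nat \<Rightarrow> nat list \<Rightarrow> ((nat \<times> nat) \<times>
    (nat \<times> nat)) set" where
  "chain_init s [] = {}"
| "chain_init s (e # w) = insert (s, (2, e)) (chain_init (4, e) w)"

fun chain_end :: "nat \<times> nat \<Rightarrow> nat list \<Rightarrow> nat \<times> nat" where
  "chain_end s [] = s"
| "chain_end s (e # w) = chain_end (4, e) w"

definition chain :: "nat \<times> nat \<Rightarrow> nat list \<Rightarrow> nat \<times> nat \<Rightarrow>
    ((nat \<times> nat) \<times> (nat \<times> nat)) set" where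
  "chain s w t = insert (chain_end s w, t) (chain_init s w)"

text \<open>The mirror decomposition: the first edge leads to \<open>chain_start\<close>, and
  \<open>chain_tail\<close> is the chain without that edge.\<close>

fun chain_start :: "nat list \<Rightarrow> nat \<times> nat \<Rightarrow> nat \<times> nat" where
  "chain_start [] t = t"
| "chain_start (e # w) t = (2, e)"

fun chain_tail :: "nat list \<Rightarrow> nat \<times> nat \<Rightarrow> ((nat \<times> nat) \<times>
    (nat \<times> nat)) set" where
  "chain_tail [] t = {}"
| "chain_tail (e # w) t = chain (4, e) w t"

lemma chain_simps [simp]: "chain s [] t = {(s, t)}"
    "chain s (e # w) t = insert (s, (2, e)) (chain (4, e) w t)"
  by (auto simp: chain_def)

lemma chain_start_tail: "chain s w t = insert (s, chain_start w t) (chain_tail w t)"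
  by (cases w) auto

lemma chain_init_append: "chain_init s (w1 @ w2) = chain_init s w1 \<union> chain_init (chain_end s w1) w2"
  by (induction w1 arbitrary: s) auto

lemma chain_end_append: "chain_end s (w1 @ w2) = chain_end (chain_end s w1) w2"
  by (induction w1 arbitrary: s) auto

lemma chain_append: "chain s (w1 @ w2) t = chain_init s w1 \<union> chain (chain_end s w1) w2 t"
  by (simp add: chain_def chain_init_append chain_end_append)

text \<open>Isolates the edges around a middle segment of the word, the only place where a move
  acts.\<close>

lemma chain_append3:
  "chain s (w1 @ m @ w2) t =
     chain_init s w1 \<union> chain (chain_end s w1) m (chain_start w2 t) \<union> chain_tail w2 t"
  unfolding chain_append chain_start_tail[of "chain_end (chain_end s w1) m" w2]
    chain_def[of "chain_end s w1" m] by blast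

lemma chain_subset:
  assumes "s \<in> A" "t \<in> A" "\<And>e. e \<in> set w \<Longrightarrow> (2, e) \<in> A \<and> (4, e)
      \<in> A"
  shows "chain s w t \<subseteq> A \<times> A"
  using assms by (induction w arbitrary: s) auto

text \<open>The darts at the crossing of \<open>r\<close> are \<open>r\<close>, \<open>u\<close>,
  \<open>l\<close>, \<open>v\<close> in counterclockwise order. The marked point is to be carried
  from the edge of \<open>r\<close> to that of \<open>l\<close>; the strand through \<open>u\<close>
  and \<open>v\<close> is the one swept round the sphere.\<close>

locale swept_crossing =
  fixes D :: kd and r :: nat
  assumes knot: "knot_diagram D" and r_in: "r \<in> dts D"
begin

definition u where "u = sg D r"
definition l where "l = sg D u"
definition v where "v = sg D l"

lemma planar: "planar_diagram D" by (rule knot_diagram_planar[OF knot])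

lemma pre: "pre_diagram D" using planar unfolding planar_diagram_def by simp

lemma vdeg4: "d \<in> dts D \<Longrightarrow> vdeg D d = 4" using knot unfolding knot_diagram_def by simp

lemmas al_in = pre_al_in[OF pre] and al_al = pre_al_al[OF pre] and al_neq = pre_al_neq[OF pre]
  and sg_in = pre_sg_in[OF pre]

lemma al_eq: "x \<in> dts D \<Longrightarrow> y \<in> dts D \<Longrightarrow> al D x = y
    \<longleftrightarrow> x = al D y"
  using al_al by metis

lemma sg4: "d \<in> dts D \<Longrightarrow> sg D (sg D (sg D (sg D d))) = d"
  "d \<in> dts D \<Longrightarrow> distinct [d, sg D d, sg D (sg D d), sg D (sg D (sg D d))]"
  using pre_deg4[OF pre _ vdeg4] by blast+

lemma c_in: "u \<in> dts D" "l \<in> dts D" "v \<in> dts D"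
  by (simp_all add: u_def l_def v_def sg_in r_in)

lemma sg_c: "sg D r = u" "sg D u = l" "sg D l = v" "sg D v = r"
  using sg4(1)[OF r_in] by (simp_all add: u_def l_def v_def)

lemma c_neq: "r \<noteq> u" "r \<noteq> l" "r \<noteq> v" "u \<noteq> r" "u \<noteq> l" "u \<noteq> v"
    "l \<noteq> r" "l \<noteq> u" "l \<noteq> v" "v \<noteq> r" "v \<noteq> u" "v \<noteq> l"
  using sg4(2)[OF r_in] by (auto simp: u_def l_def v_def)

lemma straight_eq: "d \<in> dts D \<Longrightarrow> straight D d = sg D (sg D d)"
  by (simp add: straight_def vdeg4)

text \<open>Otherwise \<open>u\<close> and \<open>v\<close> would span a closed component missing \<open>r\<close>.\<close>
lemma al_u_neq_v: "al D u \<noteq> v" "al D v \<noteq> u"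
proof -
  let ?h = "straight D \<circ> al D"
  show n: "al D u \<noteq> v"
  proof
    assume a: "al D u = v"
    have hu: "?h u = u" using a c_in sg_c by (simp add: straight_eq)
    have av: "al D v = u" using a al_al[OF c_in(1)] by simp
    have hv: "?h v = v" using av c_in sg_c by (simp add: straight_eq)
    have "orbit ?h u \<subseteq> {u}" "orbit ?h v \<subseteq> {v}" by (rule orbit_closed_subset; use hu
        hv in simp)+
    then show False
      using one_component_dichotomy[OF pre _ c_in(1) r_in] knot a c_neq unfolding knot_diagram_def by auto
  qed
  show "al D v \<noteq> u" using n al_al[OF c_in(3)] by metis
qed

text \<open>With tag 0, the darts \<open>r\<close> and \<open>l\<close> form the vertex of degree 2
  left where the crossing was. Tags 1 to 4 run counterclockwise round a crossing of the
  strand.\<close>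

definition rot :: "nat \<times> nat \<Rightarrow> nat \<times> nat" where
  "rot p = (if fst p = 0 then (0, if snd p = r then l else if snd p = l then r else sg D (snd p))
     else if fst p = 4 then (1, snd p) else (Suc (fst p), snd p))"

text \<open>The strand keeps the height of \<open>u\<close> everywhere: this is what makes it pass
  entirely above or entirely below.\<close>

definition level :: "nat \<times> nat \<Rightarrow> bool" where
  "level p = (if fst p = 0 then ov D (snd p) else if fst p = 2 \<or> fst p = 4 then ov D u else \<not> ov
      D u)"

definition marked :: "(nat \<times> nat) set" where "marked = {(0, r), (0, l)}"

text \<open>The word \<open>w\<close> lists the darts whose edges are crossed, close to the base point of the dart, by the
  strand running from \<open>u\<close> to \<open>v\<close>. Index \<open>(0, d)\<close> is the dart \<open>d\<close> itself; \<open>(1, e), (2, e), (3, e), (4, e)\<close>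
  are the darts of the crossing with the edge of \<open>e\<close>: towards the base of \<open>e\<close>, towards \<open>u\<close>,
  away from the base of \<open>e\<close>, towards \<open>v\<close>. The crossing of \<open>r\<close> itself is dissolved: its darts
  \<open>r\<close> and \<open>l\<close> form the marked point.\<close>
definition index :: "nat list \<Rightarrow> (nat \<times> nat) set" where
  "index w = {0} \<times> (dts D - {u, v}) \<union> {1, 2, 3, 4} \<times> set w"

text \<open>Seen from the base of \<open>d\<close>, this is where the part of the edge beyond the
  strand begins.\<close>

definition front :: "nat list \<Rightarrow> nat \<Rightarrow> nat \<times> nat" where
  "front w d = (if d \<in> set w then (3, d) else (0, d))"

text \<open>For \<open>d = u\<close> and \<open>d = v\<close> this is the end of the strand: what is
  met on leaving the dissolved crossing along \<open>d\<close>. It is the near side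
  \<open>(1, d)\<close> of the crossing on the edge, if there is one close to the base, and
  otherwise the front of the far end.\<close>

definition base_partner :: "nat list \<Rightarrow> nat \<Rightarrow> nat \<times> nat" where
  "base_partner w d = (if d \<in> set w then (1, d) else front w (al D d))"

text \<open>The darts \<open>u\<close> and \<open>v\<close> vanish with the dissolved crossing, so
  they have a front only when crossed.\<close>

definition has_front :: "nat list \<Rightarrow> nat \<Rightarrow> bool" where
  "has_front w d \<longleftrightarrow> d \<in> set w \<or> d \<noteq> u \<and> d \<noteq> v"

text \<open>Three kinds of edges: stubs between a base and the strand, parts of edges beyond the
  strand, and pieces of the strand.\<close>

definition half_links :: "nat list \<Rightarrow> ((nat \<times> nat) \<times> (nat \<times> nat)) set" where
  "half_links w = {((0, d), (1, d)) | d. d \<in> set w \<and> d \<noteq> u \<and> d \<noteq> v} \<union>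
     {(front w d, front w (al D d)) | d. d \<in> dts D \<and> has_front w d \<and> has_front w (al D d)}
         \<union>
     chain (base_partner w u) w (base_partner w v)"

definition links :: "nat list \<Rightarrow> ((nat \<times> nat) \<times> (nat \<times> nat)) set" where
  "links w = half_links w \<union> (half_links w)\<inverse>"

text \<open>Although \<open>r\<close> is no letter, \<open>al D r\<close> may be one: the strand can
  cross the edge of \<open>r\<close> near its far end, and \<open>[al D r]\<close> is the final
  word.\<close>

definition word :: "nat list \<Rightarrow> bool" where
  "word w \<longleftrightarrow> distinct w \<and> set w \<subseteq> dts D - {r}"

definition realizes :: "kd \<Rightarrow> nat list \<Rightarrow> bool" where
  "realizes E w \<longleftrightarrow> (\<exists>psi. presents E psi (index w) marked rot (links w) level)"

lemma links_sym: "(p, q) \<in> links w \<Longrightarrow> (q, p) \<in> links w"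
  unfolding links_def by auto

lemma rot_simps: "rot (1, e) = (2, e)" "rot (2, e) = (3, e)" "rot (3, e) = (4, e)" "rot (4, e) = (1, e)"
  "rot (Suc 0, e) = (2, e)"
  by (simp_all add: rot_def)

lemma level_simps: "level (1, e) = (\<not> ov D u)" "level (2, e) = ov D u"
    "level (3, e) = (\<not> ov D u)" "level (4, e) = ov D u"
  "level (Suc 0, e) = (\<not> ov D u)"
  by (simp_all add: level_def)

lemma rot_index: "p \<in> index w \<Longrightarrow> rot p \<in> index w"
proof -
  assume p: "p \<in> index w"
  show ?thesis
  proof (cases "fst p = 0")
    case True
    then obtain d where d: "p = (0, d)" "d \<in> dts D" "d \<noteq> u"
        "d \<noteq> v" using p unfolding index_def by auto
    have "sg D d \<noteq> u" if "d \<noteq> r" using that d sg_c fperm_inj[OF pre_sg[OF pre], of d r]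
        r_in by auto
    moreover have "sg D d \<noteq> v" if "d \<noteq> l" using that d sg_c fperm_inj[OF pre_sg[OF pre], of
        d l] c_in by auto
    ultimately show ?thesis using d c_neq c_in r_in sg_in by (auto simp: rot_def index_def)
  next
    case False
    then show ?thesis using p by (auto simp: rot_def index_def)
  qed
qed

lemma has_front_index: "has_front w d \<Longrightarrow> d \<in> dts D \<Longrightarrow> front w d \<in>
    index w"
  unfolding has_front_def front_def index_def by auto

lemma has_front_al_u: "has_front w (al D u)" "has_front w (al D v)"
  using al_u_neq_v al_neq[OF c_in(1)] al_neq[OF c_in(3)] unfolding has_front_def by auto

lemma links_index:
  assumes "set w \<subseteq> dts D"
  shows "links w \<subseteq> index w \<times> index w"
proof -
  have "base_partner w u \<in> index w" "base_partner w v \<in> index w"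
    using has_front_index[OF has_front_al_u(1)] has_front_index[OF has_front_al_u(2)] al_in c_in
    unfolding base_partner_def by (auto simp: index_def)
  then have "chain (base_partner w u) w (base_partner w v) \<subseteq> index w \<times> index w"
    by (rule chain_subset) (auto simp: index_def)
  moreover have "{((0, d), (1, d)) | d. d \<in> set w \<and> d \<noteq> u \<and> d \<noteq> v}
      \<subseteq> index w \<times> index w"
    using assms by (auto simp: index_def)
  moreover have "{(front w d, front w (al D d)) | d. d \<in> dts D \<and> has_front w d \<and> has_front
      w (al D d)} \<subseteq> index w \<times> index w"
    using has_front_index al_in by auto
  ultimately show ?thesis unfolding links_def half_links_def by blast
qed

lemma linksI:
  "d \<in> set w \<Longrightarrow> d \<noteq> u \<Longrightarrow> d \<noteq> v \<Longrightarrow> ((0, d),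
      (1, d)) \<in> half_links w"
  "d \<in> dts D \<Longrightarrow> has_front w d \<Longrightarrow> has_front w (al D d) \<Longrightarrow>
      (front w d, front w (al D d)) \<in> half_links w"
  "(p, q) \<in> chain (base_partner w u) w (base_partner w v) \<Longrightarrow> (p, q) \<in> half_links w"
  unfolding half_links_def by blast+

lemma half_links_subset:
  assumes "\<And>d. d \<in> set w \<Longrightarrow> d \<noteq> u \<Longrightarrow> d \<noteq> v
      \<Longrightarrow> ((0, d), (1, d)) \<in> R"
    and "\<And>d. d \<in> dts D \<Longrightarrow> has_front w d \<Longrightarrow> has_front w (al D d)
        \<Longrightarrow> (front w d, front w (al D d)) \<in> R"
    and "chain (base_partner w u) w (base_partner w v) \<subseteq> R"
  shows "half_links w \<subseteq> R"
  using assms unfolding half_links_def by blast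

lemma links_subset:
  assumes "half_links w \<subseteq> R" "\<And>p q. (p, q) \<in> R \<Longrightarrow> (q, p) \<in> R"
  shows "links w \<subseteq> R"
  using assms unfolding links_def by auto

text \<open>The darts of the crossing of \<open>e\<close> are listed cyclically from an arbitrary
  one, with the loop between \<open>x2\<close> and \<open>x3\<close>. So one statement covers the
  four monogons at the two ends of the strand.\<close>

lemma realizes_kink_del:
  assumes E: "realizes E w'" and w: "set w' = insert e (set w)" "e \<notin> set w"
      "set w' \<subseteq> dts D"
    and x: "{x1, x2, x3, x4} = {1, 2, 3, 4} \<times> {e}" "distinct [x1, x2, x3, x4]"
      "rot x1 = x2" "rot x2 = x3" "rot x3 = x4" "rot x4 = x1"
    and st: "(s, x1) \<in> links w'" "(x2, x3) \<in> links w'" "(x4, t) \<in> links w'"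
      "s \<in> index w" "t \<in> index w"
    and sub: "half_links w \<subseteq> half_links w' \<union> {(s, t), (t, s)}"
  shows "\<exists>E'. reid_step E E' \<and> realizes E' w"
proof -
  let ?X = "{x1, x2, x3, x4}"
  have lev: "level x2 = (\<not> level x1)" "level x3 = level x1" "level x4 = (\<not> level x1)"
  proof -
    have "level (rot p) = (\<not> level p)" if "p \<in> {1, 2, 3, 4} \<times> {e}" for p
      using that by (auto simp: rot_simps level_simps)
    then have "\<forall>p\<in>?X. level (rot p) = (\<not> level p)" unfolding x(1) by blast
    then show "level x2 = (\<not> level x1)" "level x3 = level x1"
        "level x4 = (\<not> level x1)" using x(3-5) by auto
  qed
  have idx: "index w' = index w \<union> ?X" unfolding x(1) index_def w(1) by blast
  have disj: "?X \<inter> index w = {}" unfolding x(1) index_def using w(2) by auto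
  have mk: "?X \<inter> marked = {}" unfolding x(1) marked_def by auto
  have L: "links w \<subseteq> {(p, q) \<in> links w'. p \<in> index w \<and> q \<in> index w} \<union>
      {(s, t), (t, s)}"
  proof -
    have "links w \<subseteq> links w' \<union> {(s, t), (t, s)}" using sub unfolding links_def by blast
    moreover have "links w \<subseteq> index w \<times> index w" using w by (intro links_index) auto
    ultimately show ?thesis by blast
  qed
  obtain psi where P: "presents E psi (index w \<union> ?X) marked rot (links w') level"
    using E unfolding realizes_def idx by blast
  show ?thesis
    using presents_kink_del[OF P st x(2) disj mk x(3-6) rot_index refl lev L] unfolding realizes_def by
        blast
qed

text \<open>With first letter \<open>u\<close> the strand starts at \<open>(1, u)\<close> and at
  once enters \<open>(2, u)\<close>. These are neighbouring darts of one crossing joined by an edge: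
  a monogon.\<close>

lemma realizes_drop_u:
  assumes "realizes E (u # w)" "word (u # w)"
  shows "\<exists>E'. reid_step E E' \<and> realizes E' w"
proof -
  let ?y = "al D u"
  have w: "distinct w" "u \<notin> set w"
      "set w \<subseteq> dts D" using assms(2) unfolding word_def by auto
  have y: "?y \<noteq> u" "?y \<noteq> v" "?y \<in> dts D" using al_neq al_u_neq_v al_in c_in by auto
  have fr: "front (u # w) d = front w d" if "d \<noteq> u" for d using that by (simp add: front_def)
  have bv: "base_partner (u # w) v = base_partner w v"
    using c_neq al_u_neq_v by (simp add: base_partner_def fr)
  have bu: "base_partner (u # w) u = (1, u)" "base_partner w u = front w ?y"
    using w by (simp_all add: base_partner_def)
  let ?q = "chain_start w (base_partner w v)"
  have ch: "chain (base_partner (u # w) u) (u # w) (base_partner (u # w) v) =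
      {((1, u), (2, u)), ((4, u), ?q)} \<union> chain_tail w (base_partner w v)"
    unfolding bu bv by (simp add: chain_start_tail[of _ w])
  have ch': "chain (base_partner w u) w (base_partner w v) =
      insert (front w ?y, ?q) (chain_tail w (base_partner w v))"
    unfolding bu by (simp add: chain_start_tail[of _ w])
  have hf: "has_front w d \<longleftrightarrow> d \<noteq> u \<and> has_front (u # w) d" for d using w
      c_neq by (auto simp: has_front_def)
  show ?thesis
  proof (rule realizes_kink_del[OF assms(1), where e = u and s = ?q and t = "front w ?y" and ?x1.0 = "(4,
      u)" and ?x2.0 = "(1, u)" and ?x3.0 = "(2, u)" and ?x4.0 = "(3, u)"])
    show "(?q, (4, u)) \<in> links (u # w)" "((1, u), (2, u)) \<in> links (u # w)"
      using ch unfolding links_def half_links_def by auto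
    have "(front (u # w) u, front (u # w) ?y) \<in> half_links (u # w)"
      by (rule linksI(2)) (use c_in y in \<open>simp_all add: has_front_def\<close>)
    then show "((3, u), front w ?y) \<in> links (u # w)"
      unfolding links_def using fr[OF y(1)] by (simp add: front_def[of _ u])
    have "(front w ?y, ?q) \<in> links w" unfolding links_def half_links_def ch' by blast
    then show "?q \<in> index w" "front w ?y \<in> index w" using links_index[OF w(3)] by auto
    show "half_links w \<subseteq> half_links (u # w) \<union> {(?q, front w ?y), (front w ?y, ?q)}"
    proof (rule half_links_subset)
      show "((0, d), (1, d)) \<in> half_links (u # w) \<union> {(?q, front w ?y), (front w ?y, ?q)}"
        if "d \<in> set w" "d \<noteq> u" "d \<noteq> v" for d using linksI(1)[of d "u # w"] that by simp
      show "(front w d, front w (al D d)) \<in> half_links (u # w) \<union> {(?q, front w ?y), (front w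
          ?y, ?q)}"
        if "d \<in> dts D" "has_front w d" "has_front w (al D d)" for d
        using linksI(2)[of d "u # w"] that hf fr by simp
      show "chain (base_partner w u) w (base_partner w v) \<subseteq> half_links (u # w) \<union> {(?q,
          front w ?y), (front w ?y, ?q)}"
        unfolding ch' using ch unfolding half_links_def by blast
    qed
  qed (use w assms(2) in \<open>auto simp: rot_simps word_def\<close>)
qed

text \<open>As \<open>u\<close> itself is not crossed, the strand starts at the far end of the edge
  of \<open>u\<close>, here at \<open>(3, al D u)\<close>, and at once enters
  \<open>(2, al D u)\<close>. This is again a monogon.\<close>

lemma realizes_drop_al_u:
  assumes "realizes E (al D u # w)" "word (al D u # w)" "u \<notin> set w"
  shows "\<exists>E'. reid_step E E' \<and> realizes E' w"
proof -
  let ?y = "al D u"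
  have w: "distinct w" "?y \<notin> set w"
      "set w \<subseteq> dts D" using assms(2) unfolding word_def by auto
  have y: "?y \<noteq> u" "?y \<noteq> v" "?y \<in> dts D"
      "al D ?y = u" using al_neq al_u_neq_v al_in c_in al_al by auto
  have fr: "front (?y # w) d = front w d" if "d \<noteq> ?y" for d using that by (simp add: front_def)
  have avy: "al D v \<noteq> ?y" using y(4) al_al[OF c_in(3)] c_neq by metis
  have bv: "base_partner (?y # w) v = base_partner w v"
    using y avy by (auto simp: base_partner_def fr)
  have bu: "base_partner (?y # w) u = (3, ?y)" "base_partner w u = (0, ?y)"
    using w assms(3) y(1)[symmetric] by (simp_all add: base_partner_def front_def)
  let ?q = "chain_start w (base_partner w v)"
  have ch: "chain (base_partner (?y # w) u) (?y # w) (base_partner (?y # w) v) =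
      {((3, ?y), (2, ?y)), ((4, ?y), ?q)} \<union> chain_tail w (base_partner w v)"
    unfolding bu bv by (simp add: chain_start_tail[of _ w])
  have ch': "chain (base_partner w u) w (base_partner w v) =
      insert ((0, ?y), ?q) (chain_tail w (base_partner w v))"
    unfolding bu by (simp add: chain_start_tail[of _ w])
  show ?thesis
  proof (rule realizes_kink_del[OF assms(1), where e = ?y and s = "(0, ?y)" and t = ?q and ?x1.0 = "(1,
      ?y)" and ?x2.0 = "(2, ?y)" and ?x3.0 = "(3, ?y)" and ?x4.0 = "(4, ?y)"])
    show "((4, ?y), ?q) \<in> links (?y # w)" "((2, ?y), (3, ?y)) \<in> links (?y # w)"
      using ch unfolding links_def half_links_def by auto
    show "((0, ?y), (1, ?y)) \<in> links (?y # w)"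
      unfolding links_def using linksI(1)[of ?y "?y # w"] y by simp
    have "((0, ?y), ?q) \<in> links w" unfolding links_def half_links_def ch' by blast
    then show "?q \<in> index w" "(0, ?y) \<in> index w" using links_index[OF w(3)] by auto
    show "half_links w \<subseteq> half_links (?y # w) \<union> {((0, ?y), ?q), (?q, (0, ?y))}"
    proof (rule half_links_subset)
      show "((0, d), (1, d)) \<in> half_links (?y # w) \<union> {((0, ?y), ?q), (?q, (0, ?y))}"
        if "d \<in> set w" "d \<noteq> u" "d \<noteq> v" for d using linksI(1)[of d "?y # w"] that by simp
      show "(front w d, front w (al D d)) \<in> half_links (?y # w) \<union> {((0, ?y), ?q), (?q, (0, ?y))}"
        if d: "d \<in> dts D" "has_front w d" "has_front w (al D d)" for d
      proof -
        have "\<not> has_front w u" using assms(3) by (simp add: has_front_def)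
        then have "d \<noteq> ?y" "al D d \<noteq> ?y" using d y(4) al_al[OF d(1)] by metis+
        then show ?thesis using linksI(2)[of d "?y # w"] d fr by (simp add: has_front_def)
      qed
      show "chain (base_partner w u) w (base_partner w v) \<subseteq> half_links (?y # w) \<union> {((0,
          ?y), ?q), (?q, (0, ?y))}"
        unfolding ch' using ch unfolding half_links_def by blast
    qed
  qed (use w assms(2) in \<open>auto simp: rot_simps word_def\<close>)
qed

text \<open>Mirror image at the other end: the monogon lies between \<open>(4, v)\<close> and
  \<open>(1, v)\<close>.\<close>

lemma realizes_drop_v:
  assumes "realizes E (w @ [v])" "word (w @ [v])"
  shows "\<exists>E'. reid_step E E' \<and> realizes E' w"
proof -
  let ?z = "al D v"
  let ?w = "w @ [v]"
  have w: "distinct w" "v \<notin> set w"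
      "set w \<subseteq> dts D" using assms(2) unfolding word_def by auto
  have z: "?z \<noteq> u" "?z \<noteq> v" "?z \<in> dts D" using al_neq al_u_neq_v al_in c_in by auto
  have fr: "front ?w d = front w d" if "d \<noteq> v" for d using that by (simp add: front_def)
  have bu: "base_partner ?w u = base_partner w u"
    using c_neq al_u_neq_v by (simp add: base_partner_def fr)
  have bv: "base_partner ?w v = (1, v)" "base_partner w v = front w ?z"
    using w by (simp_all add: base_partner_def)
  let ?q = "chain_end (base_partner w u) w"
  have ch: "chain (base_partner ?w u) ?w (base_partner ?w v) =
      {((4, v), (1, v)), (?q, (2, v))} \<union> chain_init (base_partner w u) w"
    unfolding bu bv chain_append by (auto simp: chain_def)
  have ch': "chain (base_partner w u) w (base_partner w v) =
      insert (?q, front w ?z) (chain_init (base_partner w u) w)"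
    unfolding bv chain_def ..
  have hf: "has_front w d \<longleftrightarrow> d \<noteq> v \<and> has_front ?w d" for d using w c_neq
      by (auto simp: has_front_def)
  show ?thesis
  proof (rule realizes_kink_del[OF assms(1), where e = v and s = "front w ?z" and t = ?q and ?x1.0 = "(3,
      v)" and ?x2.0 = "(4, v)" and ?x3.0 = "(1, v)" and ?x4.0 = "(2, v)"])
    show "((2, v), ?q) \<in> links ?w" "((4, v), (1, v)) \<in> links ?w"
      using ch unfolding links_def half_links_def by auto
    have "(front ?w v, front ?w ?z) \<in> half_links ?w"
      by (rule linksI(2)) (use c_in z in \<open>simp_all add: has_front_def\<close>)
    then show "(front w ?z, (3, v)) \<in> links ?w"
      unfolding links_def using fr[OF z(2)] by (simp add: front_def[of _ v])
    have "(front w ?z, ?q) \<in> links w" unfolding links_def half_links_def ch' by blast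
    then show "?q \<in> index w" "front w ?z \<in> index w" using links_index[OF w(3)] by auto
    show "half_links w \<subseteq> half_links ?w \<union> {(front w ?z, ?q), (?q, front w ?z)}"
    proof (rule half_links_subset)
      show "((0, d), (1, d)) \<in> half_links ?w \<union> {(front w ?z, ?q), (?q, front w ?z)}"
        if "d \<in> set w" "d \<noteq> u" "d \<noteq> v" for d using linksI(1)[of d ?w] that by simp
      show "(front w d, front w (al D d)) \<in> half_links ?w \<union> {(front w ?z, ?q), (?q, front w ?z)}"
        if "d \<in> dts D" "has_front w d" "has_front w (al D d)" for d
        using linksI(2)[of d ?w] that hf fr by simp
      show "chain (base_partner w u) w (base_partner w v) \<subseteq> half_links ?w \<union> {(front w
          ?z, ?q), (?q, front w ?z)}"
        unfolding ch' using ch unfolding half_links_def by blast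
    qed
  qed (use w assms(2) in \<open>auto simp: rot_simps word_def\<close>)
qed

text \<open>Mirror image at the other end: the monogon lies between \<open>(4, al D v)\<close> and
  \<open>(3, al D v)\<close>.\<close>

lemma realizes_drop_al_v:
  assumes "realizes E (w @ [al D v])" "word (w @ [al D v])" "v \<notin> set w"
  shows "\<exists>E'. reid_step E E' \<and> realizes E' w"
proof -
  let ?z = "al D v"
  let ?w = "w @ [?z]"
  have w: "distinct w" "?z \<notin> set w"
      "set w \<subseteq> dts D" using assms(2) unfolding word_def by auto
  have z: "?z \<noteq> u" "?z \<noteq> v" "?z \<in> dts D"
      "al D ?z = v" using al_neq al_u_neq_v al_in c_in al_al by auto
  have fr: "front ?w d = front w d" if "d \<noteq> ?z" for d using that by (simp add: front_def)
  have auz: "al D u \<noteq> ?z" using z(4) al_al[OF c_in(1)] c_neq by metis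
  have bu: "base_partner ?w u = base_partner w u"
    using z auz by (auto simp: base_partner_def fr)
  have bv: "base_partner ?w v = (3, ?z)" "base_partner w v = (0, ?z)"
    using w assms(3) z(2)[symmetric] by (simp_all add: base_partner_def front_def)
  let ?q = "chain_end (base_partner w u) w"
  have ch: "chain (base_partner ?w u) ?w (base_partner ?w v) =
      {((4, ?z), (3, ?z)), (?q, (2, ?z))} \<union> chain_init (base_partner w u) w"
    unfolding bu bv chain_append by (auto simp: chain_def)
  have ch': "chain (base_partner w u) w (base_partner w v) =
      insert (?q, (0, ?z)) (chain_init (base_partner w u) w)"
    unfolding bv chain_def ..
  show ?thesis
  proof (rule realizes_kink_del[OF assms(1), where e = ?z and s = ?q and t = "(0, ?z)" and ?x1.0 = "(2,
      ?z)" and ?x2.0 = "(3, ?z)" and ?x3.0 = "(4, ?z)" and ?x4.0 = "(1, ?z)"])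
    show "(?q, (2, ?z)) \<in> links ?w" "((3, ?z), (4, ?z)) \<in> links ?w"
      using ch unfolding links_def half_links_def by auto
    show "((1, ?z), (0, ?z)) \<in> links ?w"
      unfolding links_def using linksI(1)[of ?z ?w] z by simp
    have "((0, ?z), ?q) \<in> links w" unfolding links_def half_links_def ch' by blast
    then show "?q \<in> index w" "(0, ?z) \<in> index w" using links_index[OF w(3)] by auto
    show "half_links w \<subseteq> half_links ?w \<union> {(?q, (0, ?z)), ((0, ?z), ?q)}"
    proof (rule half_links_subset)
      show "((0, d), (1, d)) \<in> half_links ?w \<union> {(?q, (0, ?z)), ((0, ?z), ?q)}"
        if "d \<in> set w" "d \<noteq> u" "d \<noteq> v" for d using linksI(1)[of d ?w] that by simp
      show "(front w d, front w (al D d)) \<in> half_links ?w \<union> {(?q, (0, ?z)), ((0, ?z), ?q)}"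
        if d: "d \<in> dts D" "has_front w d" "has_front w (al D d)" for d
      proof -
        have "\<not> has_front w v" using assms(3) by (simp add: has_front_def)
        then have "d \<noteq> ?z" "al D d \<noteq> ?z" using d z(4) al_al[OF d(1)] by metis+
        then show ?thesis using linksI(2)[of d ?w] d fr by (simp add: has_front_def)
      qed
      show "chain (base_partner w u) w (base_partner w v) \<subseteq> half_links ?w \<union> {(?q, (0,
          ?z)), ((0, ?z), ?q)}"
        unfolding ch' using ch unfolding half_links_def by blast
    qed
  qed (use w assms(2) in \<open>auto simp: rot_simps word_def\<close>)
qed

text \<open>The strand crosses one edge near both of its ends in succession. The middle part of the
  edge, between \<open>(3, e)\<close> and \<open>(3, al D e)\<close>, and the piece of the strand
  between \<open>(4, e)\<close> and \<open>(2, al D e)\<close> bound a bigon. Since \<open>e\<close>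
  and \<open>al D e\<close> avoid \<open>u\<close> and \<open>v\<close>, the bases of the edge are
  darts of the diagram that can be rejoined.\<close>

lemma realizes_drop_bigon:
  assumes "realizes E (w1 @ [e, al D e] @ w2)" "word (w1 @ [e, al D e] @ w2)"
    and ne: "e \<noteq> u" "e \<noteq> v" "al D e \<noteq> u" "al D e \<noteq> v"
  shows "\<exists>E'. reid_step E E' \<and> realizes E' (w1 @ w2)"
proof -
  define a where "a = al D e"
  let ?w = "w1 @ [e, a] @ w2" and ?wr = "w1 @ w2"
  have E: "realizes E ?w" and wd: "word ?w" using assms(1,2) unfolding a_def by auto
  have w: "e \<notin> set ?wr" "a \<notin> set ?wr" "e \<noteq> a" "a \<noteq> e"
      "set ?wr \<subseteq> dts D" "e \<in> dts D" "a \<in> dts D"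
    using wd unfolding word_def by auto
  have al: "al D e = a" "al D a = e" using w(6) al_al by (auto simp: a_def)
  have ne': "e \<noteq> u" "e \<noteq> v" "a \<noteq> u" "a \<noteq> v" using ne unfolding a_def by auto
  have fr: "front ?w d = front ?wr d" if "d \<noteq> e"
      "d \<noteq> a" for d using that by (simp add: front_def)
  have hf: "has_front ?w d \<longleftrightarrow> has_front ?wr d" for d using ne' by (auto simp:
      has_front_def)
  have b: "base_partner ?w d = base_partner ?wr d" if "d \<in> {u, v}" for d
  proof -
    have d: "d \<noteq> e" "d \<noteq> a" "d \<in> dts D" using that ne' c_in by auto
    then have "al D d \<noteq> e" "al D d \<noteq> a" using al al_al[OF d(3)] by metis+
    then show ?thesis using d fr[of "al D d"] by (simp add: base_partner_def)
  qed
  let ?s = "base_partner ?wr u" and ?t = "base_partner ?wr v"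
  let ?P = "chain_end ?s w1" and ?N = "chain_start w2 ?t"
  have ch: "chain (base_partner ?w u) ?w (base_partner ?w v) =
      chain_init ?s w1 \<union> {(?P, (2, e)), ((4, e), (2, a)), ((4, a), ?N)} \<union> chain_tail w2 ?t"
    using b[of u] b[of v] chain_append3[of ?s w1 "[e, a]" w2 ?t] by simp
  have ch': "chain ?s ?wr ?t = chain_init ?s w1 \<union> {(?P, ?N)} \<union> chain_tail w2 ?t"
    using chain_append3[of ?s w1 "[]" w2 ?t] by simp
  let ?X = "{(3, e), (4, e), (1, e), (2, e), (1, a), (2, a), (3, a), (4, a)}"
  have idx: "index ?w = index ?wr \<union> ?X" by (auto simp: index_def)
  have disj: "?X \<inter> index ?wr = {}" using w by (auto simp: index_def)
  have mk: "?X \<inter> marked = {}" by (auto simp: marked_def)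
  have dist: "distinct [(3, e), (4, e), (1 :: nat, e), (2, e), (1, a), (2, a), (3, a), (4, a)]" using w
      by simp
  have lk: "(?N, (4, a)) \<in> links ?w" "((2, a), (4, e)) \<in> links ?w" "((2, e), ?P) \<in> links ?w"
    using ch unfolding links_def half_links_def by auto
  have lk2: "((0, e), (1, e)) \<in> links ?w" "((1, a), (0, a)) \<in> links ?w"
    using linksI(1)[of e ?w] linksI(1)[of a ?w] ne' unfolding links_def by auto
  have lk3: "((3, e), (3, a)) \<in> links ?w"
    using linksI(2)[of e ?w] w al unfolding links_def by (simp add: has_front_def front_def)
  have "(?P, ?N) \<in> links ?wr" using ch' unfolding links_def half_links_def by blast
  then have PN: "?N \<in> index ?wr" "?P \<in> index ?wr" using links_index[OF w(5)] by auto
  have ea: "(0, e) \<in> index ?wr" "(0, a) \<in> index ?wr" using w ne' by (auto simp: index_def)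
  have sub: "half_links ?wr \<subseteq> links ?w \<union> {(?N, ?P), (?P, ?N), ((0, e), (0, a)), ((0, a),
      (0, e))}" (is "_ \<subseteq> ?R")
  proof (rule half_links_subset)
    show "((0, d), (1, d)) \<in> ?R" if "d \<in> set ?wr" "d \<noteq> u" "d \<noteq> v" for d
      using linksI(1)[of d ?w] that unfolding links_def by auto
    show "(front ?wr d, front ?wr (al D d)) \<in> ?R"
      if d: "d \<in> dts D" "has_front ?wr d" "has_front ?wr (al D d)" for d
    proof (cases "d = e \<or> d = a")
      case True
      then show ?thesis using al w by (auto simp: front_def)
    next
      case False
      then have "al D d \<noteq> e" "al D d \<noteq> a" using al al_al[OF d(1)] by metis+
      then show ?thesis using linksI(2)[of d ?w] d fr False hf unfolding links_def by simp
    qed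
    show "chain ?s ?wr ?t \<subseteq> ?R"
      unfolding ch' using ch unfolding links_def half_links_def by blast
  qed
  have L: "links ?wr \<subseteq> {(p, q) \<in> links ?w. p \<in> index ?wr \<and> q \<in> index ?wr}
      \<union>
      {(?N, ?P), (?P, ?N), ((0, e), (0, a)), ((0, a), (0, e))}"
  proof -
    have "links ?wr \<subseteq> ?R" by (rule links_subset[OF sub]) (auto intro: links_sym)
    moreover have "links ?wr \<subseteq> index ?wr \<times> index ?wr" by (rule links_index[OF w(5)])
    ultimately show ?thesis by blast
  qed
  obtain psi where P: "presents E psi (index ?wr \<union> ?X) marked rot (links ?w) level"
    using E unfolding realizes_def idx by blast
  have "\<exists>E'. reid_step E E' \<and> presents E' psi (index ?wr) marked rot (links ?wr) level"
    by (rule presents_finger_del[OF P lk(1,2,3) lk2(1) lk3 lk2(2) PN ea dist disj mk _ _ _ _ _ _ _ _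
        rot_index _ _ _ _ _ _ _ _ L, where b = "ov D u"])
      (simp_all add: rot_simps level_simps)
  then show ?thesis unfolding realizes_def by blast
qed

end

lemma chain_end_cases: "chain_end s w = s \<or> (\<exists>x\<in>set w. chain_end s w = (4, x))"
proof (induction w arbitrary: s)
  case (Cons e w)
  then show ?case using Cons[of "(4, e)"] by auto
qed simp

lemma chain_init_cases:
  "(p, q) \<in> chain_init s w \<Longrightarrow> (p = s \<or> fst p = 4) \<and> (\<exists>x\<in>set w. q
      = (2, x))"
proof (induction w arbitrary: s)
  case (Cons e w)
  show ?case using Cons.prems Cons.IH[of "(4, e)"] by auto
qed simp

lemma chain_tail_cases:
  assumes "(p, q) \<in> chain_tail w t"
  shows "fst p = 4 \<and> (q = t \<or> (\<exists>x\<in>set w. q = (2, x)))"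
proof (cases w)
  case (Cons e w')
  then have "(p, q) = (chain_end (4, e) w', t) \<or> (p, q) \<in> chain_init (4, e) w'"
    using assms by (simp add: chain_def)
  then show ?thesis using chain_end_cases[of "(4, e)" w'] chain_init_cases[of p q "(4, e)" w'] Cons by auto
qed (use assms in simp)

text \<open>A renaming that fixes the strand darts of all letters moves only the ends of a chain.
  This transports the strand outside the segment being changed.\<close>

lemma chain_end_map:
  assumes "\<And>x. x \<in> set w \<Longrightarrow> f (2, x) = (2, x) \<and> f (4, x) = (4, x)"
  shows "f (chain_end s w) = chain_end (f s) w"
  using assms
proof (induction w arbitrary: s)
  case (Cons e w)
  then show ?case using Cons.IH[of "(4, e)"] by simp
qed simp

lemma chain_init_map:
  assumes "\<And>x. x \<in> set w \<Longrightarrow> f (2, x) = (2, x) \<and> f (4, x) = (4, x)"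
      "(p, q) \<in> chain_init s w"
  shows "(f p, f q) \<in> chain_init (f s) w"
  using assms
proof (induction w arbitrary: s)
  case (Cons e w)
  show ?case using Cons.prems Cons.IH[of "(4, e)"] by auto
qed simp

lemma chain_start_map:
  assumes "\<And>x. x \<in> set w \<Longrightarrow> f (2, x) = (2, x) \<and> f (4, x) = (4, x)"
  shows "f (chain_start w t) = chain_start w (f t)"
  using assms by (cases w) auto

lemma chain_tail_map:
  assumes "\<And>x. x \<in> set w \<Longrightarrow> f (2, x) = (2, x) \<and> f (4, x) = (4, x)"
    and "(p, q) \<in> chain_tail w t"
  shows "(f p, f q) \<in> chain_tail w (f t)"
proof (cases w)
  case (Cons e w')
  have f': "f (2, x) = (2, x) \<and> f (4, x) = (4, x)" if "x \<in> set w'" for x using assms(1) Cons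
      that by simp
  have "f (4, e) = (4, e)" using assms(1) Cons by simp
  then show ?thesis
    using assms(2) chain_init_map[of w' f p q "(4, e)"] chain_end_map[of w' f "(4, e)"] f' Cons
    by (auto simp: chain_def)
qed (use assms in simp)

text \<open>Serves to show that an edge of the strand after the letter \<open>e\<close>, with far
  end \<open>x\<close>, is not among those cut by the finger move.\<close>

lemma not_passed:
  assumes "x = t \<or> (\<exists>y\<in>A. x = (2 :: nat, y))" "fst t = 0 \<or> fst t = 1 \<or> fst t = 3"
      "t \<noteq> (0, g)" "e \<notin> A"
  shows "x \<noteq> (2, e)" "x \<noteq> (0, g)"
  using assms by auto

lemma mem_swapped_pairs:
  "(x, y) \<in> {(a, b), (b, a), (c, d), (d, c)} \<Longrightarrow> y = b \<or> y = c \<or> x = b \<or> x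
      = c"
  by auto

context swept_crossing
begin

text \<open>The strand passes over or under the vertex \<open>(al D e, g1, g2, g3)\<close>: a Reidemeister II move across
  \<open>g1\<close> prepares the triangle for a Reidemeister III move. The indices of the result differ from those of
  the triangle move by the bijection \<open>pi\<close> below.\<close>
lemma realizes_pass:
  assumes E: "realizes E (w1 @ [e] @ w2)" and wd: "word (w1 @ [e] @ w2)"
    and new: "orbit (sg D) (al D e) \<inter> set (w1 @ [e] @ w2) = {}"
        "orbit (sg D) (al D e) \<inter> {r, u, l, v} = {}"
    and uv: "u \<in> set (w1 @ [e] @ w2) \<or> al D u \<notin> orbit (sg D) (al D e)"
      "v \<in> set (w1 @ [e] @ w2) \<or> al D v \<notin> orbit (sg D) (al D e)"
  shows "\<exists>E'. reid_step\<^sup>*\<^sup>* E E' \<and>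
    realizes E' (w1 @ [sg D (al D e), sg D (sg D (al D e)), sg D (sg D (sg D (al D e)))] @ w2)"
proof -
  define a where "a = al D e"
  define g1 where "g1 = sg D a"
  define g2 where "g2 = sg D g1"
  define g3 where "g3 = sg D g2"
  let ?w = "w1 @ [e] @ w2" and ?wn = "w1 @ [g1, g2, g3] @ w2"
  have w: "e \<notin> set w1" "e \<notin> set w2" "e \<in> dts D" "a \<in> dts D" "set ?w \<subseteq> dts D"
    "\<And>x. x \<in> set w1 \<Longrightarrow> x \<noteq> e"
        "\<And>x. x \<in> set w2 \<Longrightarrow> x \<noteq> e"
    using wd al_in unfolding word_def a_def by auto
  have al: "al D e = a" "al D a = e" "a \<noteq> e" "e \<noteq> a"
    using al_al[OF w(3)] al_neq[OF w(3)] by (simp_all add: a_def eq_commute[of e])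
  have gin: "g1 \<in> dts D" "g2 \<in> dts D"
      "g3 \<in> dts D" using w(4) sg_in by (auto simp: g1_def g2_def g3_def)
  have sg: "sg D a = g1" "sg D g1 = g2" "sg D g2 = g3" "sg D g3 = a"
    using sg4(1)[OF w(4)] by (simp_all add: g1_def g2_def g3_def)
  have orb: "orbit (sg D) a = {a, g1, g2, g3}" by (rule orbit_cycle4) (rule sg)+
  have "distinct [a, g1, g2, g3]" using sg4(2)[OF w(4)] by (simp add: g1_def g2_def g3_def)
  note gneq = distinct4_neq[OF this]
  have gw: "a \<notin> set ?w" "g1 \<notin> set ?w" "g2 \<notin> set ?w" "g3 \<notin> set ?w"
    using new(1) orb unfolding a_def[symmetric] by auto
  have ge: "e \<noteq> a" "e \<noteq> g1" "e \<noteq> g2" "e \<noteq> g3" "a \<noteq> e" "g1 \<noteq> e"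
      "g2 \<noteq> e" "g3 \<noteq> e" using gw by auto
  have gc: "x \<noteq> r" "x \<noteq> u" "x \<noteq> l" "x \<noteq> v" "r \<noteq> x" "u \<noteq> x"
      "l \<noteq> x" "v \<noteq> x" if "x \<in> {a, g1, g2, g3}" for x
    using that new(2) orb unfolding a_def[symmetric] by auto
  have gc': "a \<noteq> r" "a \<noteq> u" "a \<noteq> l" "a \<noteq> v" "g1 \<noteq> r" "g1 \<noteq> u"
      "g1 \<noteq> l" "g1 \<noteq> v"
    "g2 \<noteq> r" "g2 \<noteq> u" "g2 \<noteq> l" "g2 \<noteq> v" "g3 \<noteq> r" "g3 \<noteq> u"
        "g3 \<noteq> l" "g3 \<noteq> v"
    "u \<noteq> a" "u \<noteq> g1" "u \<noteq> g2" "u \<noteq> g3" "v \<noteq> a" "v \<noteq> g1"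
        "v \<noteq> g2" "v \<noteq> g3"
    using gc by auto
  have uv': "al D d \<notin> {a, g1, g2, g3}" if "d \<in> {u, v}" "d \<notin> set ?w" for d
    using uv orb that unfolding a_def[symmetric] by auto
  have ovg: "ov D g1 = (\<not> ov D a)" "ov D g2 = ov D a" "ov D g3 = (\<not> ov D a)"
    using planar w(4) gin vdeg4 sg unfolding planar_diagram_def crossing_data_def by metis+
  have alg: "al D g1 \<noteq> a" "al D g1 \<noteq> e" "al D g1 \<noteq> g1"
    using al al_al[OF gin(1)] ge gneq al_neq[OF gin(1)] by metis+
  let ?s = "base_partner ?w u" and ?t = "base_partner ?w v"
  let ?P = "chain_end ?s w1" and ?N = "chain_start w2 ?t" and ?h = "front ?w (al D g1)"
  \<comment> \<open>The ends of the strand never carry the strand tags 2 and 4, and they differ from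
    \<open>(0, g1)\<close>. This tells the edges cut below from those that stay.\<close>
  have st_tag: "fst x = 0 \<or> fst x = 1 \<or> fst x = 3"
      "x \<noteq> (0, g1)" if x: "x = ?s \<or> x = ?t" for x
  proof -
    have tag: "fst (base_partner ?w d) = 0 \<or> fst (base_partner ?w d) = 1 \<or> fst (base_partner ?w
        d) = 3" for d
      by (simp add: base_partner_def front_def)
    show "fst x = 0 \<or> fst x = 1 \<or> fst x = 3" using x
    proof
      assume "x = ?s" then show ?thesis using tag[of u] by (simp only:)
    next
      assume "x = ?t" then show ?thesis using tag[of v] by (simp only:)
    qed
    have ng: "base_partner ?w d \<noteq> (0, g1)" if "d \<in> {u, v}" for d
      using uv'[of d] that by (auto simp: base_partner_def front_def)
    show "x \<noteq> (0, g1)" using x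
    proof
      assume "x = ?s" then show ?thesis using ng[of u] by (simp only: insert_iff simp_thms)
    next
      assume "x = ?t" then show ?thesis using ng[of v] by (simp only: insert_iff simp_thms)
    qed
  qed
  have P: "?P = ?s \<or> (\<exists>x\<in>set w1. ?P = (4, x))" by (rule chain_end_cases)
  have ch: "chain ?s ?w ?t = chain_init ?s w1 \<union> {(?P, (2, e)), ((4, e), ?N)} \<union> chain_tail
      w2 ?t"
    using chain_append3[of ?s w1 "[e]" w2 ?t] by simp
  have fg: "front ?w x = (0, x)" if "x \<in> {a, g1, g2, g3}" for x using gw that by (auto simp: front_def)
  have hfw: "has_front ?w x" if "x \<in> {a, g1, g2, g3}" for x using gc that by (auto simp: has_front_def)
  have hfe: "has_front ?w e" by (simp add: has_front_def)
  have hfh: "has_front ?w (al D g1)"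
  proof -
    have "d \<in> set ?w" if "d \<in> {u, v}" "al D g1 = d" for d
    proof (rule ccontr)
      assume "d \<notin> set ?w"
      moreover have "al D d = g1" using that(2) al_al[OF gin(1)] by auto
      ultimately show False using uv'[of d] that(1) by simp
    qed
    then show ?thesis by (auto simp: has_front_def)
  qed
  have l1: "(?P, (2, e)) \<in> links ?w" "((4, e), ?N) \<in> links ?w"
    using ch unfolding links_def half_links_def by auto
  have l2: "((0, g1), ?h) \<in> links ?w"
    using linksI(2)[OF gin(1) hfw hfh] fg[of g1] unfolding links_def by simp
  have l3: "((3, e), (0, a)) \<in> links ?w"
    using linksI(2)[of e ?w] w(3) hfe hfw[of a] al fg[of a] unfolding links_def by (simp add: front_def)
  let ?old = "{(?P, (2, e)), ((2, e), ?P), ((0, g1), ?h), (?h, (0, g1))}"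
  let ?news = "{(?P, (2, g1)), ((2, g1), ?P), ((4, g1), (2, g2)), ((2, g2), (4, g1)), ((4, g2), (2, e)),
      ((2, e), (4, g2)),
    ((0, g1), (3, g2)), ((3, g2), (0, g1)), ((1, g2), (1, g1)), ((1, g1), (1, g2)), ((3, g1), ?h), (?h,
        (3, g1))}"
  let ?L = "(links ?w - ?old) \<union> ?news"
  \<comment> \<open>Both crossings of the finger lie on the edge of \<open>g1\<close>. The outer one
    gets the name of the letter \<open>g1\<close>, the one next to the vertex that of
    \<open>g2\<close>.\<close>
  let ?X = "{(1, g2), (2, g2), (3, g2), (4, g2), (3, g1), (4, g1), (1, g1), (2, g1)}"
  have old_sym: "(q, p) \<in> ?old" if "(p, q) \<in> ?old" for p q
    using that by (elim insertE emptyE) simp_all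
  have news_sym: "(q, p) \<in> ?news" if "(p, q) \<in> ?news" for p q
    using that by (elim insertE emptyE) simp_all
  have Lsym: "(q, p) \<in> ?L" if "(p, q) \<in> ?L" for p q
    using that links_sym[of p q ?w] old_sym[of q p] news_sym[of p q] by (metis (no_types) Diff_iff Un_iff)
  have gi: "(0, x) \<in> index ?w" if "x \<in> {a, g1, g2, g3}" for x
    using that gc w gin by (auto simp: index_def)
  have Xdisj: "?X \<inter> index ?w = {}" using gw unfolding index_def by auto
  have distX: "distinct [(1 :: nat, g2), (2, g2), (3, g2), (4, g2), (3, g1), (4, g1), (1, g1), (2, g1)]"
    using gneq by simp
  obtain psi where Ps: "presents E psi (index ?w) marked rot (links ?w) level"
    using E unfolding realizes_def by blast
  note D = presentsD[OF Ps]
  \<comment> \<open>From \<open>?P\<close> the face walk goes to \<open>(3, e)\<close>, follows the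
    edge to \<open>(0, a)\<close> and turns to \<open>(0, g1)\<close>. The finger is pushed through
    this face.\<close>
  have face: "psi (0, g1) \<in> orbit (fc E) (psi ?P)"
  proof -
    have "fc E (psi ?P) = psi (3, e)" using D(7)[OF l1(1)] D(4)[OF D(6)[OF l1(1)]] by (simp add: fc_def
        rot_simps)
    moreover have "fc E (psi (3, e)) = psi (0, g1)"
      using D(7)[OF l3] D(4)[OF D(6)[OF l3]] gc' sg by (simp add: fc_def rot_def)
    ultimately show ?thesis using orbit_stepI[OF orbit_step, of "fc E" "psi ?P"] by simp
  qed
  have ne: "(0, g1) \<noteq> ?P" "(0, g1) \<noteq> (2 :: nat, e)" using P st_tag(2)[of ?P] by auto
  have "\<exists>E1 psi1. reid_step E E1 \<and> presents E1 psi1 (index ?w \<union> ?X) marked rot ?L level"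
  proof (rule presents_finger_add[OF Ps l1(1) l2 distX Xdisj, where b = "ov D u"])
    show "psi (0, g1) \<in> orbit (fc E) (psi ?P)" by (rule face)
    show "(0, g1) \<noteq> ?P" "(0, g1) \<noteq> (2 :: nat, e)" by (rule ne)+
    show "?L \<subseteq> ?L" by (rule subset_refl)
  qed (rule rot_simps level_simps)+
  then obtain E1 psi1 where E1: "reid_step E E1"
      "presents E1 psi1 (index ?w \<union> ?X) marked rot ?L level"
    by blast
  have tri_dist: "distinct [(3 :: nat, e), (0, g1), (4, g2), (0, a), (3, g2), (2, e), (0, g2), (1, g2),
      (4, e), (1, e), (0, g3), (2, g2)]"
    using gneq ge by simp
  have lc: "((3, e), (0, a)) \<in> ?L"
    using l3 ge gneq P st_tag(2) by auto
  \<comment> \<open>The triangle has its corners at the vertex, at the crossing of \<open>e\<close>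
    and at the inner crossing of the finger.\<close>
  have "\<exists>E'. reid_step E1 E' \<and> presents E' psi1 (index ?w \<union> ?X) marked
    (rot((3, e) := (3, g2), (3, g2) := (1, e), (1, e) := (1, g2), (1, g2) := (3, e),
      (0, g1) := (2, e), (2, e) := (0, g3), (0, g3) := (4, e), (4, e) := (0, g1),
      (4, g2) := (0, a), (0, a) := (2, g2), (2, g2) := (0, g2), (0, g2) := (4, g2))) ?L
    (level((3, e) := level (0, a), (1, e) := level (0, a), (3, g2) := level (0, g1), (1, g2) := level (0,
        g1),
      (0, g1) := level (3, g2), (0, g3) := level (3, g2), (2, e) := level (4, g2), (4, e) := level (4, g2),
      (4, g2) := level (2, e), (2, g2) := level (2, e), (0, a) := level (3, e), (0, g2) := level (3, e)))"
  proof (rule presents_tri[OF E1(2) lc _ _ _ _ _ _ _ _ _ _ _ _ _ _ tri_dist])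
    show "{(3, e), (0, g1), (4, g2), (0, a), (3, g2), (2, e), (0, g2), (1, g2), (4, e), (1, e), (0, g3),
        (2, g2)} \<subseteq> index ?w \<union> ?X"
      using gi by (simp add: index_def)
    show "{(3, e), (0, g1), (4, g2), (0, a), (3, g2), (2, e), (0, g2), (1, g2), (4, e), (1, e), (0, g3),
        (2, g2)} \<inter> marked = {}"
      using gc' by (auto simp: marked_def)
    \<comment> \<open>If the strand is over, its side from \<open>(4, g2)\<close> to
      \<open>(2, e)\<close> is over at both ends. If it is under, the other two sides are over at
      the strand, and one of them is also over at the vertex, where \<open>a\<close> and
      \<open>g1\<close> differ.\<close>
    show "level (3, e) \<and> level (0, a) \<or> level (0, g1) \<and> level (3, g2) \<or> level (4, g2)
        \<and> level (2, e)"
      using ovg by (auto simp: level_def)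
  qed (use gc' sg in \<open>simp_all add: rot_simps rot_def[of "(0, _)"]\<close>)
  then obtain E2 where E2: "reid_step E1 E2" "presents E2 psi1 (index ?w \<union> ?X) marked
    (rot((3, e) := (3, g2), (3, g2) := (1, e), (1, e) := (1, g2), (1, g2) := (3, e),
      (0, g1) := (2, e), (2, e) := (0, g3), (0, g3) := (4, e), (4, e) := (0, g1),
      (4, g2) := (0, a), (0, a) := (2, g2), (2, g2) := (0, g2), (0, g2) := (4, g2))) ?L
    (level((3, e) := level (0, a), (1, e) := level (0, a), (3, g2) := level (0, g1), (1, g2) := level (0,
        g1),
      (0, g1) := level (3, g2), (0, g3) := level (3, g2), (2, e) := level (4, g2), (4, e) := level (4, g2),
      (4, g2) := level (2, e), (2, g2) := level (2, e), (0, a) := level (3, e), (0, g2) := level (3, e)))"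
    (is "presents _ _ _ _ ?rho _ ?lev") by blast
  \<comment> \<open>After the move the old vertex is the cycle
    \<open>(1, e), (1, g2), (3, e), (3, g2)\<close>, while its former darts belong to the crossings
    of the strand with \<open>g2\<close> and \<open>g3\<close>. \<open>pi\<close> translates the
    indices of the new word into these names.\<close>
  define pi where "pi = id((0 :: nat, a) := (1 :: nat, e), (0, g1) := (1, g2), (0, g2) := (3, e), (0, g3)
      := (3, g2),
    (1, g2) := (0, a), (3, g2) := (0, g2), (1, g3) := (0, g1), (2, g3) := (2, e), (3, g3) := (0, g3), (4,
        g3) := (4, e))"
  have pi_g: "pi (0, a) = (1, e)" "pi (0, g1) = (1, g2)" "pi (0, g2) = (3, e)" "pi (0, g3) = (3, g2)"
    "pi (1, g1) = (1, g1)" "pi (2, g1) = (2, g1)" "pi (3, g1) = (3, g1)" "pi (4, g1) = (4, g1)"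
    "pi (1, g2) = (0, a)" "pi (2, g2) = (2, g2)" "pi (3, g2) = (0, g2)" "pi (4, g2) = (4, g2)"
    "pi (1, g3) = (0, g1)" "pi (2, g3) = (2, e)" "pi (3, g3) = (0, g3)" "pi (4, g3) = (4, e)"
    "pi (Suc 0, g1) = (1, g1)" "pi (Suc 0, g2) = (0, a)" "pi (Suc 0, g3) = (0, g1)"
    by (simp_all add: pi_def gneq)
  have pi_o: "pi (k, x) = (k, x)" if "x \<notin> {a, g1, g2, g3}" for k x using that by (simp add: pi_def)
  let ?A = "{0 :: nat} \<times> {a, g1, g2, g3} \<union> {1, 2, 3, 4} \<times> {g1, g2, g3}"
  let ?R = "{0 :: nat} \<times> (dts D - {u, v, a, g1, g2, g3}) \<union> {1, 2, 3, 4} \<times> set (w1 @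
      w2)"
  let ?B = "{0 :: nat} \<times> {a, g1, g2, g3} \<union> {1, 2, 3, 4} \<times> {e, g1, g2}"
  have idx: "index ?wn = ?R \<union> ?A" "index ?w \<union> ?X = ?R \<union> ?B"
  proof -
    have d: "dts D - {u, v} = (dts D - {u, v, a, g1, g2, g3}) \<union> {a, g1, g2, g3}"
      using w(4) gin gc' by auto
    have sn: "set ?wn = set (w1 @ w2) \<union> {g1, g2, g3}" and s: "set ?w = set (w1 @ w2) \<union> {e}"
        by auto
    have X: "?X = {1, 2, 3, 4} \<times> {g1, g2}" by auto
    have egg: "{e, g1, g2} = {e} \<union> {g1, g2}" by blast
    show "index ?wn = ?R \<union> ?A" unfolding index_def d sn Sigma_Un_distrib2 by (simp only: Un_ac)
    show "index ?w \<union> ?X = ?R \<union> ?B"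
      unfolding index_def d s X egg Sigma_Un_distrib2 by (simp only: Un_ac)
  qed
  have fixR: "pi p = p" if "p \<in> ?R" for p
  proof -
    have "snd p \<notin> {a, g1, g2, g3}" using that gw by auto
    then show ?thesis using pi_o[of "snd p" "fst p"] by simp
  qed
  have bij: "bij_betw pi (index ?wn) (index ?w \<union> ?X)"
  proof -
    have "bij_betw pi ?R ?R" using bij_betw_cong[of ?R pi id ?R] fixR by simp
    moreover have "bij_betw pi ?A ?B"
    proof (rule bij_betw_byWitness[where f' = "id((1, e) := (0, a), (1, g2) := (0, g1), (3, e) := (0,
        g2), (3, g2) := (0, g3),
        (0, a) := (1, g2), (0, g2) := (3, g2), (0, g1) := (1, g3), (2, e) := (2, g3), (0, g3) := (3, g3),
            (4, e) := (4, g3))"])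
    qed (use gneq ge in \<open>simp_all add: pi_g image_Un insert_Times_insert\<close>)
    moreover have "?R \<inter> ?B = {}" using w gw by auto
    ultimately show ?thesis unfolding idx by (rule bij_betw_combine)
  qed
  have rho_o: "?rho p = rot p" "?lev p = level p" if p: "p \<in> ?R" for p
  proof -
    have "snd p \<notin> {a, g1, g2, g3}" using p gw by auto
    moreover have "fst p = 0 \<or> snd p \<noteq> e" using p w(1,2) by auto
    ultimately have "p \<noteq> (1, e)" "p \<noteq> (2, e)" "p \<noteq> (3, e)" "p \<noteq> (4, e)"
        "p \<noteq> (0, a)" "p \<noteq> (0, g1)" "p \<noteq> (0, g2)"
      "p \<noteq> (0, g3)" "p \<noteq> (1, g2)" "p \<noteq> (2, g2)" "p \<noteq> (3, g2)"
          "p \<noteq> (4, g2)"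
      by auto
    then show "?rho p = rot p" "?lev p = level p" by simp_all
  qed
  have rotR: "rot p \<in> ?R" if p: "p \<in> ?R" for p
  proof -
    have 1: "rot p \<in> ?R \<union> ?A" unfolding idx(1)[symmetric] by (rule rot_index, unfold idx(1),
        rule UnI1[OF p])
    have 2: "snd (rot p) \<notin> {a, g1, g2, g3}"
    proof (cases "fst p = 0")
      case True
      then obtain d where d: "p = (0, d)" "d \<in> dts D" "d \<notin> {a, g1, g2, g3}" using p by auto
      have "sg D d \<notin> {a, g1, g2, g3}"
      proof -
        have "sg D d \<noteq> sg D x" if "x \<in> {a, g1, g2, g3}" for x
        proof -
          have "x \<in> dts D" "d \<noteq> x" using that d(3) w(4) gin by blast+
          then show ?thesis using fperm_inj[OF pre_sg[OF pre] d(2)] by blast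
        qed
        from this[of a] this[of g1] this[of g2] this[of g3] show ?thesis by (simp add: sg)
      qed
      then show ?thesis using d gc' by (auto simp: rot_def)
    next
      case False
      then have "snd (rot p) = snd p" by (simp add: rot_def)
      then show ?thesis using p False gw by auto
    qed
    have "snd q \<in> {a, g1, g2, g3}" if "q \<in> ?A" for q using that by auto
    then have "rot p \<notin> ?A" using 2 by metis
    with 1 show ?thesis by (simp only: Un_iff simp_thms)
  qed
  have A: "?A = {(0, a), (0, g1), (0, g2), (0, g3), (1, g1), (2, g1), (3, g1), (4, g1), (1, g2), (2, g2),
      (3, g2), (4, g2), (1, g3), (2, g3), (3, g3), (4, g3)}" by auto
  have split: "p \<in> ?R \<or> p \<in> ?A" if "p \<in> index ?wn" for p
    using that unfolding idx(1) Un_iff[of _ ?R] .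
  have step: "rot p \<in> index ?wn \<and> pi (rot p) = ?rho (pi p)" if p: "p \<in> index ?wn" for p
  proof
    show "rot p \<in> index ?wn" by (rule rot_index[OF p])
    show "pi (rot p) = ?rho (pi p)" using split[OF p]
    proof
      assume R: "p \<in> ?R"
      show ?thesis unfolding fixR[OF R] fixR[OF rotR[OF R]] rho_o(1)[OF R] by (rule refl)
    next
      assume "p \<in> ?A"
      then show ?thesis unfolding A
        by (elim insertE emptyE; hypsubst) (simp_all add: pi_g rot_simps rot_def[of "(0, _)"] gc' sg gneq
            ge)
    qed
  qed
  have lev: "pi p \<notin> marked \<and> level p = ?lev (pi p)" if p: "p \<in> index ?wn"
      "p \<notin> marked" for p
    using split[OF p(1)]
  proof
    assume R: "p \<in> ?R"
    show ?thesis unfolding fixR[OF R] rho_o(2)[OF R] using p(2) by simp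
  next
    assume "p \<in> ?A"
    then show ?thesis unfolding A
      by (elim insertE emptyE; hypsubst)
        (simp_all add: pi_g level_simps marked_def level_def[of "(0, _)"] gc' gneq ge ovg)
  qed
  \<comment> \<open>Among the darts other than \<open>a\<close> and \<open>e\<close>, only
    \<open>g1\<close> has a new front. For \<open>g2\<close> and \<open>g3\<close> the renaming
    turns \<open>(3, g2)\<close> and \<open>(3, g3)\<close> back into the old darts.\<close>
  have frn: "pi (front ?wn d) = (if d = g1 then (3, g1) else front ?w d)" if "d \<noteq> a"
      "d \<noteq> e" for d
    using that gw gneq by (auto simp: front_def pi_g pi_o)
  have bp: "pi (base_partner ?wn d) = base_partner ?w d" if d: "d \<in> {u, v}" for d
  proof -
    have dg: "d \<notin> {a, g1, g2, g3}" "d \<in> dts D" using d gc' c_in by auto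
    have ade: "al D d \<noteq> e" using al(2) al_al[OF dg(2)] dg(1) al(1) by auto
    consider "d = e" | "d \<noteq> e" "d \<in> set ?w" | "d \<notin> set ?w" by blast
    then show ?thesis
    proof cases
      case 1
      then have "base_partner ?wn d = (0, a)" using w al ge gw gneq by (auto simp: base_partner_def
          front_def)
      then show ?thesis using 1 by (simp add: pi_g base_partner_def)
    next
      case 2
      then show ?thesis using dg by (auto simp: base_partner_def pi_o)
    next
      case 3
      have "al D d \<notin> {a, g1, g2, g3}" by (rule uv'[OF d 3])
      then show ?thesis using 3 dg frn[of "al D d"] ade by (auto simp: base_partner_def)
    qed
  qed
  have old: "(p, q) \<in> ?L" if "(p, q) \<in> links ?w" "(p, q) \<notin> ?old" for p q using that by blast
  have sub: "half_links ?wn \<subseteq> {(p, q). (pi p, pi q) \<in> ?L}"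
  proof (rule half_links_subset)
    fix d assume d: "d \<in> set ?wn" "d \<noteq> u" "d \<noteq> v"
    then consider "d = g1" | "d = g2" | "d = g3" | "d \<in> set w1 \<union> set w2" by auto
    then show "((0, d), (1, d)) \<in> {(p, q). (pi p, pi q) \<in> ?L}"
    proof cases
      case 2
      then show ?thesis using lc by (simp add: pi_g)
    next
      case 4
      then have "d \<in> set ?w" "d \<notin> {a, g1, g2, g3}" using gw by auto
      moreover from this have "((0, d), (1, d)) \<in> links ?w" using linksI(1)[of d ?w] d unfolding
          links_def by blast
      ultimately show ?thesis using P by (auto simp: pi_o front_def)
    qed (simp_all add: pi_g)
  next
    fix d assume d: "d \<in> dts D" "has_front ?wn d" "has_front ?wn (al D d)"
    have hf: "has_front ?w x" if "has_front ?wn x"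
        "x \<noteq> e" for x using that gc' by (auto simp: has_front_def)
    have ftag: "fst (front ?w x) = 0 \<or> fst (front ?w x) = 3"
        "front ?w x = (0, g1) \<longrightarrow> x = g1" for x
      by (auto simp: front_def)
    \<comment> \<open>The edges of \<open>a\<close> and of \<open>g1\<close> are treated by hand;
      every other edge beyond the strand is inherited from the old word.\<close>
    consider "d = a" | "d = e" | "d = g1" | "al D d = g1" | "d \<notin> {a, e, g1}"
        "al D d \<noteq> g1" by blast
    then have "(pi (front ?wn d), pi (front ?wn (al D d))) \<in> ?L"
    proof cases
      case 1
      then have e: "e \<noteq> u" "e \<noteq> v" using d(3) al w ge by (auto simp: has_front_def)
      have "((1, e), (0, e)) \<in> links ?w" using linksI(1)[of e ?w] e unfolding links_def by auto
      then have "((1, e), (0, e)) \<in> ?L" using P ge by (intro old) (auto simp: front_def)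
      moreover have "front ?wn a = (0, a)"
          "front ?wn e = (0, e)" using gw w ge gneq by (auto simp: front_def)
      ultimately show ?thesis using 1 al ge by (simp add: pi_g pi_o)
    next
      case 2
      then have e: "e \<noteq> u" "e \<noteq> v" using d(2) al w ge by (auto simp: has_front_def)
      have "((0, e), (1, e)) \<in> links ?w" using linksI(1)[of e ?w] e unfolding links_def by auto
      then have "((0, e), (1, e)) \<in> ?L" using P ge by (intro old) (auto simp: front_def)
      moreover have "front ?wn a = (0, a)"
          "front ?wn e = (0, e)" using gw w ge gneq by (auto simp: front_def)
      ultimately show ?thesis using 2 al ge by (simp add: pi_g pi_o)
    next
      case 3
      then show ?thesis using frn[of g1] frn[of "al D g1"] alg ge gneq by simp
    next
      case 4
      then have "d = al D g1" using al_al[OF d(1)] by simp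
      then show ?thesis using 4 frn[of g1] frn[of d] alg ge gneq by simp
    next
      case 5
      have ad: "al D d \<noteq> a" "al D d \<noteq> e" using 5 al al_al[OF d(1)] by auto
      have "(front ?w d, front ?w (al D d)) \<in> links ?w"
        using linksI(2)[OF d(1) hf hf] d ad 5 unfolding links_def by simp
      moreover have "(front ?w d, front ?w (al D d)) \<notin> ?old"
        using ftag[of d] ftag[of "al D d"] 5 by auto
      ultimately show ?thesis using frn[of d] frn[of "al D d"] 5 ad old by simp
    qed
    then show "(front ?wn d, front ?wn (al D d)) \<in> {(p, q). (pi p, pi q) \<in> ?L}" by simp
  next
    let ?s' = "base_partner ?wn u" and ?t' = "base_partner ?wn v"
    have s': "pi ?s' = ?s" "pi ?t' = ?t" using bp by auto
    have m1: "pi (2, x) = (2, x) \<and> pi (4, x) = (4, x)" if "x \<in> set w1" for x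
    proof -
      have "x \<notin> {a, g1, g2, g3}" using that gw by auto
      from pi_o[OF this] show ?thesis by (intro conjI)
    qed
    have m2: "pi (2, x) = (2, x) \<and> pi (4, x) = (4, x)" if "x \<in> set w2" for x
    proof -
      have "x \<notin> {a, g1, g2, g3}" using that gw by auto
      from pi_o[OF this] show ?thesis by (intro conjI)
    qed
    have ch': "chain ?s' ?wn ?t' = chain_init ?s' w1 \<union> {(chain_end ?s' w1, (2, g1)), ((4, g1), (2,
        g2)), ((4, g2), (2, g3)),
        ((4, g3), chain_start w2 ?t')} \<union> chain_tail w2 ?t'"
      using chain_append3[of ?s' w1 "[g1, g2, g3]" w2 ?t'] by simp
    have htag: "fst ?h = 0 \<or> fst ?h = 3" by (auto simp: front_def)
    have "(pi p, pi q) \<in> ?L" if pq: "(p, q) \<in> chain ?s' ?wn ?t'" for p q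
    proof -
      consider "(p, q) \<in> chain_init ?s' w1" | "(p, q) \<in> {(chain_end ?s' w1, (2, g1)), ((4, g1),
          (2, g2)), ((4, g2), (2, g3))}"
        | "p = (4, g3)" "q = chain_start w2 ?t'" | "(p, q) \<in> chain_tail w2 ?t'"
        using pq unfolding ch' by blast
      then show ?thesis
      proof cases
        case 1
        then have c: "(pi p, pi q) \<in> chain_init ?s w1" using chain_init_map[of w1 pi, OF m1 1] s' by
            simp
        then have "(pi p, pi q) \<in> links ?w" using ch unfolding links_def half_links_def by blast
        moreover have "(pi p, pi q) \<notin> ?old"
        proof -
          obtain x where x: "x \<in> set w1" "pi q = (2, x)" and pp: "pi p = ?s \<or> fst (pi p) = 4"
            using chain_init_cases[OF c] by blast
          have n: "fst (pi p) \<noteq> 2" "pi p \<noteq> (0, g1)" using pp st_tag[OF disjI1[OF refl]] by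
              (elim disjE; force)+
          have "pi q \<noteq> (2, e)" "pi q \<noteq> (0, g1)" using w(6)[OF x(1)] x(2) by simp_all
          show ?thesis
          proof
            assume "(pi p, pi q) \<in> ?old"
            then have "pi q = (2, e) \<or> pi q = (0, g1) \<or> pi p = (2, e) \<or> pi p = (0, g1)"
              by (rule mem_swapped_pairs)
            then show False using n \<open>pi q \<noteq> (2, e)\<close> \<open>pi q \<noteq> (0,
                g1)\<close> by (elim disjE) simp_all
          qed
        qed
        ultimately show ?thesis by (rule old)
      next
        case 2
        have "pi (chain_end ?s' w1) = chain_end (pi ?s') w1" by (rule chain_end_map) (rule m1)
        then have ce: "pi (chain_end ?s' w1) = ?P" by (simp only: s')
        have "(pi p, pi q) \<in> {(?P, (2, g1)), ((4, g1), (2, g2)), ((4, g2), (2, e))}"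
          using 2 by (elim insertE emptyE Pair_inject) (simp_all only: ce pi_g insert_iff simp_thms)
        then have "(pi p, pi q) \<in> ?news" by (elim insertE emptyE) (simp_all only: insert_iff simp_thms)
        then show ?thesis by (rule UnI2)
      next
        case 3
        have "?N = ?t \<or> (\<exists>x\<in>set w2. ?N = (2, x))" by (cases w2) auto
        note N = not_passed[OF this st_tag[OF disjI2[OF refl]] w(2)]
        have "((4, e), ?N) \<notin> ?old"
        proof
          assume "((4, e), ?N) \<in> ?old"
          then have "?N = (2, e) \<or> ?N = (0, g1) \<or> (4, e) = (2 :: nat, e) \<or> (4, e) = (0 ::
              nat, g1)"
            by (rule mem_swapped_pairs)
          then show False using N by (elim disjE) simp_all
        qed
        then have L: "((4, e), ?N) \<in> ?L" by (rule old[OF l1(2)])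
        have "pi (chain_start w2 ?t') = chain_start w2 (pi ?t')" by (rule chain_start_map) (rule m2)
        then have "pi q = ?N" by (simp only: 3(2) s')
        moreover have "pi p = (4, e)" unfolding 3(1) by (rule pi_g)
        ultimately show ?thesis using L by (simp only:)
      next
        case 4
        then have c: "(pi p, pi q) \<in> chain_tail w2 ?t" using chain_tail_map[of w2 pi, OF m2 4] s' by
            simp
        then have "(pi p, pi q) \<in> links ?w" using ch unfolding links_def half_links_def by blast
        moreover have "(pi p, pi q) \<notin> ?old"
        proof -
          have pp: "fst (pi p) = 4" and qq: "pi q = ?t \<or> (\<exists>x\<in>set w2. pi q = (2, x))"
            using chain_tail_cases[OF c] by auto
          note q = not_passed[OF qq st_tag[OF disjI2[OF refl]] w(2)]
          show ?thesis
          proof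
            assume "(pi p, pi q) \<in> ?old"
            then have "pi q = (2, e) \<or> pi q = (0, g1) \<or> pi p = (2, e) \<or> pi p = (0, g1)"
              by (rule mem_swapped_pairs)
            then show False using q pp by (elim disjE) simp_all
          qed
        qed
        ultimately show ?thesis by (rule old)
      qed
    qed
    then show "chain ?s' ?wn ?t' \<subseteq> {(p, q). (pi p, pi q) \<in> ?L}" by (intro subrelI) (simp
        only: mem_Collect_eq prod.case)
  qed
  have wn: "set ?wn \<subseteq> dts D" using w(5) gin by auto
  have L: "p \<in> index ?wn \<and> q \<in> index ?wn \<and> (pi p, pi q) \<in> ?L" if "(p, q) \<in>
      links ?wn" for p q
  proof -
    have "links ?wn \<subseteq> {(p, q). (pi p, pi q) \<in> ?L}"
    proof (rule links_subset[OF sub])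
      fix p q assume "(p, q) \<in> {(p, q). (pi p, pi q) \<in> ?L}"
      then have "(pi p, pi q) \<in> ?L" by (simp only: mem_Collect_eq prod.case)
      then have "(pi q, pi p) \<in> ?L" by (rule Lsym)
      then show "(q, p) \<in> {(p, q). (pi p, pi q) \<in> ?L}" by (simp only: mem_Collect_eq prod.case)
    qed
    then have "(p, q) \<in> {(p, q). (pi p, pi q) \<in> ?L}" using that by (rule subsetD)
    moreover have "(p, q) \<in> index ?wn \<times> index ?wn" by (rule subsetD[OF links_index[OF wn] that])
    ultimately show ?thesis by (simp only: mem_Sigma_iff mem_Collect_eq prod.case simp_thms)
  qed
  have "presents E2 (psi1 \<circ> pi) (index ?wn) marked rot (links ?wn) level"
    by (rule presents_reindex[OF E2(2) bij step L lev])
  then have "realizes E2 ?wn" unfolding realizes_def by blast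
  moreover have "reid_step\<^sup>*\<^sup>* E E2" using E1(1) E2(1) by (meson
      converse_rtranclp_into_rtranclp r_into_rtranclp)
  ultimately show ?thesis unfolding g3_def g2_def g1_def a_def by blast
qed

end

section \<open>Contracting the swept region\<close>

definition skip :: "('a \<Rightarrow> 'a) \<Rightarrow> 'a \<Rightarrow> 'a \<Rightarrow> 'a" where
  "skip f a x = (if f x = a then f a else f x)"

lemma fperm_skip:
  assumes "fperm f H" "a \<in> H"
  shows "fperm (skip f a) (H - {a})"
proof (rule fpermI)
  show "finite (H - {a})" using fperm_finite[OF assms(1)] by simp
  show "skip f a x \<in> H - {a}" if "x \<in> H - {a}" for x
    using that fperm_in[OF assms(1)] fperm_inj[OF assms(1), of x a] assms(2) by (auto simp: skip_def)
  show "inj_on (skip f a) (H - {a})"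
    using fperm_inj[OF assms(1)] assms(2) by (auto simp: inj_on_def skip_def)
qed

lemma norb_skip:
  assumes f: "fperm f H" and a: "a \<in> H" "f a \<noteq> a"
  shows "norb (skip f a) (H - {a}) = norb f H"
proof -
  obtain z where z: "z \<in> H" "a = f z" using fperm_onto[OF f a(1)] by blast
  have za: "z \<noteq> a" using z a(2) by auto
  have H: "(H - {a}) \<union> {a} = H" using a(1) by blast
  have "norb f ((H - {a}) \<union> {a}) = norb (skip f a) (H - {a})"
  proof (rule norb_subdivide[where ret = "\<lambda>_. z"])
    show "fperm f ((H - {a}) \<union> {a})" unfolding H by (rule f)
    show "fperm (skip f a) (H - {a})" by (rule fperm_skip[OF f a(1)])
    show "f y = skip f a y \<or> f y \<in> {a} \<and> z = y" if "y \<in> H - {a}" for y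
      using that fperm_inj[OF f z(1), of y] z(2) by (auto simp: skip_def)
    show "y \<in> orbit f z" if "y \<in> {a}" for y using that z(2) orbit_step[of f z] by simp
  qed (use z za in \<open>auto simp: skip_def\<close>)
  then show ?thesis unfolding H by simp
qed

lemma norb_remove_fixpoint:
  assumes "fperm f H" "a \<in> H" "f a = a"
  shows "norb f H = Suc (norb f (H - {a}))"
proof -
  have H: "(H - {a}) \<union> {a} = H" using assms(2) by blast
  have "norb f ((H - {a}) \<union> {a}) = norb f (H - {a}) + norb f {a}"
    by (rule norb_Un) (use assms H in auto)
  then show ?thesis unfolding H by (simp add: norb_image)
qed

text \<open>All orbits except possibly \<open>{z}\<close> have at least two points. Used
  contrapositively: if there are more orbits than this, then for every \<open>z\<close> there is a
  fixed point other than \<open>z\<close>.\<close>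

lemma norb_few_fixpoints:
  assumes f: "fperm f H" and few: "\<And>x. x \<in> H \<Longrightarrow> f x = x \<Longrightarrow> x = z"
  shows "2 * norb f H \<le> card H + 1"
proof -
  have big: "2 \<le> card C" if C: "C \<in> orbit f ` H - {{z}}" for C
  proof -
    obtain x where x: "x \<in> H" "C = orbit f x" "C \<noteq> {z}" using C by blast
    have fin: "finite C" using finite_subset[OF orbit_subset[OF f x(1)]] fperm_finite[OF f] x(2) by simp
    have "f x \<noteq> x"
    proof
      assume "f x = x"
      then have "x = z" "orbit f x \<subseteq> {x}" using few[OF x(1)] orbit_closed_subset[of x "{x}" f]
          by auto
      then show False using x orbit_self[of x f] by auto
    qed
    moreover have "{x, f x} \<subseteq> C" using orbit_self[of x f] orbit_step[of f x] x(2) by auto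
    ultimately show ?thesis using card_mono[OF fin, of "{x, f x}"] by (metis card_2_iff)
  qed
  have fin: "finite (orbit f ` H)" using fperm_finite[OF f] by simp
  have rest: "2 * card (orbit f ` H - {{z}}) \<le> (\<Sum>C\<in>orbit f ` H - {{z}}. card C)"
    using sum_bounded_below[of "orbit f ` H - {{z}}" 2 card] big by (simp add: mult.commute)
  have "2 * card (orbit f ` H) \<le> card H + 1"
  proof (cases "{z} \<in> orbit f ` H")
    case True
    then have "(\<Sum>C\<in>orbit f ` H. card C) = 1 + (\<Sum>C\<in>orbit f ` H - {{z}}. card C)"
      using fin by (simp add: sum.remove)
    moreover have "card (orbit f ` H) = Suc (card (orbit f ` H - {{z}}))"
      using True fin by (metis card.remove)
    ultimately show ?thesis using rest sum_orbit_card[OF f] by linarith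
  next
    case False
    then show ?thesis using rest sum_orbit_card[OF f] by simp
  qed
  then show ?thesis by (simp add: norb_image)
qed

text \<open>With \<open>s = t = r\<close> and distinct letters different from \<open>r\<close>, this
  says that \<open>r # w\<close> is a cycle of \<open>f\<close>.\<close>

fun follows :: "('a \<Rightarrow> 'a) \<Rightarrow> 'a \<Rightarrow> 'a list \<Rightarrow> 'a
    \<Rightarrow> bool" where
  "follows f s [] t \<longleftrightarrow> f s = t"
| "follows f s (e # w) t \<longleftrightarrow> f s = e \<and> follows f e w t"

lemma follows_append: "follows f s (w1 @ e # w2) t \<longleftrightarrow> follows f s w1 e \<and> follows
    f e w2 t"
  by (induction w1 arbitrary: s) auto

lemma follows_cong:
  assumes "\<And>x. x \<in> insert s (set w) \<Longrightarrow> f x = g x"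
  shows "follows f s w t = follows g s w t"
  using assms by (induction w arbitrary: s) auto

lemma follows_mem: "follows f s w t \<Longrightarrow> x \<in> insert s (set w) \<Longrightarrow> f x
    \<in> insert t (set w)"
  by (induction w arbitrary: s) auto

text \<open>Only the last step of the walk is turned from \<open>e\<close> to \<open>t\<close>. This
  is what happens to the initial part of the word when its next letter is contracted or
  deleted.\<close>

lemma follows_redirect:
  assumes "follows f s w e" "distinct w" "e \<notin> set w"
      "\<And>x. x \<in> insert s (set w) \<Longrightarrow> g x = (if f x = e then t else f x)"
  shows "follows g s w t"
  using assms
proof (induction w arbitrary: s)
  case (Cons y w)
  have "f s = y" "y \<noteq> e" using Cons.prems by auto
  then have "g s = y" using Cons.prems(4)[of s] by simp
  moreover have "follows g y w t" by (rule Cons.IH) (use Cons.prems in auto)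
  ultimately show ?case by simp
qed simp

definition map_connected :: "(nat \<Rightarrow> nat) \<Rightarrow> (nat \<Rightarrow> nat) \<Rightarrow>
    nat set \<Rightarrow> bool" where
  "map_connected f g N \<longleftrightarrow> (\<forall>S. S \<subseteq> N \<longrightarrow> S \<noteq> {}
      \<longrightarrow> (\<forall>x\<in>S. f x \<in> S \<and> g x \<in> S) \<longrightarrow> S = N)"

lemma map_connectedI:
  assumes "\<And>S. S \<subseteq> N \<Longrightarrow> S \<noteq> {} \<Longrightarrow> (\<And>x. x \<in> S
      \<Longrightarrow> f x \<in> S \<and> g x \<in> S) \<Longrightarrow> S = N"
  shows "map_connected f g N"
  unfolding map_connected_def by (intro allI impI, rule assms) simp_all

lemma map_connectedD:
  assumes "map_connected f g N" "S \<subseteq> N" "S \<noteq> {}"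
      "\<And>x. x \<in> S \<Longrightarrow> f x \<in> S \<and> g x \<in> S"
  shows "S = N"
  using assms(1)[unfolded map_connected_def, rule_format, of S] assms(2-) by simp

context swept_crossing
begin

section \<open>The sweep and its reduction steps\<close>

definition reach :: "nat list \<Rightarrow> bool" where
  "reach w \<longleftrightarrow> (\<exists>E. reid_step\<^sup>*\<^sup>* (insert_bp D r) E \<and> realizes
      E w)"

lemma reach_step:
  assumes "reach w" "\<And>E. realizes E w \<Longrightarrow> \<exists>E'. reid_step E E' \<and> realizes
      E' w'"
  shows "reach w'"
  using assms unfolding reach_def by (meson rtranclp.rtrancl_into_rtrancl)

lemma reach_steps:
  assumes "reach w" "\<And>E. realizes E w \<Longrightarrow> \<exists>E'. reid_step\<^sup>*\<^sup>* E E'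
      \<and> realizes E' w'"
  shows "reach w'"
  using assms unfolding reach_def by (meson rtranclp_trans)

text \<open>\<open>Q\<close> consists of the darts of the vertices not yet passed by the strand; \<open>rho\<close> is the rotation of
  the map in which all other vertices have been contracted to one, with the darts \<open>r # w\<close> around it.\<close>
definition sweep :: "nat list \<Rightarrow> nat set \<Rightarrow> (nat \<Rightarrow> nat) \<Rightarrow>
    nat set \<Rightarrow> bool" where
  "sweep w Q rho N \<longleftrightarrow> word w \<and> (u \<in> set w \<longrightarrow> hd w = u) \<and>
      (v \<in> set w \<longrightarrow> last w = v) \<and>
     N = insert r (set w) \<union> Q \<and> Q \<subseteq> dts D \<and> Q \<inter> insert r (set w) = {}
         \<and> Q \<inter> {r, u, l, v} = {} \<and>
     (\<forall>x\<in>Q. sg D x \<in> Q) \<and> (\<forall>x\<in>Q. rho x = sg D x) \<and>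
         (\<forall>x\<in>N. al D x \<in> N) \<and> fperm rho N \<and>
     follows rho r w r \<and> map_connected rho (al D) N \<and> 4 * norb (rho \<circ> al D) N + card Q =
         2 * card N + 4"

lemma sweepD:
  assumes "sweep w Q rho N"
  shows "word w" "u \<in> set w \<Longrightarrow> hd w = u" "v \<in> set w \<Longrightarrow> last w = v"
      "N = insert r (set w) \<union> Q" "Q \<subseteq> dts D"
    "Q \<inter> insert r (set w) = {}" "Q \<inter> {r, u, l, v} = {}"
        "\<And>x. x \<in> Q \<Longrightarrow> sg D x \<in> Q"
        "\<And>x. x \<in> Q \<Longrightarrow> rho x = sg D x"
    "\<And>x. x \<in> N \<Longrightarrow> al D x \<in> N" "fperm rho N" "follows rho r w r"
        "map_connected rho (al D) N"
    "4 * norb (rho \<circ> al D) N + card Q = 2 * card N + 4"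
    "distinct w" "set w \<subseteq> dts D" "r \<notin> set w" "N \<subseteq> dts D" "finite N" "finite Q"
    "fperm (rho \<circ> al D) N"
proof -
  note a = assms[unfolded sweep_def]
  note * = a[THEN conjunct1]
    a[THEN conjunct2, THEN conjunct1, rule_format]
    a[THEN conjunct2, THEN conjunct2, THEN conjunct1, rule_format]
    a[THEN conjunct2, THEN conjunct2, THEN conjunct2, THEN conjunct1]
    a[THEN conjunct2, THEN conjunct2, THEN conjunct2, THEN conjunct2, THEN conjunct1]
    a[THEN conjunct2, THEN conjunct2, THEN conjunct2, THEN conjunct2, THEN conjunct2, THEN conjunct1]
    a[THEN conjunct2, THEN conjunct2, THEN conjunct2, THEN conjunct2, THEN conjunct2, THEN conjunct2,
        THEN conjunct1]
    a[THEN conjunct2, THEN conjunct2, THEN conjunct2, THEN conjunct2, THEN conjunct2, THEN conjunct2,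
        THEN conjunct2, THEN conjunct1, rule_format]
    a[THEN conjunct2, THEN conjunct2, THEN conjunct2, THEN conjunct2, THEN conjunct2, THEN conjunct2,
        THEN conjunct2, THEN conjunct2, THEN conjunct1, rule_format]
    a[THEN conjunct2, THEN conjunct2, THEN conjunct2, THEN conjunct2, THEN conjunct2, THEN conjunct2,
        THEN conjunct2, THEN conjunct2, THEN conjunct2, THEN conjunct1, rule_format]
    a[THEN conjunct2, THEN conjunct2, THEN conjunct2, THEN conjunct2, THEN conjunct2, THEN conjunct2,
        THEN conjunct2, THEN conjunct2, THEN conjunct2, THEN conjunct2, THEN conjunct1]
    a[THEN conjunct2, THEN conjunct2, THEN conjunct2, THEN conjunct2, THEN conjunct2, THEN conjunct2,
        THEN conjunct2, THEN conjunct2, THEN conjunct2, THEN conjunct2, THEN conjunct2, THEN conjunct1]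
    a[THEN conjunct2, THEN conjunct2, THEN conjunct2, THEN conjunct2, THEN conjunct2, THEN conjunct2,
        THEN conjunct2, THEN conjunct2, THEN conjunct2, THEN conjunct2, THEN conjunct2, THEN conjunct2,
        THEN conjunct1]
    a[THEN conjunct2, THEN conjunct2, THEN conjunct2, THEN conjunct2, THEN conjunct2, THEN conjunct2,
        THEN conjunct2, THEN conjunct2, THEN conjunct2, THEN conjunct2, THEN conjunct2, THEN conjunct2,
        THEN conjunct2]
  show "word w" "u \<in> set w \<Longrightarrow> hd w = u" "v \<in> set w \<Longrightarrow> last w = v"
      "N = insert r (set w) \<union> Q" "Q \<subseteq> dts D"
    "Q \<inter> insert r (set w) = {}" "Q \<inter> {r, u, l, v} = {}"
        "\<And>x. x \<in> Q \<Longrightarrow> sg D x \<in> Q"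
        "\<And>x. x \<in> Q \<Longrightarrow> rho x = sg D x"
    "\<And>x. x \<in> N \<Longrightarrow> al D x \<in> N" "fperm rho N" "follows rho r w r"
        "map_connected rho (al D) N"
    "4 * norb (rho \<circ> al D) N + card Q = 2 * card N + 4"
    by (fact *)+
  show "distinct w" "set w \<subseteq> dts D" "r \<notin> set w" using *(1) unfolding word_def by auto
  then show N: "N \<subseteq> dts D" using *(4,5) r_in by simp
  then show "finite N" using finite_subset[OF _ pre_finite[OF pre]] by blast
  then show "finite Q" using *(4) by simp
  show "fperm (rho \<circ> al D) N"
    by (rule fperm_comp[OF *(11) fperm_involution]) (use \<open>finite N\<close> *(10) N al_al in blast)+
qed

lemma sweepI:
  assumes "word w" "u \<in> set w \<Longrightarrow> hd w = u" "v \<in> set w \<Longrightarrow> last w = v"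
      "N = insert r (set w) \<union> Q" "Q \<subseteq> dts D"
    "Q \<inter> insert r (set w) = {}" "Q \<inter> {r, u, l, v} = {}"
        "\<And>x. x \<in> Q \<Longrightarrow> sg D x \<in> Q"
        "\<And>x. x \<in> Q \<Longrightarrow> rho x = sg D x"
    "\<And>x. x \<in> N \<Longrightarrow> al D x \<in> N" "fperm rho N" "follows rho r w r"
        "map_connected rho (al D) N"
    "4 * norb (rho \<circ> al D) N + card Q = 2 * card N + 4"
  shows "sweep w Q rho N"
  unfolding sweep_def by (intro conjI impI ballI) (rule assms | assumption)+

text \<open>Nothing but the dissolved crossing has been swept: its rotation is \<open>r\<close>
  followed by the word \<open>[u, l, v]\<close>.\<close>

lemma sweep_start: "sweep [u, l, v] (dts D - {r, u, l, v}) (sg D) (dts D)"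
proof (rule sweepI)
  have orb: "sg D x \<in> {r, u, l, v} \<Longrightarrow> x \<in> {r, u, l, v}" if "x \<in> dts D" for x
    using sg4(1)[OF that] sg_c by auto
  then show "\<And>x. x \<in> dts D - {r, u, l, v} \<Longrightarrow> sg D x \<in> dts D - {r, u, l, v}"
      using sg_in by blast
  show "fperm (sg D) (dts D)" by (rule pre_sg[OF pre])
  show "map_connected (sg D) (al D) (dts D)"
    by (rule map_connectedI, rule one_component_connected[OF pre])
      (use planar in \<open>auto simp: planar_diagram_def\<close>)
  \<comment> \<open>Four times Euler's formula with 1 + \<open>card Q\<close> / 4 vertices and
    \<open>card N\<close> / 2 edges: every vertex in \<open>Q\<close> has degree 4, and one vertex
    stands for the swept region.\<close>
  show "4 * norb (sg D \<circ> al D) (dts D) + card (dts D - {r, u, l, v}) = 2 * card (dts D) + 4"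
  proof -
    have "norb (sg D) (dts D) * 4 = card (dts D)"
      by (rule norb_uniform[OF pre_sg[OF pre]]) (use vdeg4 in \<open>simp add: vdeg_def\<close>)
    moreover have "norb (al D) (dts D) * 2 = card (dts D)" by (rule pre_norb_al[OF pre])
    moreover have "norb (sg D) (dts D) + norb (sg D \<circ> al D) (dts D) = norb (al D) (dts D) + 2"
      using planar unfolding planar_diagram_def fc_def by simp
    moreover have "card {r, u, l, v} = 4" using c_neq by simp
    then have "card (dts D - {r, u, l, v}) + 4 = card (dts D)"
      using card_Diff_subset[of "{r, u, l, v}"
          "dts D"] card_mono[OF pre_finite[OF pre], of "{r, u, l, v}"] r_in c_in by simp
    ultimately show ?thesis by linarith
  qed
  show "word [u, l, v]" using c_neq c_in by (simp add: word_def)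
  show "dts D = insert r (set [u, l, v]) \<union> (dts D - {r, u, l, v})" using r_in c_in by auto
  show "follows (sg D) r [u, l, v] r" by (simp add: sg_c)
  show "x \<in> dts D \<Longrightarrow> al D x \<in> dts D" for x by (rule al_in)
qed auto

text \<open>While vertices are left, some letter \<open>e\<close> leads to one of them. Passing the
  strand across that vertex replaces \<open>e\<close> by the other three darts there, which is the
  effect of contracting the edge of \<open>e\<close> on the rotation around the swept
  region.\<close>

lemma sweep_contract:
  assumes sw: "sweep w Q rho N" and Q: "Q \<noteq> {}" and rw: "reach w"
  shows "\<exists>w' Q' rho' N'. sweep w' Q' rho' N' \<and> reach w' \<and> card N' < card N"
proof -
  note S = sweepD[OF sw]
  have "\<exists>e\<in>set w. al D e \<in> Q"
  proof (rule ccontr)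
    assume n: "\<not> ?thesis"
    have alQ: "al D x \<in> Q" if "x \<in> Q" "x \<noteq> al D r" for x
    proof -
      have x: "x \<in> dts D" using that S(5) by blast
      have "al D x \<in> N" using S(4,10) that by blast
      moreover have "al D x \<noteq> r" using that(2) al_eq[OF x r_in] by auto
      moreover have "al D x \<notin> set w" using n al_al[OF x] that(1) by metis
      ultimately show ?thesis using S(4) by blast
    qed
    show False
    proof (cases "al D r \<in> Q")
      case False
      \<comment> \<open>If not even the edge of \<open>r\<close> leads to \<open>Q\<close>, the
        darts \<open>r # w\<close> form a closed set, contrary to connectedness.\<close>
      have "rho x \<in> insert r (set w)" if "x \<in> insert r (set w)" for x using follows_mem[OF S(12)
          that] .
      moreover have "al D x \<in> insert r (set w)" if "x \<in> insert r (set w)" for x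
        using that n False S(4,10) by blast
      ultimately have "insert r (set w) = N" using S(4) by (intro map_connectedD[OF S(13)]) auto
      then show False using S(4,6) Q by blast
    next
      case True
      \<comment> \<open>If the edge of \<open>r\<close> alone leads to \<open>Q\<close>, then
        \<open>al\<close> pairs the darts of \<open>Q\<close> other than \<open>al D r\<close>, so
        that \<open>card Q\<close> is odd; but it is a multiple of 4.\<close>
      have "norb (sg D) Q * 4 = card Q"
      proof (rule norb_uniform)
        show "fperm (sg D) Q" by (rule fperm_Diff(2)[OF pre_sg[OF pre] S(5)]) (rule S(8))
        show "card (orbit (sg D) x) = 4" if "x \<in> Q" for x using vdeg4[of x] S(5) that by (auto simp:
            vdeg_def)
      qed
      moreover have "norb (al D) (Q - {al D r}) * 2 = card (Q - {al D r})"
      proof (rule norb_involution)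
        show "finite (Q - {al D r})" using S(20) by simp
        fix x assume x: "x \<in> Q - {al D r}"
        have xD: "x \<in> dts D" using x S(5) by blast
        have "x \<noteq> r" using x S(7) by auto
        then have "al D x \<noteq> al D r" using al_eq[OF xD al_in[OF r_in]] al_al[OF r_in] by simp
        then show "al D x \<in> Q - {al D r} \<and> al D (al D x) = x \<and> al D x \<noteq> x"
          using alQ x al_al[OF xD] al_neq[OF xD] by blast
      qed
      moreover have "card Q = Suc (card (Q - {al D r}))" using True S(20) by (metis card.remove)
      ultimately show False by presburger
    qed
  qed
  then obtain e where e: "e \<in> set w" "al D e \<in> Q" by blast
  obtain w1 w2 where w12: "w = w1 @ [e] @ w2" using split_list[OF e(1)] by auto
  define a where "a = al D e"
  define g1 where "g1 = sg D a"
  define g2 where "g2 = sg D g1"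
  define g3 where "g3 = sg D g2"
  have aQ: "a \<in> Q" "g1 \<in> Q" "g2 \<in> Q"
      "g3 \<in> Q" using e(2) S(8) by (auto simp: a_def g1_def g2_def g3_def)
  have aD: "a \<in> dts D" using aQ S(5) by blast
  have eD: "e \<in> dts D" using e S(16) by blast
  have al: "al D e = a" "al D a = e" using al_al[OF eD] by (auto simp: a_def)
  have sg: "sg D a = g1" "sg D g1 = g2" "sg D g2 = g3" "sg D g3 = a"
    using sg4(1)[OF aD] by (simp_all add: g1_def g2_def g3_def)
  have orb: "orbit (sg D) a = {a, g1, g2, g3}" by (rule orbit_cycle4) (rule sg)+
  have "distinct [a, g1, g2, g3]" using sg4(2)[OF aD] by (simp add: g1_def g2_def g3_def)
  note gneq = distinct4_neq[OF this]
  have notin: "x \<notin> insert r (set w)" "x \<notin> {r, u, l, v}" if "x \<in> {a, g1, g2, g3}" for x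
    using that aQ S(6,7) by blast+
  \<comment> \<open>Both darts of an edge lie in \<open>N\<close> as soon as one does. So if
    \<open>al D d\<close> is at an unswept vertex, \<open>d\<close> is in \<open>N\<close>, and
    being at the dissolved crossing it must be a letter.\<close>
  have uv: "d \<in> set w \<or> al D d \<notin> orbit (sg D) a" if "d \<in> {u, v}" for d
  proof (rule ccontr)
    assume n: "\<not> ?thesis"
    have dD: "d \<in> dts D" using that c_in by auto
    have "al D d \<in> Q" using n aQ unfolding orb by blast
    then have "al D (al D d) \<in> N" using S(4,10) by blast
    then have "d \<in> N" using al_al[OF dD] by simp
    then show False using S(4,7) n that c_neq by auto
  qed
  let ?w = "w1 @ [g1, g2, g3] @ w2"
  have reach': "reach ?w"
  proof (rule reach_steps[OF rw])
    fix E assume "realizes E w"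
    then have "\<exists>E'. reid_step\<^sup>*\<^sup>* E E' \<and> realizes E' (w1 @ [sg D (al D e), sg D
        (sg D (al D e)), sg D (sg D (sg D (al D e)))] @ w2)"
    proof (intro realizes_pass)
      show "orbit (sg D) (al D e) \<inter> set (w1 @ [e] @ w2) = {}"
          "orbit (sg D) (al D e) \<inter> {r, u, l, v} = {}"
        using notin unfolding a_def[symmetric] orb w12 by blast+
    qed (use S(1) uv w12 a_def in auto)
    then show "\<exists>E'. reid_step\<^sup>*\<^sup>* E E' \<and> realizes E' ?w" unfolding g3_def g2_def
        g1_def a_def .
  qed
  let ?Q = "Q - {a, g1, g2, g3}"
  let ?N = "N - {e, a}"
  \<comment> \<open>The contraction in two stages: the swap merges the two vertices, then both darts
    of the edge are taken out of the merged cycle.\<close>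
  define s1 where "s1 = rho(e := rho a, a := rho e)"
  define rho' where "rho' = skip (skip s1 e) a"
  have eN: "e \<in> N" "a \<in> N" using S(4) e aQ by auto
  have ea: "e \<noteq> a" "e \<notin> Q" using e(1) aQ S(6) by auto
  have rho_g: "rho a = g1" "rho g1 = g2" "rho g2 = g3" "rho g3 = a" using S(9) aQ sg by auto
  have fol: "follows rho r w1 e" "follows rho e w2 r" using S(12) unfolding w12 by (auto simp:
      follows_append)
  have rho_e: "rho e \<in> insert r (set w)" using follows_mem[OF S(12)] e(1) by simp
  have inj: "rho x = rho y \<longleftrightarrow> x = y" if "x \<in> N"
      "y \<in> N" for x y using fperm_inj[OF S(11) that] .
  have rho_e': "rho e \<noteq> a" "rho e \<noteq> e"
  proof -
    show "rho e \<noteq> a" using rho_e aQ S(6) by blast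
    show "rho e \<noteq> e"
    proof (cases w2)
      case Nil
      then show ?thesis using fol(2) e(1) S(17) by auto
    next
      case (Cons y ys)
      then show ?thesis using fol(2) S(15) unfolding w12 by auto
    qed
  qed
  have rho': "rho' x = (if rho x = e then g1 else if rho x = a then rho e else rho x)" if x: "x \<in> ?N"
      for x
    using x rho_g rho_e' ea gneq unfolding rho'_def skip_def s1_def by auto
  have perm': "fperm rho' ?N"
  proof -
    have "fperm s1 N" unfolding s1_def by (rule fperm_swap[OF S(11) eN])
    then have "fperm (skip s1 e) (N - {e})" by (rule fperm_skip[OF _ eN(1)])
    then have "fperm rho' (N - {e} - {a})" unfolding rho'_def by (rule fperm_skip) (use eN ea in auto)
    moreover have "N - {e} - {a} = ?N" by blast
    ultimately show ?thesis by simp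
  qed
  have fol': "follows rho' r ?w r"
  proof -
    have w1n: "x \<in> ?N" "rho x \<noteq> a" if "x \<in> insert r (set w1)" for x
    proof -
      have xN: "x \<in> N" using that S(4) w12 by auto
      show "x \<in> ?N" using that xN S(15,17) w12 aQ S(6) by auto
      show "rho x \<noteq> a" using inj[OF xN, of g3] rho_g that aQ S(4,6) w12 by auto
    qed
    have "follows rho' r w1 g1"
      by (rule follows_redirect[OF fol(1)]) (use S(15) w12 rho'[OF w1n(1)] w1n(2) in auto)
    moreover have gN: "g1 \<in> ?N" "g2 \<in> ?N" "g3 \<in> ?N" using aQ S(4) ea gneq by auto
    have "rho' g1 = g2" "rho' g2 = g3" "rho' g3 = rho e"
      using rho'[OF gN(1)] rho'[OF gN(2)] rho'[OF gN(3)] rho_g gneq ea aQ by auto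
    moreover have "follows rho' (rho e) (tl w2) r \<and> (w2 = [] \<longrightarrow> rho e = r)" if "w2
        \<noteq> []"
    proof -
      have "rho' x = rho x" if x: "x \<in> set w2" for x
      proof -
        have xN: "x \<in> N" using x S(4) w12 by auto
        have "x \<in> ?N" using x xN S(15) w12 aQ S(6) by auto
        moreover have "rho x \<noteq> a" using inj[OF xN, of g3] rho_g x aQ S(4,6) w12 by auto
        moreover have "rho x \<noteq> e"
        proof
          assume "rho x = e"
          moreover have "rho x \<in> insert r (set w2)" using follows_mem[OF fol(2)] x by simp
          ultimately show False using S(15,17) e(1) unfolding w12 by auto
        qed
        ultimately show ?thesis using rho' by simp
      qed
      then show ?thesis using fol(2) that follows_cong[of "rho e" "tl w2" rho' rho r] by (cases w2) auto
    qed
    ultimately show ?thesis using fol(2) by (cases w2) (auto simp: follows_append)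
  qed
  \<comment> \<open>Contraction shortens faces and destroys none: when a dart of the edge is taken
    out, it is not a face by itself.\<close>
  have fc': "norb (rho' \<circ> al D) ?N = norb (rho \<circ> al D) N"
  proof -
    let ?f = "rho \<circ> al D"
    have fe: "?f e = g1" "?f a = rho e" using al rho_g by auto
    have p1: "fperm (skip ?f e) (N - {e})" by (rule fperm_skip[OF S(21) eN(1)])
    have "norb (skip ?f e) (N - {e}) = norb ?f N" by (rule norb_skip[OF S(21) eN(1)]) (use fe aQ ea in auto)
    moreover have "norb (skip (skip ?f e) a) (N - {e} - {a}) = norb (skip ?f e) (N - {e})"
      by (rule norb_skip[OF p1]) (use eN ea fe rho_e' in \<open>auto simp: skip_def\<close>)
    moreover have "norb (rho' \<circ> al D) ?N = norb (skip (skip ?f e) a) ?N"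
    proof (rule norb_cong)
      have alN: "al D x \<in> ?N" if x: "x \<in> ?N" for x
      proof -
        have xD: "x \<in> dts D" using x S(18) by blast
        then have "al D x \<noteq> e" "al D x \<noteq> a" using x al al_al[OF xD] by auto
        then show ?thesis using S(10) x by blast
      qed
      show "(rho' \<circ> al D) x \<in> ?N" if "x \<in> ?N" for x using fperm_in[OF perm' alN[OF that]]
          by simp
      show "(rho' \<circ> al D) x = skip (skip ?f e) a x" if x: "x \<in> ?N" for x
        using rho'[OF alN[OF x]] fe rho_e' ea aQ gneq by (auto simp: skip_def)
    qed
    moreover have "N - {e} - {a} = ?N" by blast
    ultimately show ?thesis by simp
  qed
  \<comment> \<open>A closed set of the contracted map that contains a dart whose
    \<open>rho\<close>-successor is \<open>e\<close> or \<open>a\<close> stays closed when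
    \<open>e\<close> and \<open>a\<close> are added to it. A set without such a dart was closed
    before.\<close>
  have conn: "T = ?N" if T: "T \<subseteq> ?N"
      "T \<noteq> {}" and cl: "\<And>x. x \<in> T \<Longrightarrow> rho' x \<in> T \<and> al D x \<in> T"
      for T
  proof -
    have orbT: "orbit rho' x \<subseteq> T" if "x \<in> T" for x by (rule orbit_closed_subset[OF that])
        (use cl in blast)
    have gN: "g1 \<in> ?N" "g2 \<in> ?N" "g3 \<in> ?N" using aQ S(4) ea gneq by auto
    have r': "rho' g1 = g2" "rho' g2 = g3" "rho' g3 = rho e"
      using rho'[OF gN(1)] rho'[OF gN(2)] rho'[OF gN(3)] rho_g gneq ea aQ by auto
    have "g3 \<in> orbit rho' g1" using orbit_stepI[OF orbit_step, of rho' g1] r' by simp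
    then have g31: "g1 \<in> orbit rho' g3" by (rule orbit_sym[OF perm' gN(1)])
    show ?thesis
    proof (cases "\<exists>x\<in>T. rho x = e \<or> rho x = a")
      case True
      then obtain x where x: "x \<in> T" "rho x = e \<or> rho x = a" by blast
      have xN: "x \<in> N" using x T by blast
      have "g1 \<in> T"
      proof (cases "rho x = e")
        case True
        then show ?thesis using cl[OF x(1)] rho'[OF subsetD[OF T(1) x(1)]] by simp
      next
        case False
        then have "x = g3" using x(2) inj[OF xN, of g3] rho_g gN by auto
        then show ?thesis using g31 orbT[OF x(1)] by blast
      qed
      then have "g1 \<in> T" "rho e \<in> T" using cl r' by metis+
      have "T \<union> {e, a} = N"
      proof (rule map_connectedD[OF S(13)])
        show "T \<union> {e, a} \<subseteq> N" using T eN by blast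
        fix y assume y: "y \<in> T \<union> {e, a}"
        show "rho y \<in> T \<union> {e, a} \<and> al D y \<in> T \<union> {e, a}"
        proof (cases "y \<in> T")
          case True
          then have "rho' y \<in> T" "al D y \<in> T" "y \<in> ?N" using cl T by auto
          then show ?thesis using rho'[of y] by (auto split: if_splits)
        next
          case False
          then show ?thesis using y \<open>g1 \<in> T\<close> \<open>rho e \<in> T\<close> rho_g al by auto
        qed
      qed simp
      then show ?thesis using T by blast
    next
      case False
      have "T = N"
      proof (rule map_connectedD[OF S(13)])
        show "T \<subseteq> N" "T \<noteq> {}" using T by auto
        show "rho y \<in> T \<and> al D y \<in> T" if "y \<in> T" for y
          using cl[OF that] rho'[OF subsetD[OF T(1) that]] False that by auto
      qed
      then show ?thesis using T eN by blast
    qed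
  qed
  have cN: "card N = card ?N + 2"
  proof -
    have "card ?N = card N - card {e, a}" by (rule card_Diff_subset) (use eN in auto)
    moreover have "card {e, a} \<le> card N" by (rule card_mono[OF S(19)]) (use eN in auto)
    ultimately show ?thesis using ea by simp
  qed
  have cQ: "card Q = card ?Q + 4"
  proof -
    have "card ?Q = card Q - card {a, g1, g2, g3}" by (rule card_Diff_subset) (use aQ in auto)
    moreover have "card {a, g1, g2, g3} \<le> card Q" by (rule card_mono[OF S(20)]) (use aQ in auto)
    ultimately show ?thesis using gneq by simp
  qed
  have "sweep ?w ?Q rho' ?N"
  proof (rule sweepI)
    have g_w: "g1 \<notin> set w" "g2 \<notin> set w" "g3 \<notin> set w" "g1 \<noteq> r" "g2 \<noteq> r"
        "g3 \<noteq> r"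
      "g1 \<noteq> u" "g2 \<noteq> u" "g3 \<noteq> u" "g1 \<noteq> v" "g2 \<noteq> v"
          "g3 \<noteq> v" using notin by auto
    have gD: "g1 \<in> dts D" "g2 \<in> dts D" "g3 \<in> dts D" using aQ S(5) by auto
    show "word ?w" using S(15,16,17) g_w gneq gD unfolding word_def w12 by auto
    \<comment> \<open>No inserted letter is \<open>u\<close>; so if \<open>u\<close> is a letter
      now, it was one before and is not the letter replaced, and the head is the old one.\<close>
    show "hd ?w = u" if "u \<in> set ?w"
    proof -
      have "u \<in> set w1 \<union> set w2" using that g_w by auto
      then have "hd w = u" "u \<noteq> e" using S(2,15) unfolding w12 by auto
      then show ?thesis unfolding w12 by (cases w1) auto
    qed
    show "last ?w = v" if "v \<in> set ?w"
    proof -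
      have "v \<in> set w1 \<union> set w2" using that g_w by auto
      then have "last w = v" "v \<noteq> e" using S(3,15) unfolding w12 by auto
      then show ?thesis unfolding w12 by (cases w2 rule: rev_cases) (auto simp: last_append)
    qed
    show "?N = insert r (set ?w) \<union> ?Q"
    proof -
      have "e \<notin> insert r (set w1 \<union> set w2)" using S(15,17) w12 by auto
      then show ?thesis unfolding S(4) w12 using aQ ea gneq notin(1)[of a] w12 by auto
    qed
    show "?Q \<subseteq> dts D" using S(5) by blast
    show "?Q \<inter> insert r (set ?w) = {}" using S(6) w12 by auto
    show "?Q \<inter> {r, u, l, v} = {}" using S(7) by blast
    show "sg D x \<in> ?Q" if x: "x \<in> ?Q" for x
    proof -
      have xD: "x \<in> dts D" using x S(5) by blast
      have "sg D x \<noteq> sg D y" if "y \<in> {a, g1, g2, g3}" for y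
        using fperm_inj[OF pre_sg[OF pre] xD, of y] x that aD gD by blast
      from this[of a] this[of g1] this[of g2] this[of g3] show ?thesis using S(8)[of x] x by (simp add: sg)
    qed
    show "rho' x = sg D x" if x: "x \<in> ?Q" for x
    proof -
      have xN: "x \<in> ?N" "x \<in> N" "x \<in> Q" using x S(4) ea by auto
      have "rho x \<in> Q" using S(8,9) xN(3) by simp
      then have "rho x \<noteq> e" using ea by blast
      moreover have "rho x \<noteq> a" using inj[OF xN(2), of g3] rho_g x aQ S(4) by auto
      ultimately show ?thesis using rho'[OF xN(1)] S(9)[OF xN(3)] by simp
    qed
    show "al D x \<in> ?N" if x: "x \<in> ?N" for x
    proof -
      have xD: "x \<in> dts D" using x S(18) by blast
      then have "al D x \<noteq> e" "al D x \<noteq> a" using x al al_al[OF xD] by auto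
      then show ?thesis using S(10) x by blast
    qed
    \<comment> \<open>\<open>card Q\<close> drops by 4 and \<open>card N\<close> by 2 with the same
      number of faces, which is balanced.\<close>
    show "4 * norb (rho' \<circ> al D) ?N + card ?Q = 2 * card ?N + 4"
      using S(14) cN cQ unfolding fc' by linarith
  qed (rule perm' fol' map_connectedI[OF conn] | assumption)+
  then show ?thesis using reach' cN by (metis less_add_same_cancel1 zero_less_numeral)
qed

text \<open>The conditions on \<open>hd\<close> and \<open>last\<close> decide which move applies.
  If \<open>e\<close> is \<open>u\<close>, it is the first letter and two monogons are removed; if
  \<open>al D e\<close> is \<open>v\<close>, it is the last letter and the same happens at the other
  end. \<open>u\<close> cannot come second in the pair nor \<open>v\<close> first, so in all other
  cases there is a bigon.\<close>

lemma reach_drop: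
  assumes sw: "sweep (w1 @ [e, al D e] @ w2) Q rho N" and rw: "reach (w1 @ [e, al D e] @ w2)"
  shows "reach (w1 @ w2)"
proof -
  let ?w = "w1 @ [e, al D e] @ w2"
  note S = sweepD[OF sw]
  have eD: "e \<in> dts D" using S(16) by simp
  consider "e = u" | "al D e = v" | "e \<noteq> u" "al D e \<noteq> v" by blast
  then show ?thesis
  proof cases
    case 1
    then have "w1 = []" using S(2,15) by (cases w1) auto
    then have w: "?w = u # al D u # w2" using 1 by simp
    have "reach (al D u # w2)" by (rule reach_step[OF rw]) (use realizes_drop_u w S(1) in simp)
    then have "reach w2"
      by (rule reach_step) (use realizes_drop_al_u S(1) w in \<open>auto simp: word_def\<close>)
    then show ?thesis using \<open>w1 = []\<close> by simp
  next
    case 2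
    have "w2 = []" using S(3,15) 2 by (cases w2 rule: rev_cases) auto
    then have w: "?w = (w1 @ [al D v]) @ [v]" using 2 al_al[OF eD] by auto
    have "reach (w1 @ [al D v])" by (rule reach_step[OF rw]) (use realizes_drop_v w S(1) in metis)
    then have "reach w1"
    proof (rule reach_step)
      fix E assume "realizes E (w1 @ [al D v])"
      moreover have "word (w1 @ [al D v])" "v \<notin> set w1" using S(1) unfolding w word_def by auto
      ultimately show "\<exists>E'. reid_step E E' \<and> realizes E' w1" by (rule realizes_drop_al_v)
    qed
    then show ?thesis using \<open>w2 = []\<close> by simp
  next
    case 3
    have "al D e \<noteq> u" using S(2,15) by (cases w1) auto
    moreover have "e \<noteq> v" using S(3,15) by (cases w2 rule: rev_cases) auto
    ultimately show ?thesis
      by (intro reach_step[OF rw] realizes_drop_bigon) (use S(1) 3 in auto)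
  qed
qed

lemma sweep_remove:
  assumes sw: "sweep w {} rho N" and w: "w \<noteq> [al D r]" and rw: "reach w"
  shows "\<exists>w' Q' rho' N'. sweep w' Q' rho' N' \<and> reach w' \<and> card N' < card N"
proof -
  note S = sweepD[OF sw]
  let ?f = "rho \<circ> al D"
  have N: "N = insert r (set w)" using S(4) by simp
  have nr: "N \<noteq> {r, al D r}"
  proof
    assume "N = {r, al D r}"
    then have "set w = {al D r}" using N S(17) al_neq[OF r_in] by auto
    then have "w = [al D r]" using S(15) by (metis distinct_card length_0_conv card.empty
        card_insert_disjoint
      empty_iff finite.emptyI length_Suc_conv list.set_intros(1) singletonD)
    then show False using w by contradiction
  qed
  have two: "2 * norb ?f N = card N + 2" using S(14) by simp
  have fixp: "\<exists>x\<in>N. ?f x = x \<and> x \<noteq> z" for z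
    using norb_few_fixpoints[OF S(21), of z] two by force
  \<comment> \<open>There is a one-dart face other than \<open>r\<close> and one other than
    \<open>al D r\<close>. If these were \<open>al D r\<close> and \<open>r\<close> themselves, the
    two darts would form the whole connected map.\<close>
  obtain x where x: "x \<in> N" "?f x = x" "x \<noteq> r" "x \<noteq> al D r"
  proof -
    obtain x1 where x1: "x1 \<in> N" "?f x1 = x1" "x1 \<noteq> r" using fixp by blast
    obtain x2 where x2: "x2 \<in> N" "?f x2 = x2" "x2 \<noteq> al D r" using fixp by blast
    have "x1 \<noteq> al D r \<or> x2 \<noteq> r"
    proof (rule ccontr)
      assume "\<not> ?thesis"
      then have "rho r = al D r" "rho (al D r) = r" using x1 x2 al_al[OF r_in] by auto
      then have "{r, al D r} = N" by (intro map_connectedD[OF S(13)]) (use N S(10) al_al[OF r_in] in auto)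
      then show False using nr by simp
    qed
    then show ?thesis using that x1 x2 by blast
  qed
  define e where "e = al D x"
  have xD: "x \<in> dts D" using x(1) S(18) by blast
  have al: "al D e = x" "al D x = e" using al_al[OF xD] by (simp_all add: e_def)
  have re: "rho e = x" using x(2) by (simp add: e_def)
  have eN: "e \<in> N" "x \<in> N" using S(10) x(1) by (simp_all add: e_def)
  have er: "e \<noteq> r" using x(4) al by auto
  have ew: "e \<in> set w" "x \<in> set w" using eN er x(3) N by auto
  obtain w1 w' where w1: "w = w1 @ e # w'" using split_list[OF ew(1)] by blast
  have "follows rho e w' r" using S(12) unfolding w1 by (simp add: follows_append)
  then obtain w2 where w2: "w' = x # w2" using re x(3) by (cases w') auto
  have w12: "w = w1 @ [e, al D e] @ w2" using w1 w2 al by simp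
  have dx: "e \<noteq> x" "e \<notin> set w1" "e \<notin> set w2" "x \<notin> set w1" "x \<notin> set w2"
      "distinct (w1 @ w2)"
    using S(15) unfolding w12 al by auto
  have fol: "follows rho r w1 e" "follows rho x w2 r" using S(12) unfolding w1 w2 by (auto simp:
      follows_append)
  have inj: "rho y = rho z \<longleftrightarrow> y = z" if "y \<in> N"
      "z \<in> N" for y z using fperm_inj[OF S(11) that] .
  have rx: "rho x \<noteq> e" "rho x \<noteq> x"
  proof -
    show "rho x \<noteq> e"
    proof
      assume "rho x = e"
      then have "{e, x} = N" by (intro map_connectedD[OF S(13)]) (use eN re al in auto)
      moreover have "r \<in> N" by (simp add: N)
      ultimately have "r \<in> {e, x}" by (simp only:)
      then show False using er x(3) by simp
    qed
    show "rho x \<noteq> x" using inj[OF eN] re dx(1) by simp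
  qed
  let ?N = "N - {e, x}"
  define rho' where "rho' = skip (skip rho e) x"
  have NN: "N - {e} - {x} = ?N" by blast
  have rho': "rho' y = (if rho y = e then rho x else rho y)" if y: "y \<in> ?N" for y
  proof -
    have "rho y \<noteq> x" using inj[of y e] y eN re by auto
    then show ?thesis using re rx dx unfolding rho'_def skip_def by auto
  qed
  have perm': "fperm rho' ?N"
  proof -
    have "fperm (skip (skip rho e) x) (N - {e} - {x})"
      by (rule fperm_skip[OF fperm_skip[OF S(11) eN(1)]]) (use eN dx(1) in simp)
    then show ?thesis unfolding rho'_def NN .
  qed
  have alN: "al D y \<in> ?N" if y: "y \<in> ?N" for y
  proof -
    have yD: "y \<in> dts D" using y S(18) by blast
    then have "al D y \<noteq> e" "al D y \<noteq> x" using y al al_al[OF yD] by auto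
    then show ?thesis using S(10) y by blast
  qed
  \<comment> \<open>The face \<open>{x}\<close> disappears, and \<open>e\<close> drops out of
    another face, which survives.\<close>
  have fc': "Suc (norb (rho' \<circ> al D) ?N) = norb ?f N"
  proof -
    have fx: "?f x = x" "?f e = rho x" using x(2) al by auto
    have p: "fperm ?f (N - {x})"
      by (rule fperm_Diff(1)[OF S(21)]) (use eN fx in simp_all)
    have "norb ?f N = Suc (norb ?f (N - {x}))" by (rule norb_remove_fixpoint[OF S(21) eN(2) fx(1)])
    moreover have "norb (skip ?f e) (N - {x} - {e}) = norb ?f (N - {x})"
      by (rule norb_skip[OF p]) (use eN dx fx rx in auto)
    moreover have "norb (rho' \<circ> al D) ?N = norb (skip ?f e) ?N"
    proof (rule norb_cong)
      show "(rho' \<circ> al D) y \<in> ?N" if "y \<in> ?N" for y using fperm_in[OF perm' alN[OF that]]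
          by simp
      show "(rho' \<circ> al D) y = skip ?f e y" if "y \<in> ?N" for y
        using rho'[OF alN[OF that]] fx by (simp add: skip_def)
    qed
    moreover have "N - {x} - {e} = ?N" by blast
    ultimately show ?thesis by simp
  qed
  have conn: "T = ?N" if T: "T \<subseteq> ?N"
      "T \<noteq> {}" and cl: "\<And>y. y \<in> T \<Longrightarrow> rho' y \<in> T \<and> al D y \<in> T"
      for T
  proof (cases "\<exists>y\<in>T. rho y = e")
    case True
    then obtain y where y: "y \<in> T" "rho y = e" by blast
    then have rxT: "rho x \<in> T" using cl[OF y(1)] rho'[OF subsetD[OF T(1) y(1)]] by simp
    have "T \<union> {e, x} = N"
    proof (rule map_connectedD[OF S(13)])
      show "T \<union> {e, x} \<subseteq> N" using T eN by blast
      fix z assume z: "z \<in> T \<union> {e, x}"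
      show "rho z \<in> T \<union> {e, x} \<and> al D z \<in> T \<union> {e, x}"
      proof (cases "z \<in> T")
        case True
        then have "rho' z \<in> T" "al D z \<in> T" "z \<in> ?N" using cl T by auto
        then show ?thesis using rho'[of z] by (auto split: if_splits)
      next
        case False
        then show ?thesis using z rxT re al by auto
      qed
    qed simp
    then show ?thesis using T by blast
  next
    case False
    have "T = N"
    proof (rule map_connectedD[OF S(13)])
      show "T \<subseteq> N" "T \<noteq> {}" using T by auto
      show "rho y \<in> T \<and> al D y \<in> T" if "y \<in> T" for y
        using cl[OF that] rho'[OF subsetD[OF T(1) that]] False that by auto
    qed
    then show ?thesis using T eN by blast
  qed
  have cN: "card N = card ?N + 2"
  proof -
    have "card ?N = card N - card {e, x}" by (rule card_Diff_subset) (use eN in auto)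
    moreover have "card {e, x} \<le> card N" by (rule card_mono[OF S(19)]) (use eN in auto)
    ultimately show ?thesis using dx by simp
  qed
  have fol': "follows rho' r (w1 @ w2) r"
  proof -
    have r1: "rho' y = (if rho y = e then rho x else rho y)" if "y \<in> insert r (set w1)" for y
      by (rule rho') (use that N w12 dx er x(3) in auto)
    have r2: "rho' y = rho y" if y: "y \<in> set w2" for y
    proof -
      have "y \<in> ?N" using y N w12 dx by auto
      moreover have "rho y \<noteq> e" using follows_mem[OF fol(2), of y] y dx er by auto
      ultimately show ?thesis using rho' by simp
    qed
    have "follows rho' r w1 (rho x)"
      by (rule follows_redirect[OF fol(1)]) (use dx r1 in auto)
    then show ?thesis using fol(2) r2 follows_cong[of "rho x" "tl w2" rho' rho r]
      by (cases w2) (auto simp: follows_append)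
  qed
  have "sweep (w1 @ w2) {} rho' ?N"
  proof (rule sweepI)
    show "word (w1 @ w2)" using S(1) unfolding w12 word_def by auto
    show "hd (w1 @ w2) = u" if "u \<in> set (w1 @ w2)"
    proof -
      have "hd w = u" "u \<noteq> e" using S(2) that dx unfolding w12 by auto
      then show ?thesis unfolding w12 by (cases w1) auto
    qed
    show "last (w1 @ w2) = v" if "v \<in> set (w1 @ w2)"
    proof -
      have "last w = v" "v \<noteq> x" using S(3) that dx unfolding w12 by auto
      then show ?thesis unfolding w12 using al by (cases w2 rule: rev_cases) (auto simp: last_append)
    qed
    show "?N = insert r (set (w1 @ w2)) \<union> {}" unfolding N w12 using al dx er x(3) by auto
    show "4 * norb (rho' \<circ> al D) ?N + card {} = 2 * card ?N + 4" using two fc' cN by simp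
  qed (rule perm' fol' map_connectedI[OF conn] alN | assumption | simp)+
  moreover have "reach (w1 @ w2)" by (rule reach_drop) (use sw rw w12 in simp_all)
  ultimately show ?thesis using cN by (metis less_add_same_cancel1 zero_less_numeral)
qed

text \<open>Both reductions decrease \<open>card N\<close>, and neither applies only when nothing is
  left unswept and the word is \<open>[al D r]\<close>.\<close>

lemma sweep_all:
  assumes "sweep w Q rho N" "reach w"
  shows "reach [al D r]"
  using assms
proof (induction "card N" arbitrary: w Q rho N rule: less_induct)
  case less
  show ?case
  proof (cases "w = [al D r] \<and> Q = {}")
    case True
    then show ?thesis using less.prems by simp
  next
    case False
    then have "\<exists>w' Q' rho' N'. sweep w' Q' rho' N' \<and> reach w' \<and> card N' < card N"
      using sweep_contract[OF less.prems(1) _ less.prems(2)] sweep_remove[of w rho N] less.prems by blast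
    then show ?thesis using less.hyps by blast
  qed
qed

end

section \<open>Moving the marked point\<close>

context swept_crossing
begin

lemma realizes_kink_add:
  assumes E: "realizes E w" and w: "e \<notin> set w" "set w' = insert e (set w)"
    and x: "{x1, x2, x3, x4} = {1, 2, 3, 4} \<times> {e}" "distinct [x1, x2, x3, x4]"
      "rot x1 = x2" "rot x2 = x3" "rot x3 = x4" "rot x4 = x1"
    and st: "(s, t) \<in> links w"
    and sub: "half_links w' \<subseteq> (links w - {(s, t), (t, s)}) \<union>
      {(s, x1), (x1, s), (x2, x3), (x3, x2), (x4, t), (t, x4)}" (is "_ \<subseteq> ?R")
  shows "\<exists>E'. reid_step E E' \<and> realizes E' w'"
proof -
  let ?X = "{x1, x2, x3, x4}"
  have lev: "level x2 = (\<not> level x1)" "level x3 = level x1" "level x4 = (\<not> level x1)"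
  proof -
    have "level (rot p) = (\<not> level p)" if "p \<in> {1, 2, 3, 4} \<times> {e}" for p
      using that by (auto simp: rot_simps level_simps)
    then have "\<forall>p\<in>?X. level (rot p) = (\<not> level p)" unfolding x(1) by blast
    then show "level x2 = (\<not> level x1)" "level x3 = level x1"
        "level x4 = (\<not> level x1)" using x(3-5) by auto
  qed
  have idx: "index w' = index w \<union> ?X" unfolding x(1) index_def w(2) by blast
  have disj: "?X \<inter> index w = {}" unfolding x(1) index_def using w(1) by auto
  have L: "links w' \<subseteq> ?R"
  proof (rule links_subset[OF sub])
    fix p q assume "(p, q) \<in> ?R"
    then show "(q, p) \<in> ?R" using links_sym[of p q w] by auto
  qed
  obtain psi where P: "presents E psi (index w) marked rot (links w) level"
    using E unfolding realizes_def by blast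
  show ?thesis
    using presents_kink_add[OF P st x(2) disj x(3-6) refl lev L] unfolding realizes_def idx by blast
qed

text \<open>A kink on the first piece of the strand makes it cross the edge of \<open>u\<close> near
  its base. This prepares the initial word.\<close>

lemma realizes_add_u:
  assumes "realizes E w" "word w" "u \<notin> set w"
  shows "\<exists>E'. reid_step E E' \<and> realizes E' (u # w)"
proof -
  let ?y = "al D u"
  have y: "?y \<noteq> u" "?y \<noteq> v" "?y \<in> dts D" using al_neq al_u_neq_v al_in c_in by auto
  have fr: "front (u # w) d = front w d" if "d \<noteq> u" for d using that by (simp add: front_def)
  have bv: "base_partner (u # w) v = base_partner w v"
    using c_neq al_u_neq_v by (simp add: base_partner_def fr)
  have bu: "base_partner (u # w) u = (1, u)" "base_partner w u = front w ?y"
    using assms(3) by (simp_all add: base_partner_def)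
  let ?q = "chain_start w (base_partner w v)" and ?t = "front w ?y"
  have ch: "chain (base_partner (u # w) u) (u # w) (base_partner (u # w) v) =
      {((1, u), (2, u)), ((4, u), ?q)} \<union> chain_tail w (base_partner w v)"
    unfolding bu bv by (simp add: chain_start_tail[of _ w])
  have ch': "chain (base_partner w u) w (base_partner w v) = insert (?t, ?q) (chain_tail w (base_partner
      w v))"
    unfolding bu by (simp add: chain_start_tail[of _ w])
  have hf: "has_front w d \<longleftrightarrow> d \<noteq> u \<and> has_front (u # w) d" for d using
      assms(3) c_neq by (auto simp: has_front_def)
  have t_tag: "?t = (0, ?y) \<and> ?y \<notin> set w \<or> ?t = (3, ?y)" by (simp add: front_def)
  \<comment> \<open>The tags identify the cut edge: none of the edges that are kept joins
    \<open>?q\<close> and \<open>?t\<close>.\<close>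
  have q_tag: "fst ?q \<noteq> 4" "?q \<noteq> (1, d)" if "d \<noteq> v" for d
    using that by (cases w; auto simp: base_partner_def front_def)+
  show ?thesis
  proof (rule realizes_kink_add[OF assms(1), where e = u and s = ?q and t = ?t and ?x1.0 = "(4, u)" and
      ?x2.0 = "(1, u)" and ?x3.0 = "(2, u)" and ?x4.0 = "(3, u)"])
    show "(?q, ?t) \<in> links w" unfolding links_def half_links_def ch' by blast
    show "half_links (u # w) \<subseteq> (links w - {(?q, ?t), (?t, ?q)}) \<union>
      {(?q, (4, u)), ((4, u), ?q), ((1, u), (2, u)), ((2, u), (1, u)), ((3, u), ?t), (?t, (3, u))}" (is
          "_ \<subseteq> ?R")
    proof (rule half_links_subset)
      fix d assume d: "d \<in> set (u # w)" "d \<noteq> u" "d \<noteq> v"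
      then have "((0, d), (1, d)) \<in> links w" using linksI(1)[of d w] unfolding links_def by auto
      moreover have "((0, d), (1, d)) \<notin> {(?q, ?t), (?t, ?q)}"
        using t_tag q_tag(2)[OF d(3)] d by auto
      ultimately show "((0, d), (1, d)) \<in> ?R" by blast
    next
      fix d assume d: "d \<in> dts D" "has_front (u # w) d" "has_front (u # w) (al D d)"
      consider "d = u" | "al D d = u" | "d \<noteq> u" "al D d \<noteq> u" by blast
      then show "(front (u # w) d, front (u # w) (al D d)) \<in> ?R"
      proof cases
        case 1
        then have "front (u # w) d = (3, u)"
            "front (u # w) (al D d) = ?t" using fr y by (simp_all add: front_def)
        then show ?thesis by simp
      next
        case 2
        then have "d = ?y" using al_al[OF d(1)] by simp
        then have "front (u # w) (al D d) = (3, u)"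
            "front (u # w) d = ?t" using fr y 2 by (simp_all add: front_def)
        then show ?thesis by simp
      next
        case 3
        have "(front w d, front w (al D d)) \<in> links w"
          using linksI(2)[OF d(1)] d 3 hf unfolding links_def by simp
        moreover have "d \<noteq> ?y" "al D d \<noteq> ?y" using 3 al_eq[OF d(1) c_in(1)] al_al[OF d(1)]
            al_al[OF c_in(1)] by metis+
        then have "front w d \<noteq> ?t" "front w (al D d) \<noteq> ?t" by (auto simp: front_def)
        ultimately show ?thesis using fr 3 by auto
      qed
    next
      have "(p, p') \<in> ?R" if pp: "(p, p') \<in> chain_tail w (base_partner w v)" for p p'
      proof -
        have L: "(p, p') \<in> links w" using pp unfolding links_def half_links_def ch' by blast
        have p4: "fst p = 4" using chain_tail_cases[OF pp] by simp
        have "p \<noteq> ?q" using p4 q_tag(1)[OF c_neq(3)] by metis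
        moreover have "p \<noteq> ?t" using p4 t_tag by auto
        ultimately have "(p, p') \<notin> {(?q, ?t), (?t, ?q)}" by simp
        then show ?thesis by (rule UnI1[OF DiffI[OF L]])
      qed
      then have "chain_tail w (base_partner w v) \<subseteq> ?R" by (rule subrelI)
      moreover have "{((1, u), (2, u)), ((4, u), ?q)} \<subseteq> ?R" by simp
      ultimately show "chain (base_partner (u # w) u) (u # w) (base_partner (u # w) v) \<subseteq> ?R"
        unfolding ch by (rule Un_least[rotated])
    qed
  qed (use assms in \<open>auto simp: rot_simps\<close>)
qed

text \<open>The same kink on the last piece of the strand.\<close>

lemma realizes_add_v:
  assumes "realizes E w" "word w" "v \<notin> set w"
  shows "\<exists>E'. reid_step E E' \<and> realizes E' (w @ [v])"
proof -
  let ?z = "al D v" and ?w = "w @ [v]"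
  have z: "?z \<noteq> u" "?z \<noteq> v" "?z \<in> dts D" using al_neq al_u_neq_v al_in c_in by auto
  have fr: "front ?w d = front w d" if "d \<noteq> v" for d using that by (simp add: front_def)
  have bu: "base_partner ?w u = base_partner w u"
    using c_neq al_u_neq_v by (simp add: base_partner_def fr)
  have bv: "base_partner ?w v = (1, v)" "base_partner w v = front w ?z"
    using assms(3) by (simp_all add: base_partner_def)
  let ?q = "chain_end (base_partner w u) w" and ?s = "front w ?z"
  have ch: "chain (base_partner ?w u) ?w (base_partner ?w v) =
      {((4, v), (1, v)), (?q, (2, v))} \<union> chain_init (base_partner w u) w"
    unfolding bu bv chain_append by (auto simp: chain_def)
  have ch': "chain (base_partner w u) w (base_partner w v) = insert (?q, ?s) (chain_init (base_partner w
      u) w)"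
    unfolding bv chain_def ..
  have hf: "has_front w d \<longleftrightarrow> d \<noteq> v \<and> has_front ?w d" for d using assms(3)
      c_neq by (auto simp: has_front_def)
  have s_tag: "?s = (0, ?z) \<and> ?z \<notin> set w \<or> ?s = (3, ?z)" by (simp add: front_def)
  have b_tag: "fst (base_partner w u) \<noteq> 2"
      "d \<noteq> u \<Longrightarrow> base_partner w u \<noteq> (1, d)" for d
    by (simp_all add: base_partner_def front_def)
  have q_tag: "fst ?q \<noteq> 2" "d \<noteq> u \<Longrightarrow> ?q \<noteq> (1, d)" for d
    using chain_end_cases[of "base_partner w u" w] b_tag by (elim disjE; force)+
  show ?thesis
  proof (rule realizes_kink_add[OF assms(1), where e = v and s = ?s and t = ?q and ?x1.0 = "(3, v)" and
      ?x2.0 = "(4, v)" and ?x3.0 = "(1, v)" and ?x4.0 = "(2, v)"])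
    show "(?s, ?q) \<in> links w" unfolding links_def half_links_def ch' by blast
    show "half_links ?w \<subseteq> (links w - {(?s, ?q), (?q, ?s)}) \<union>
      {(?s, (3, v)), ((3, v), ?s), ((4, v), (1, v)), ((1, v), (4, v)), ((2, v), ?q), (?q, (2, v))}" (is
          "_ \<subseteq> ?R")
    proof (rule half_links_subset)
      fix d assume d: "d \<in> set ?w" "d \<noteq> u" "d \<noteq> v"
      then have "((0, d), (1, d)) \<in> links w" using linksI(1)[of d w] unfolding links_def by auto
      moreover have "((0, d), (1, d)) \<notin> {(?s, ?q), (?q, ?s)}"
        using s_tag q_tag(2)[OF d(2)] d by auto
      ultimately show "((0, d), (1, d)) \<in> ?R" by blast
    next
      fix d assume d: "d \<in> dts D" "has_front ?w d" "has_front ?w (al D d)"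
      consider "d = v" | "al D d = v" | "d \<noteq> v" "al D d \<noteq> v" by blast
      then show "(front ?w d, front ?w (al D d)) \<in> ?R"
      proof cases
        case 1
        then have "front ?w d = (3, v)" "front ?w (al D d) = ?s" using fr z by (simp_all add: front_def)
        then show ?thesis by simp
      next
        case 2
        then have "d = ?z" using al_al[OF d(1)] by simp
        then have "front ?w (al D d) = (3, v)" "front ?w d = ?s" using fr z 2 by (simp_all add: front_def)
        then show ?thesis by simp
      next
        case 3
        have "(front w d, front w (al D d)) \<in> links w"
          using linksI(2)[OF d(1)] d 3 hf unfolding links_def by simp
        moreover have "d \<noteq> ?z" "al D d \<noteq> ?z" using 3 al_eq[OF d(1) c_in(3)] al_al[OF d(1)]
            al_al[OF c_in(3)] by metis+
        then have "front w d \<noteq> ?s" "front w (al D d) \<noteq> ?s" by (auto simp: front_def)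
        ultimately show ?thesis using fr 3 by auto
      qed
    next
      have "(p, p') \<in> ?R" if pp: "(p, p') \<in> chain_init (base_partner w u) w" for p p'
      proof -
        have L: "(p, p') \<in> links w" using pp unfolding links_def half_links_def ch' by blast
        have p2: "fst p' = 2" using chain_init_cases[OF pp] by auto
        have "p' \<noteq> ?q" using p2 q_tag(1) by metis
        moreover have "p' \<noteq> ?s" using p2 s_tag by auto
        ultimately have "(p, p') \<notin> {(?s, ?q), (?q, ?s)}" by simp
        then show ?thesis by (rule UnI1[OF DiffI[OF L]])
      qed
      then have "chain_init (base_partner w u) w \<subseteq> ?R" by (rule subrelI)
      moreover have "{((4, v), (1, v)), (?q, (2, v))} \<subseteq> ?R" by simp
      ultimately show "chain (base_partner ?w u) ?w (base_partner ?w v) \<subseteq> ?R"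
        unfolding ch by (rule Un_least[rotated])
    qed
  qed (use assms in \<open>auto simp: rot_simps\<close>)
qed

text \<open>Both \<open>insert_bp D r\<close> and \<open>insert_bp D l\<close> are presented by placing the darts of the crossing of \<open>r\<close> at
  the single crossing of the word \<open>[y]\<close>; they differ in the order of the two darts of the marked point.\<close>
lemma presents_insert_bp:
  assumes d: "d \<in> dts D" and AB: "{A, B} = {Suc (Max (dts D)), Suc (Suc (Max (dts D)))}"
    and L: "\<And>p q. (p, q) \<in> links [y] \<Longrightarrow> al (insert_bp D d) (psi p) = psi q"
    and psi: "psi = (\<lambda>p. if fst p = 0 then (if snd p = r then A else if snd p = l then B else snd p)
      else if fst p = 1 then r else if fst p = 2 then u else if fst p = 3 then l else v)"
    and y: "y \<in> dts D"
  shows "presents (insert_bp D d) psi (index [y]) marked rot (links [y]) level"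
proof -
  let ?E = "insert_bp D d"
  have nAB: "A \<noteq> B" "B \<noteq> A" using AB by (auto simp: doubleton_eq_iff)
  have fresh: "x \<noteq> A" "x \<noteq> B" "A \<noteq> x" "B \<noteq> x" if "x \<in> dts D" for x
  proof -
    have "x \<le> Max (dts D)" by (rule Max_ge[OF pre_finite[OF pre] that])
    then have "x \<notin> {A, B}" unfolding AB by auto
    then show "x \<noteq> A" "x \<noteq> B" "A \<noteq> x" "B \<noteq> x" by auto
  qed
  have dE: "dts ?E = dts D \<union> {A, B}" unfolding AB by (simp add: insert_bp_def Let_def)
  have sgE: "sg ?E A = B" "sg ?E B = A" using AB by (auto simp: insert_bp_def Let_def doubleton_eq_iff)
  have sgo: "sg ?E x = sg D x" "ov ?E x = ov D x" if "x \<in> dts D" for x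
  proof -
    have "x \<le> Max (dts D)" by (rule Max_ge[OF pre_finite[OF pre] that])
    then show "sg ?E x = sg D x" "ov ?E x = ov D x" by (auto simp: insert_bp_def Let_def)
  qed
  have ovc: "ov D r = (\<not> ov D u)" "ov D l = (\<not> ov D u)" "ov D v = ov D u"
    using planar r_in c_in sg_c vdeg4 unfolding planar_diagram_def crossing_data_def by metis+
  have idx: "index [y] = {(0, r), (0, l), (1, y), (2, y), (3, y), (4, y)} \<union> {0} \<times> (dts D -
      {r, u, l, v})"
  proof -
    have d: "dts D - {u, v} = {r, l} \<union> (dts D - {r, u, l, v})" using r_in c_in c_neq by auto
    have 0: "{0 :: nat} \<times> {r, l} = {(0, r), (0, l)}"
      "{1 :: nat, 2, 3, 4} \<times> set [y] = {(1, y), (2, y), (3, y), (4, y)}" by auto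
    show ?thesis unfolding index_def d Sigma_Un_distrib2 0 by (simp add: insert_commute)
  qed
  have p: "psi (0, r) = A" "psi (0, l) = B" "psi (1, y) = r" "psi (2, y) = u" "psi (3, y) = l"
      "psi (4, y) = v"
    "psi (Suc 0, y) = r"
    using c_neq by (simp_all add: psi)
  have po: "psi (0, x) = x" if "x \<noteq> r" "x \<noteq> l" for x using that by (simp add: psi)
  show ?thesis
  proof (rule presentsI)
    show "based_diagram ?E" by (rule insert_bp_based[OF knot d])
    have "bij_betw psi {(0, r), (0, l), (1, y), (2, y), (3, y), (4, y)} {A, B, r, u, l, v}"
      unfolding bij_betw_def inj_on_def
      by (simp add: p nAB fresh[OF r_in] fresh[OF c_in(1)] fresh[OF c_in(2)] fresh[OF c_in(3)] c_neq)
    moreover have "bij_betw psi ({0} \<times> (dts D - {r, u, l, v})) (dts D - {r, u, l, v})"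
    proof -
      have "bij_betw snd ({0 :: nat} \<times> (dts D - {r, u, l, v})) (dts D - {r, u, l, v})"
        by (auto simp: bij_betw_def inj_on_def)
      moreover have "psi q = snd q" if "q \<in> {0} \<times> (dts D - {r, u, l, v})" for q
        using that po[of "snd q"] by auto
      ultimately show ?thesis using bij_betw_cong[of _ psi snd] by blast
    qed
    moreover have "{A, B, r, u, l, v} \<inter> (dts D - {r, u, l, v}) = {}"
    proof -
      have "A \<notin> dts D" "B \<notin> dts D" using fresh by blast+
      then show ?thesis by blast
    qed
    ultimately have "bij_betw psi (index [y]) ({A, B, r, u, l, v} \<union> (dts D - {r, u, l, v}))"
      unfolding idx by (rule bij_betw_combine)
    moreover have "{A, B, r, u, l, v} \<union> (dts D - {r, u, l, v}) = dts ?E" unfolding dE using r_in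
        c_in by auto
    ultimately show "bij_betw psi (index [y]) (dts ?E)" by simp
    fix q assume q: "q \<in> index [y]"
    show "rot q \<in> index [y]" by (rule rot_index[OF q])
    have "q \<in> {(0, r), (0, l), (1, y), (2, y), (3, y), (4, y)} \<or> (\<exists>x. q = (0, x) \<and> x
        \<in> dts D \<and> x \<notin> {r, u, l, v})"
      using q unfolding idx by auto
    then have "sg ?E (psi q) = psi (rot q) \<and> (q \<notin> marked \<longrightarrow> ov ?E (psi q) =
        level q)"
    proof
      assume "q \<in> {(0, r), (0, l), (1, y), (2, y), (3, y), (4, y)}"
      then show ?thesis
        by (elim insertE emptyE)
          (simp_all add: p sgE rot_simps level_simps marked_def rot_def[of "(0, _)"] sgo r_in c_in sg_c
              ovc c_neq)
    next
      assume "\<exists>x. q = (0, x) \<and> x \<in> dts D \<and> x \<notin> {r, u, l, v}"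
      then obtain x where x: "q = (0, x)" "x \<in> dts D" "x \<notin> {r, u, l, v}" by blast
      have "sg D x \<noteq> r \<and> sg D x \<noteq> l" using x sg4(1)[OF x(2)] sg_c by auto
      then show ?thesis using x by (simp add: po sgo rot_def level_def)
    qed
    then show "sg ?E (psi q) = psi (rot q)"
        "q \<notin> marked \<Longrightarrow> ov ?E (psi q) = level q" by auto
  next
    fix p q assume "(p, q) \<in> links [y]"
    then show "p \<in> index [y] \<and> q \<in> index [y] \<and> al ?E (psi p) = psi q"
      using links_index[of "[y]"] L y by auto
  qed
qed

lemma al_insert_bp:
  assumes d: "d \<in> dts D"
  shows "al (insert_bp D d) d = Suc (Max (dts D))" "al (insert_bp D d) (Suc (Max (dts D))) = d"
    "al (insert_bp D d) (Suc (Suc (Max (dts D)))) = al D d"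
        "al (insert_bp D d) (al D d) = Suc (Suc (Max (dts D)))"
    "x \<in> dts D \<Longrightarrow> x \<noteq> d \<Longrightarrow> x \<noteq> al D d \<Longrightarrow>
        al (insert_bp D d) x = al D x"
proof -
  have le: "x \<le> Max (dts D)" if "x \<in> dts D" for x by (rule Max_ge[OF pre_finite[OF pre] that])
  note al = le[OF d] le[OF al_in[OF d]] al_neq[OF d]
  show "al (insert_bp D d) d = Suc (Max (dts D))" "al (insert_bp D d) (Suc (Max (dts D))) = d"
    "al (insert_bp D d) (Suc (Suc (Max (dts D)))) = al D d"
        "al (insert_bp D d) (al D d) = Suc (Suc (Max (dts D)))"
    using al by (auto simp: insert_bp_def Let_def)
  show "al (insert_bp D d) x = al D x" if "x \<in> dts D" "x \<noteq> d" "x \<noteq> al D d"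
    using that le[OF that(1)] by (auto simp: insert_bp_def Let_def)
qed

text \<open>As \<open>al\<close> is an involution, each edge has to be checked in one direction
  only.\<close>

lemma half_links_al:
  assumes E: "pre_diagram E" and half: "\<And>p q. (p, q) \<in> half_links w \<Longrightarrow> psi p
      \<in> dts E \<and> al E (psi p) = psi q"
    and L: "(p, q) \<in> links w"
  shows "al E (psi p) = psi q"
proof (cases "(p, q) \<in> half_links w")
  case False
  then have "(q, p) \<in> half_links w" using L unfolding links_def by auto
  then show ?thesis using half pre_al_al[OF E] by metis
qed (use half in simp)

lemma half_links_singleE:
  assumes "(p, q) \<in> half_links [y]"
  obtains "p = (0, y)" "q = (1, y)"
    | d where "p = front [y] d" "q = front [y] (al D d)" "d \<in> dts D"
    | "p = base_partner [y] u" "q = (2, y)" | "p = (4, y)" "q = base_partner [y] v"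
  using assms(1) unfolding half_links_def
proof (elim UnE)
  assume "(p, q) \<in> {((0, d), (1, d)) | d. d \<in> set [y] \<and> d \<noteq> u \<and> d \<noteq> v}"
  then have "p = (0, y) \<and> q = (1, y)" by auto
  then show thesis using that(1) by blast
next
  assume "(p, q) \<in> {(front [y] d, front [y] (al D d)) | d. d \<in> dts D \<and> has_front [y] d
      \<and> has_front [y] (al D d)}"
  then obtain d where "p = front [y] d" "q = front [y] (al D d)" "d \<in> dts D" by blast
  then show thesis by (rule that(2))
next
  assume "(p, q) \<in> chain (base_partner [y] u) [y] (base_partner [y] v)"
  then have "p = base_partner [y] u \<and> q = (2, y) \<or> p = (4, y) \<and> q = base_partner [y] v" by
      simp
  then show thesis using that(3,4) by blast
qed

lemma pre_insert_bp: "d \<in> dts D \<Longrightarrow> pre_diagram (insert_bp D d)"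
  using insert_bp_based[OF knot] unfolding based_diagram_iff planar_diagram_def by blast

text \<open>Seen from the marked point, the crossing of \<open>insert_bp D r\<close> sits on the
  edge of \<open>l\<close>. Its dart \<open>r\<close> looks back at the marked point and becomes
  \<open>(1, l)\<close>; the dart \<open>?p1\<close> joined to it becomes
  \<open>(0, l)\<close>.\<close>

lemma presents_insert_bp_r:
  "\<exists>psi. presents (insert_bp D r) psi (index [l]) marked rot (links [l]) level"
proof -
  let ?E = "insert_bp D r" and ?p1 = "Suc (Max (dts D))" and ?p2 = "Suc (Suc (Max (dts D)))"
  define psi where "psi = (\<lambda>p :: nat \<times> nat. if fst p = 0 then (if snd p = r then ?p2 else
      if snd p = l then ?p1 else snd p)
      else if fst p = 1 then r else if fst p = 2 then u else if fst p = 3 then l else v)"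
  note A = al_insert_bp[OF r_in]
  have dE: "dts ?E = dts D \<union> {?p1, ?p2}" by (simp add: insert_bp_def Let_def)
  have are: "al D r \<noteq> r" "al D (al D r) = r" using al_neq[OF r_in] al_al[OF r_in] by auto
  have f: "psi (front [l] x) = (if x = r then ?p2 else x)" for x
    using c_neq by (auto simp: psi_def front_def)
  have al: "al ?E (if x = r then ?p2 else x) = (if al D x = r then ?p2 else al D x)" if x: "x \<in> dts
      D" for x
  proof -
    have "al D x = r \<longleftrightarrow> x = al D r" by (rule al_eq[OF x r_in])
    then show ?thesis using A x are by auto
  qed
  have "al ?E (psi p) = psi q" if "(p, q) \<in> links [l]" for p q
  proof (rule half_links_al[OF pre_insert_bp[OF r_in] _ that])
    fix p q assume "(p, q) \<in> half_links [l]"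
    then show "psi p \<in> dts ?E \<and> al ?E (psi p) = psi q"
    proof (cases rule: half_links_singleE)
      case 1
      then show ?thesis using A(2) c_neq by (simp add: psi_def dE)
    next
      case 2
      then show ?thesis using al[OF 2(3)] by (simp add: f dE)
    next
      case 3
      then have "p = front [l] (al D u)" using c_neq by (simp add: base_partner_def)
      then show ?thesis using 3 al[OF al_in[OF c_in(1)]] al_in[OF c_in(1)] al_al[OF c_in(1)] c_neq
        by (simp add: f dE) (simp add: psi_def)
    next
      case 4
      then have "q = front [l] (al D v)" using c_neq by (simp add: base_partner_def)
      moreover have "psi p = v" using 4 by (simp add: psi_def)
      ultimately show ?thesis using al[OF c_in(3)] c_in c_neq by (simp add: f dE)
    qed
  qed
  then have "presents ?E psi (index [l]) marked rot (links [l]) level"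
    by (intro presents_insert_bp[OF r_in _ _ psi_def c_in(2)]) auto
  then show ?thesis by blast
qed

text \<open>Here the crossing lies on the other side of the marked point, on the edge of
  \<open>r\<close>, whose letter is that of the far end. Its dart \<open>l\<close> looks at the
  marked point and becomes \<open>(3, al D r)\<close>, and \<open>?p1\<close> becomes
  \<open>(0, r)\<close>.\<close>

lemma presents_insert_bp_l:
  "\<exists>psi. presents (insert_bp D l) psi (index [al D r]) marked rot (links [al D r]) level"
proof -
  let ?E = "insert_bp D l" and ?p1 = "Suc (Max (dts D))" and ?p2 = "Suc (Suc (Max (dts D)))" and ?y = "al
      D r"
  define psi where "psi = (\<lambda>p :: nat \<times> nat. if fst p = 0 then (if snd p = r then ?p1 else
      if snd p = l then ?p2 else snd p)
      else if fst p = 1 then r else if fst p = 2 then u else if fst p = 3 then l else v)"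
  note A = al_insert_bp[OF c_in(2)]
  have dE: "dts ?E = dts D \<union> {?p1, ?p2}" by (simp add: insert_bp_def Let_def)
  have y: "?y \<noteq> r" "al D ?y = r"
      "?y \<in> dts D" using al_neq[OF r_in] al_al[OF r_in] al_in[OF r_in] by auto
  have all: "al D l \<noteq> l" "al D (al D l) = l" "al D l \<in> dts D"
    using al_neq[OF c_in(2)] al_al[OF c_in(2)] al_in[OF c_in(2)] by auto
  have f: "psi (front [?y] x) = (if x = ?y then l else if x = r then ?p1 else if x = l then ?p2 else x)"
      for x
    using c_neq by (auto simp: psi_def front_def)
  have al: "al ?E (psi (front [?y] x)) = psi (front [?y] (al D x))" if x: "x \<in> dts D" for x
  proof -
    have e: "al D x = r \<longleftrightarrow> x = ?y" "al D x = l \<longleftrightarrow> x = al D l"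
        "al D x = ?y \<longleftrightarrow> x = r"
      using al_eq[OF x r_in] al_eq[OF x c_in(2)] al_eq[OF x y(3)] y(2) by auto
    consider "x = ?y" | "x = r" | "x = l" "x \<noteq> ?y" "x \<noteq> r" | "x = al D l" "x \<noteq> ?y"
        "x \<noteq> r" "x \<noteq> l"
      | "x \<noteq> ?y" "x \<noteq> r" "x \<noteq> l" "x \<noteq> al D l" by blast
    then show ?thesis
    proof cases
      case 1 then show ?thesis using A(1) y by (simp add: f)
    next
      case 2 then show ?thesis using A(2) y(1)[symmetric] by (simp add: f)
    next
      case 3 then show ?thesis using A(3) e all by (simp add: f)
    next
      case 4 then show ?thesis using A(4) e all by (simp add: f)
    next
      case 5 then show ?thesis using A(5)[OF x] e by (simp add: f)
    qed
  qed
  have fE: "psi (front [?y] x) \<in> dts ?E" if "x \<in> dts D" for x using that c_in by (simp add: f dE)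
  have psi_y: "psi (1, ?y) = r" "psi (2, ?y) = u" "psi (4, ?y) = v" by (simp_all add: psi_def)
  have base: "psi (base_partner [?y] d) \<in> dts ?E \<and> al ?E (psi (base_partner [?y] d)) = d \<and>
      al ?E d = psi (base_partner [?y] d)"
    if d: "d \<in> {u, v}" for d
  proof -
    have dD: "d \<in> dts D" "d \<noteq> r" "d \<noteq> l" using d c_in c_neq by auto
    have ad: "al D d \<in> dts D" "al D (al D d) = d" using al_in[OF dD(1)] al_al[OF dD(1)] by auto
    show ?thesis
    proof (cases "d = ?y")
      \<comment> \<open>Here the edge of \<open>r\<close> leads back to \<open>u\<close> or
        \<open>v\<close> at the same crossing, so that \<open>D\<close> has a loop there.\<close>
      case True
      then have "base_partner [?y] d = (1, ?y)" "al D d = r"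
          "al D r = d" using y by (simp_all add: base_partner_def)
      moreover have "al ?E r = al D r" "al ?E d = al D d"
        using A(5)[OF r_in] A(5)[OF dD(1)] True y all dD c_neq by (metis)+
      ultimately show ?thesis using psi_y r_in by (simp add: dE)
    next
      case False
      then have b: "base_partner [?y] d = front [?y] (al D d)" by (simp add: base_partner_def)
      have "psi (front [?y] d) = d" using False dD by (simp add: f)
      then show ?thesis using b al[OF ad(1)] al[OF dD(1)] fE[OF ad(1)] ad by simp
    qed
  qed
  have "al ?E (psi p) = psi q" if "(p, q) \<in> links [?y]" for p q
  proof (rule half_links_al[OF pre_insert_bp[OF c_in(2)] _ that])
    fix p q assume "(p, q) \<in> half_links [?y]"
    then show "psi p \<in> dts ?E \<and> al ?E (psi p) = psi q"
    proof (cases rule: half_links_singleE)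
      case 1
      have q: "psi q = r" using 1 psi_y by simp
      show ?thesis
      proof (cases "?y = l")
        case True
        then have "psi p = ?p2" "al D l = r" using 1 y by (simp_all add: psi_def)
        then show ?thesis using A(3) q by (simp add: dE)
      next
        case False
        then have "psi p = ?y" using 1 y by (simp add: psi_def)
        moreover have "?y \<noteq> al D l" using y all c_neq by metis
        ultimately show ?thesis using A(5)[OF y(3)] False y q by (simp add: dE)
      qed
    next
      case 2
      then show ?thesis using al[OF 2(3)] fE[OF 2(3)] by simp
    next
      case 3
      then show ?thesis using base[of u] psi_y by simp
    next
      case 4
      then show ?thesis using base[of v] psi_y c_in by (simp add: dE)
    qed
  qed
  then have "presents ?E psi (index [?y]) marked rot (links [?y]) level"
    by (intro presents_insert_bp[OF c_in(2) _ _ psi_def y(3)]) auto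
  then show ?thesis by blast
qed

text \<open>The two kinks let the strand go round the dissolved crossing, so that the word becomes
  its rotation and the sweep can begin.\<close>

lemma reach_start: "reach [u, l, v]"
proof -
  have "reach [l]" unfolding reach_def realizes_def using presents_insert_bp_r by blast
  then have "reach [u, l]"
    by (rule reach_step) (use realizes_add_u c_in c_neq in \<open>auto simp: word_def\<close>)
  then have "reach ([u, l] @ [v])"
    by (rule reach_step, intro realizes_add_v) (use c_in c_neq in \<open>auto simp: word_def\<close>)
  then show ?thesis by simp
qed

text \<open>Completeness of the edge list, which pins the final diagram down up to isotopy. For an
  uncrossed edge that ended at \<open>u\<close> or \<open>v\<close>, the partner of the remaining
  dart is found on the strand.\<close>

lemma links_cover:
  assumes "p \<in> index [y]" "y = al D r"
  shows "\<exists>q. (p, q) \<in> links [y] \<or> (q, p) \<in> links [y]"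
proof -
  have y: "y \<in> dts D" "al D y = r" using assms(2) al_in[OF r_in] al_al[OF r_in] by auto
  have c: "(base_partner [y] u, (2, y)) \<in> links [y]" "((4, y), base_partner [y] v) \<in> links [y]"
    unfolding links_def half_links_def by auto
  have b: "\<exists>q. (base_partner [y] d, q) \<in> links [y] \<or> (q, base_partner [y] d) \<in> links
      [y]" if "d \<in> {u, v}" for d
    using that c by auto
  consider d where "p = (0, d)" "d \<in> dts D" "d \<noteq> u"
      "d \<noteq> v" | "p = (1, y)" | "p = (2, y)" | "p = (3, y)" | "p = (4, y)"
    using assms(1) unfolding index_def by auto
  then show ?thesis
  proof cases
    case 1
    consider "d = y" | "d \<noteq> y" "has_front [y] (al D d)" | "d \<noteq> y" "al D d \<in> {u, v}"
        "al D d \<noteq> y"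
      unfolding has_front_def by auto
    then show ?thesis
    proof cases
      case 1
      then show ?thesis using linksI(1)[of y "[y]"] \<open>p = (0, d)\<close> \<open>d \<noteq> u\<close>
          \<open>d \<noteq> v\<close> unfolding links_def by auto
    next
      case 2
      have "has_front [y] d" using 1(3,4) by (simp add: has_front_def)
      then have "(front [y] d, front [y] (al D d)) \<in> links [y]"
        using linksI(2)[OF 1(2)] 2(2) unfolding links_def by blast
      moreover have "front [y] d = p" using 1(1) 2(1) by (simp add: front_def)
      ultimately show ?thesis by blast
    next
      case 3
      have "base_partner [y] (al D d) = (0, d)" using 3 al_al[OF 1(2)] by (simp add: base_partner_def
          front_def)
      then show ?thesis using b[OF 3(2)] 1(1) by simp
    qed
  next
    case 2
    show ?thesis
    proof (cases "y \<in> {u, v}")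
      case True
      have "base_partner [y] y = p" using 2 by (simp add: base_partner_def)
      then show ?thesis using b[OF True] by simp
    next
      case False
      then show ?thesis using linksI(1)[of y "[y]"] 2 unfolding links_def by auto
    qed
  next
    case 4
    have "has_front [y] y" "has_front [y] (al D y)" using y c_neq by (auto simp: has_front_def)
    then have "(front [y] y, front [y] (al D y)) \<in> links [y]"
      using linksI(2)[OF y(1)] unfolding links_def by blast
    moreover have "front [y] y = p" using 4 by (simp add: front_def)
    ultimately show ?thesis by blast
  qed (use c in blast)+
qed

text \<open>The swept diagram and \<open>insert_bp D l\<close> have the same complete presentation
  by the word \<open>[al D r]\<close>, so an isotopy finishes the passage.\<close>

lemma pass_crossing: "reid_equiv (insert_bp D r) (insert_bp D l)"
proof -
  have "reach [al D r]" by (rule sweep_all[OF sweep_start reach_start])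
  then obtain E psi where E: "reid_step\<^sup>*\<^sup>* (insert_bp D r) E"
      "presents E psi (index [al D r]) marked rot (links [al D r]) level"
    unfolding reach_def realizes_def by blast
  obtain psi' where "presents (insert_bp D l) psi' (index [al D r]) marked rot (links [al D r]) level"
    using presents_insert_bp_l by blast
  then have "diag_iso E (insert_bp D l)"
  proof (rule presents_unique[OF E(2)])
    show "\<exists>q. (p, q) \<in> links [al D r] \<or> (q, p) \<in> links [al D r]" if "p \<in> index
        [al D r]" for p
      by (rule links_cover[OF that refl])
    show "rot (rot p) = p" if "p \<in> marked" for p
    proof -
      have "p = (0, r) \<or> p = (0, l)" using that unfolding marked_def by blast
      then show ?thesis by (elim disjE) (simp_all add: rot_def[of "(0, _)"] c_neq)
    qed
  qed
  then have "reid_step E (insert_bp D l)"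
    unfolding reid_step_def using presentsD(1)[OF E(2)] insert_bp_based[OF knot c_in(2)] by blast
  then show ?thesis unfolding reid_equiv_def using E(1) by simp
qed

text \<open>Both darts name the same arc. The two diagrams differ by exchanging the names of the two
  darts at the marked point, which is an isotopy.\<close>

lemma flip_edge: "reid_equiv (insert_bp D r) (insert_bp D (al D r))"
proof -
  let ?p1 = "Suc (Max (dts D))" and ?p2 = "Suc (Suc (Max (dts D)))"
  let ?E = "insert_bp D r" and ?F = "insert_bp D (al D r)"
  define f where "f = id(?p1 := ?p2, ?p2 := ?p1)"
  have y: "al D r \<in> dts D" "al D (al D r) = r" "al D r \<noteq> r" using al_in al_al al_neq r_in by auto
  have le: "x \<noteq> ?p1" "x \<noteq> ?p2" "?p1 \<noteq> x" "?p2 \<noteq> x" if "x \<in> dts D" for x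
    using Max_ge[OF pre_finite[OF pre] that] by auto
  have f: "f ?p1 = ?p2" "f ?p2 = ?p1"
      "x \<in> dts D \<Longrightarrow> f x = x" for x using le[of x] by (simp_all add: f_def)
  have dE: "dts (insert_bp D d) = dts D \<union> {?p1, ?p2}" for d by (simp add: insert_bp_def Let_def)
  have sgp: "sg (insert_bp D d) ?p1 = ?p2"
      "sg (insert_bp D d) ?p2 = ?p1" for d by (simp_all add: insert_bp_def Let_def)
  have sgo: "sg (insert_bp D d) x = sg D x" "ov (insert_bp D d) x = ov D x" if "x \<in> dts D" for x d
    using le[OF that] by (simp_all add: insert_bp_def Let_def)
  have ovp: "ov (insert_bp D d) ?p1 = False"
      "ov (insert_bp D d) ?p2 = False" for d by (simp_all add: insert_bp_def Let_def)
  note A = al_insert_bp[OF r_in] and B = al_insert_bp[OF y(1), unfolded y(2)]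
  have "bij_betw f (dts ?E) (dts ?F)"
    unfolding dE by (rule bij_betw_byWitness[where f' = f]) (auto simp: f)
  moreover have "f (sg ?E x) = sg ?F (f x) \<and> f (al ?E x) = al ?F (f x) \<and> (vdeg ?E x = 4
      \<longrightarrow> ov ?F (f x) = ov ?E x)"
    if x: "x \<in> dts ?E" for x
  proof -
    consider "x = ?p1" | "x = ?p2" | "x = r" | "x = al D r" | "x \<in> dts D" "x \<noteq> r"
        "x \<noteq> al D r"
      using x unfolding dE by blast
    then show ?thesis
    proof cases
      case 5
      then show ?thesis using A(5) B(5) al_in by (simp add: f sgo sg_in)
    qed (simp_all add: f sgp sgo ovp A B y r_in sg_in)
  qed
  ultimately have "diag_iso ?E ?F" unfolding diag_iso_def by blast
  then have "reid_step ?E ?F"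
    unfolding reid_step_def using insert_bp_based[OF knot r_in] insert_bp_based[OF knot y(1)] by blast
  then show ?thesis unfolding reid_equiv_def by simp
qed

end

lemma reid_equiv_trans: "reid_equiv C D \<Longrightarrow> reid_equiv D E \<Longrightarrow> reid_equiv C E"
  unfolding reid_equiv_def by (rule rtranclp_trans)

text \<open>A step of \<open>straight D \<circ> al D\<close> along the knot is a change of the dart
  naming the arc followed by the passage of a crossing. By the dichotomy every dart is reached in
  this way from \<open>d\<close> or from \<open>al D d\<close>.\<close>

lemma insert_bp_reid_equiv:
  assumes knot: "knot_diagram D" and d: "d \<in> dts D" "d' \<in> dts D"
  shows "reid_equiv (insert_bp D d) (insert_bp D d')"
proof -
  let ?h = "straight D \<circ> al D"
  have pre: "pre_diagram D" and one: "one_component D"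
    using knot_diagram_planar[OF knot] unfolding planar_diagram_def by auto
  have flip: "reid_equiv (insert_bp D x) (insert_bp D (al D x))" if "x \<in> dts D" for x
    using swept_crossing.flip_edge[OF swept_crossing.intro[OF knot that]] .
  have pass: "reid_equiv (insert_bp D x) (insert_bp D (straight D x))" if x: "x \<in> dts D" for x
  proof -
    interpret swept_crossing D x by unfold_locales (rule knot, rule x)
    show ?thesis using pass_crossing straight_eq[OF x] by (simp add: l_def u_def)
  qed
  have orb: "reid_equiv (insert_bp D x) (insert_bp D y)" if x: "x \<in> dts D" and y: "y \<in> orbit ?h
      x" for x y
  proof -
    have "y \<in> dts D \<and> reid_equiv (insert_bp D x) (insert_bp D y)"
      using y
    proof (induction rule: orbit_induct)
      case self
      then show ?case using x by (simp add: reid_equiv_def)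
    next
      case (step s)
      then have s: "s \<in> dts D" "al D s \<in> dts D" using pre_al_in[OF pre] by auto
      have "reid_equiv (insert_bp D s) (insert_bp D (?h s))"
        using reid_equiv_trans[OF flip[OF s(1)] pass[OF s(2)]] by simp
      then show ?case using step straight_in[OF pre s(2)] by (auto intro: reid_equiv_trans)
    qed
    then show ?thesis by simp
  qed
  show ?thesis
    using one_component_dichotomy[OF pre one d] orb[OF d(1)] orb[OF pre_al_in[OF pre d(1)]] flip[OF d(1)]
    by (auto intro: reid_equiv_trans)
qed

theorem theorem6:
  assumes "knot_diagram D" and "a \<in> arcs D" and "a' \<in> arcs D"
  shows "\<forall>d\<in>a. \<forall>d'\<in>a'. reid_equiv (insert_bp D d) (insert_bp D d')"
proof -
  have "pre_diagram D" using knot_diagram_planar[OF assms(1)] unfolding planar_diagram_def by simp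
  then have "a \<subseteq> dts D" "a' \<subseteq> dts D" using assms(2,3) pre_al_in unfolding arcs_def by
      auto
  then show ?thesis using insert_bp_reid_equiv[OF assms(1)] by blast
qed

end
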